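(* Let $K$ be a field, $n \geq 1$, and $A = K[x_1,\ldots,x_n]$ the polynomial ring with each $\deg x_i = 1$. Let $H : \mathbb{N} \to \mathbb{N}$ be a numerical function satisfying $H(0) = 1$, $H(1) \leq n$ and $H(q+1) \leq H(q)^{\langle q \rangle}$ for all $q \geq 1$. Let $\mathcal{A}_H$ be the set of those integers $0 \leq r \leq n$ for which there exists a homogeneous ideal $I$ of $A$ with $H_{A/I} = H$ and $\operatorname{depth} A/I = r$. Then \[ \max \mathcal{A}_H = \max\{\, p \geq 0 : \Delta^p(H) \text{ takes values in } \mathbb{N} \text{ and } \Delta^p(H)(q+1) \leq \Delta^p(H)(q)^{\langle q \rangle} \text{ for all } q \geq 1 \,\}. \]
   Context: $\mathbb{N}$ is the set of nonnegative integers. For a homogeneous ideal $I \neq A$, the Hilbert function of $A/I$ is $H_{A/I}(q) = \dim_K (A/I)_q$. For integers $a \geq 1$ and $q \geq 1$, write the $q$-th Macaulay representation $a = \binom{k_q}{q} + \binom{k_{q-1}}{q-1} + \cdots + \binom{k_j}{j}$ with $k_q > k_{q-1} > \cdots > k_j \geq j \geq 1$ (it is unique), and set $a^{\langle q \rangle} = \binom{k_q+1}{q+1} + \binom{k_{q-1}+1}{q} + \cdots + \binom{k_j+1}{j+1}$; also $0^{\langle q \rangle} = 0$. By Macaulay's theorem, the conditions on $H$ are equivalent to $H = H_{A/I}$ for some homogeneous ideal $I \neq A$ of $A$. For an integer-valued function $H$ on $\mathbb{N}$ with $H(0)=1$, the differential $\Delta^1(H)$ is defined by $\Delta^1(H)(0)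 = 1$ and $\Delta^1(H)(q) = H(q) - H(q-1)$ for $q \geq 1$. Inductively $\Delta^p(H) = \Delta^1(\Delta^{p-1}(H))$, with $\Delta^0(H) = H$. *)

theory Defs
  imports
    "HOL-Library.Poly_Mapping"
    "HOL-Library.Extended_Nat"
    "HOL-Algebra.QuotRing"
    "HOL-Algebra.Embedded_Algebras"
begin

section \<open>The standard graded polynomial ring in n variables\<close>

text \<open>A monomial is a finitely supported exponent vector, indexed by the (0-based) variables;
  a polynomial is a finitely supported family of coefficients, indexed by monomials.\<close>

type_synonym monomial = "nat \<Rightarrow>\<^sub>0 nat"

type_synonym 'k mpoly = "monomial \<Rightarrow>\<^sub>0 'k"

definition mpoly_ring :: "nat \<Rightarrow> 'k::field mpoly ring" where
  "mpoly_ring n =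
    \<lparr>carrier = {p. \<forall>m\<in>Poly_Mapping.keys p. Poly_Mapping.keys m \<subseteq> {..<n}},
     mult = (*), one = 1, zero = 0, add = (+)\<rparr>"

definition const :: "'k::field \<Rightarrow> 'k mpoly" where
  "const c = Poly_Mapping.single 0 c"

definition var :: "nat \<Rightarrow> 'k::field mpoly" where
  "var i = Poly_Mapping.single (Poly_Mapping.single i 1) 1"

definition mdeg :: "monomial \<Rightarrow> nat" where
  "mdeg m = (\<Sum>i\<in>Poly_Mapping.keys m. Poly_Mapping.lookup m i)"

definition graded_part :: "nat \<Rightarrow> nat \<Rightarrow> 'k::field mpoly set" where
  "graded_part n q =
    {p \<in> carrier (mpoly_ring n). \<forall>m\<in>Poly_Mapping.keys p. mdeg m = q}"

lemma mpoly_ring_cring: "cring (mpoly_ring n :: 'k::field mpoly ring)"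
proof (rule cringI)
  let ?A = "mpoly_ring n :: 'k mpoly ring"
  have uminus: "- p \<in> carrier ?A" if "p \<in> carrier ?A" for p
    using that by (simp add: mpoly_ring_def in_keys_iff)
  have add: "p + r \<in> carrier ?A" if "p \<in> carrier ?A" "r \<in> carrier ?A" for p r
    using that Poly_Mapping.keys_add[of p r] unfolding mpoly_ring_def by fastforce
  have mult: "p * r \<in> carrier ?A" if pr: "p \<in> carrier ?A" "r \<in> carrier ?A" for p r
  proof -
    have "Poly_Mapping.keys m \<subseteq> {..<n}" if m: "m \<in> Poly_Mapping.keys (p * r)" for m
    proof -
      obtain a b where ab: "m = a + b" "a \<in> Poly_Mapping.keys p" "b \<in> Poly_Mapping.keys r"
        using m Poly_Mapping.keys_mult[of p r] by blast
      have "Poly_Mapping.keys a \<subseteq> {..<n}" "Poly_Mapping.keys b \<subseteq> {..<n}"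
        using ab pr by (simp_all add: mpoly_ring_def)
      then show ?thesis
        using Poly_Mapping.keys_add[of a b] ab(1) by blast
    qed
    then show ?thesis
      by (simp add: mpoly_ring_def)
  qed
  have ops: "p \<otimes>\<^bsub>?A\<^esub> r = p * r" "p \<oplus>\<^bsub>?A\<^esub> r = p + r" "\<one>\<^bsub>?A\<^esub> = 1" "\<zero>\<^bsub>?A\<^esub> = 0" for p r
    by (simp_all add: mpoly_ring_def)
  have units: "0 \<in> carrier ?A" "1 \<in> carrier ?A"
    by (simp_all add: mpoly_ring_def)
  show "abelian_group ?A"
  proof (rule abelian_groupI)
    fix p assume "p \<in> carrier ?A"
    then show "\<exists>r\<in>carrier ?A. r \<oplus>\<^bsub>?A\<^esub> p = \<zero>\<^bsub>?A\<^esub>"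
      by (intro bexI[of _ "- p"] uminus) (simp_all add: ops)
  qed (simp_all add: ops units add ac_simps)
  show "comm_monoid ?A"
    by (rule comm_monoidI) (simp_all add: ops units mult ac_simps)
  show "(p \<oplus>\<^bsub>?A\<^esub> r) \<otimes>\<^bsub>?A\<^esub> s = p \<otimes>\<^bsub>?A\<^esub> s \<oplus>\<^bsub>?A\<^esub> r \<otimes>\<^bsub>?A\<^esub> s" for p r s
    by (simp add: ops distrib_right)
qed

section \<open>Homogeneous ideals, Hilbert functions and depth\<close>

definition homogeneous_ideal :: "nat \<Rightarrow> 'k::field mpoly set \<Rightarrow> bool" where
  "homogeneous_ideal n I \<longleftrightarrow>
    (\<exists>G \<subseteq> (\<Union>q. graded_part n q). I = Idl\<^bsub>mpoly_ring n\<^esub> G)"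

text \<open>The dimension is taken inside the ring \<open>A/I\<close>, over the image of the constants, which is a
  subfield exactly when \<open>I \<noteq> A\<close>; hence this is only meaningful for proper \<open>I\<close>.\<close>

definition hilbert_fun :: "nat \<Rightarrow> 'k::field mpoly set \<Rightarrow> nat \<Rightarrow> nat" where
  "hilbert_fun n I q =
    (let A = mpoly_ring n; proj = (\<lambda>f. I +>\<^bsub>A\<^esub> f)
     in THE d. ring.dimension (A Quot I) d (proj ` range const) (proj ` graded_part n q))"

definition irrelevant_ideal :: "nat \<Rightarrow> 'k::field mpoly set" where
  "irrelevant_ideal n = Idl\<^bsub>mpoly_ring n\<^esub> (var ` {..<n})"

text \<open>Regular sequences on the module \<open>A/I\<close>, consisting of elements of \<open>(x\<^sub>1, \<dots>, x\<^sub>n)\<close>.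
  The quotient of \<open>A/I\<close> by the first \<open>i\<close> elements is \<open>A/J i\<close> with \<open>J i\<close> as below.\<close>

definition regular_sequence :: "nat \<Rightarrow> 'k::field mpoly set \<Rightarrow> 'k mpoly list \<Rightarrow> bool" where
  "regular_sequence n I fs \<longleftrightarrow>
    (let A = mpoly_ring n; J = (\<lambda>i. Idl\<^bsub>A\<^esub> (I \<union> set (take i fs)))
     in set fs \<subseteq> irrelevant_ideal n \<and>
        (\<forall>i<length fs. \<forall>g\<in>carrier A. fs ! i \<otimes>\<^bsub>A\<^esub> g \<in> J i \<longrightarrow> g \<in> J i) \<and>
        J (length fs) \<noteq> carrier A)"

text \<open>The depth of \<open>A/I\<close>, that is, the grade of \<open>(x\<^sub>1, \<dots>, x\<^sub>n)\<close> on \<open>A/I\<close>.\<close>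

definition depth :: "nat \<Rightarrow> 'k::field mpoly set \<Rightarrow> enat" where
  "depth n I = (SUP fs \<in> {fs. regular_sequence n I fs}. enat (length fs))"

section \<open>Macaulay representations and differentials\<close>

definition macaulay_rep :: "nat \<Rightarrow> nat \<Rightarrow> nat \<Rightarrow> (nat \<Rightarrow> nat) \<Rightarrow> bool" where
  "macaulay_rep a q j k \<longleftrightarrow>
    1 \<le> j \<and> j \<le> q \<and> (\<forall>i\<in>{j..<q}. k i < k (Suc i)) \<and> j \<le> k j \<and>
    a = (\<Sum>i=j..q. k i choose i)"

definition macaulay_power :: "nat \<Rightarrow> nat \<Rightarrow> nat" where
  "macaulay_power a q =
    (if a = 0 then 0
     else THE b. \<exists>j k. macaulay_rep a q j k \<and> b = (\<Sum>i=j..q. (k i + 1) choose (i + 1)))"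

definition differential :: "(nat \<Rightarrow> int) \<Rightarrow> nat \<Rightarrow> int" where
  "differential h q = (if q = 0 then 1 else h q - h (q - 1))"

end

theory Submission
  imports Defs
    "HOL-Library.List_Lexorder"
    "HOL-Library.Multiset"
    "HOL-Library.Countable_Set"
    "HOL-Computational_Algebra.Formal_Laurent_Series"
begin

text \<open>If \<open>A/I\<close> has depth \<open>r\<close>, extend the scalars to the uncountable field of Laurent series.  There
  a generic linear form is regular on every quotient that has no socle, and by an exchange argument the
  given regular sequence may be replaced by linear forms \<open>l\<^sub>1, \<dots>, l\<^sub>r\<close>.  Each of them
  differentiates the Hilbert function, so \<open>\<Delta>\<^sup>r H\<close> is the Hilbert function of
  \<open>I + (l\<^sub>1, \<dots>, l\<^sub>r)\<close> and satisfies Macaulay's bound.  The bound itself is a statement about the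
  standard monomials: compressing with respect to neighbouring variables makes this order ideal stable, and
  for stable sets the comparison with lexicographic segments is an induction on the number of variables.

  Conversely, if \<open>\<Delta>\<^sup>p H\<close> satisfies the bound, it is the Hilbert function of a lexicographic ideal in
  \<open>n - p\<close> variables.  The extension of this ideal to \<open>n\<close> variables has Hilbert function \<open>H\<close>, and the
  \<open>p\<close> new variables form a regular sequence.\<close>

section \<open>Initial segments and stable sets\<close>

text \<open>Regular sequences consist of arbitrary elements of the irrelevant ideal, whereas a
  Hilbert function is controlled only by homogeneous ones; so the given elements must be traded for
  linear forms. Over a finite field this can fail: for I = (xy(x+y)) over the field with two
  elements the depth is 1, yet every linear form is a zero divisor. Instead of prime avoidance,
  linear algebra is used: in a pencil a + c b the bad values \<open>c\<close> having a witness of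
  bounded degree are finite in number, so only countably many values are bad in all. Nothing has to
  be descended to K afterwards, since only the numerical function \<Delta>^r H is wanted and
  extension of scalars preserves Hilbert functions. For the equality of the two maxima it is enough
  that every depth lies in the right-hand set and that the ideal built for its maximum
  \<open>p\<close> has depth at least \<open>p\<close>; its own depth then lies in that set and must
  be \<open>p\<close>.\<close>

text \<open>A monomial of degree \<open>d\<close> is encoded by the weakly decreasing list of the indices of its variables, and
  monomials of equal degree are compared lexicographically.  Appending an index \<open>k\<close> not exceeding the
  entries is multiplication by \<open>x\<^sub>k\<close>, and \<open>butlast\<close> divides by the smallest variable; the
  latter maps initial segments onto their shadows.\<close>

definition desc_lists :: "nat \<Rightarrow> nat \<Rightarrow> nat list set" where
  "desc_lists k d = {xs. sorted_wrt (\<ge>) xs \<and> length xs = d \<and> set xs \<subseteq> {k..}}"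

definition initial_seg :: "nat \<Rightarrow> nat list \<Rightarrow> nat list set" where
  "initial_seg k m = {v \<in> desc_lists k (length m). v \<le> m}"

text \<open>The entries of \<open>w\<close> are at most \<open>j\<close>, so in a decreasing list
  the exchanged \<open>Suc j\<close> is its last occurrence and the result is decreasing again. On
  monomials this is multiplication by x_j / x_(j+1); only neighbouring indices occur because
  compression acts on neighbouring variables.\<close>

definition adj_stable :: "nat \<Rightarrow> nat list set \<Rightarrow> bool" where
  "adj_stable k B \<longleftrightarrow> (\<forall>u j w. k \<le> j \<longrightarrow> (\<forall>x\<in>set w. x \<le> j) \<longrightarrow> u @ Suc j # w \<in> B \<longrightarrow> u @ j # w \<in> B)"

lemma snoc_le_snoc_iff:
  fixes u w :: "nat list"
  assumes "length u = length w"
  shows "u @ [a] \<le> w @ [b] \<longleftrightarrow> u < w \<or> u = w \<and> a \<le> b"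
  using assms by (induction u w rule: list_induct2) auto

lemma desc_lists_snoc_iff:
  "u @ [a] \<in> desc_lists k (Suc d) \<longleftrightarrow> u \<in> desc_lists k d \<and> k \<le> a \<and> (\<forall>x\<in>set u. a \<le> x)"
  by (auto simp: desc_lists_def sorted_wrt_append)

lemma desc_lists_Cons_iff:
  "a # u \<in> desc_lists k (Suc d) \<longleftrightarrow> u \<in> desc_lists k d \<and> k \<le> a \<and> (\<forall>x\<in>set u. x \<le> a)"
  by (auto simp: desc_lists_def)

lemma desc_lists_mono: "k \<le> l \<Longrightarrow> desc_lists l d \<subseteq> desc_lists k d"
  by (auto simp: desc_lists_def)

lemma desc_lists_butlast: "m \<in> desc_lists k (Suc d) \<Longrightarrow> butlast m \<in> desc_lists k d"
  by (cases m rule: rev_cases) (auto simp: desc_lists_def sorted_wrt_append)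

lemma le_imp_bounded:
  fixes v m :: "nat list"
  assumes "v \<le> m" "sorted_wrt (\<ge>) v" "length v = length m" "\<forall>x\<in>set m. x \<le> N"
  shows "\<forall>x\<in>set v. x \<le> N"
  using assms by (cases v; cases m) (auto intro: order_trans)

text \<open>The number of variables is unbounded in \<open>desc_lists\<close>. Finiteness comes from
  the first entry, which is the largest one and cannot exceed the first entry of
  \<open>m\<close>.\<close>

lemma finite_initial_seg: "finite (initial_seg k m)"
proof -
  obtain N where N: "\<forall>x\<in>set m. x \<le> N"
    using finite_nat_set_iff_bounded_le[of "set m"] by auto
  have "initial_seg k m \<subseteq> {xs. set xs \<subseteq> {..N} \<and> length xs = length m}"
  proof
    fix v assume v: "v \<in> initial_seg k m"
    then have "\<forall>x\<in>set v. x \<le> N"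
      by (intro le_imp_bounded[OF _ _ _ N]) (simp_all add: initial_seg_def desc_lists_def)
    with v show "v \<in> {xs. set xs \<subseteq> {..N} \<and> length xs = length m}"
      by (auto simp: initial_seg_def desc_lists_def)
  qed
  then show ?thesis
    by (rule finite_subset) (rule finite_lists_length_eq, simp)
qed

lemma desc_lists_split:
  assumes "v \<in> desc_lists k (Suc d)"
  shows "v \<in> desc_lists (Suc k) (Suc d) \<or> (\<exists>u\<in>desc_lists k d. v = u @ [k])"
proof -
  obtain u a where v: "v = u @ [a]" using assms by (cases v rule: rev_cases) (auto simp: desc_lists_def)
  show ?thesis using assms by (cases "a = k") (auto simp: v desc_lists_def sorted_wrt_append)
qed

lemma snoc_le_iff_butlast:
  assumes "m \<in> desc_lists k (Suc d)" "length u = d"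
  shows "u @ [k] \<le> m \<longleftrightarrow> u \<le> butlast m"
proof -
  obtain w b where m: "m = w @ [b]" using assms by (cases m rule: rev_cases) (auto simp: desc_lists_def)
  have "k \<le> b" "length u = length w" using assms by (auto simp: m desc_lists_def)
  then show ?thesis using snoc_le_snoc_iff[of u w k b] by (auto simp: m)
qed

text \<open>The last entry is the smallest, so a list either avoids \<open>k\<close> or ends in
  \<open>k\<close>: monomials are sorted by divisibility by x_k.\<close>

lemma card_split:
  assumes "finite B" "B \<subseteq> desc_lists k (Suc d)"
  shows "card B = card (B \<inter> desc_lists (Suc k) (Suc d)) + card {u. u @ [k] \<in> B}"
proof -
  let ?B0 = "{u. u @ [k] \<in> B}"
  have eq: "B = (B \<inter> desc_lists (Suc k) (Suc d)) \<union> (\<lambda>u. u @ [k]) ` ?B0"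
    using desc_lists_split assms(2) by blast
  have disj: "(B \<inter> desc_lists (Suc k) (Suc d)) \<inter> (\<lambda>u. u @ [k]) ` ?B0 = {}"
    by (auto simp: desc_lists_def)
  have inj: "inj_on (\<lambda>u. u @ [k]) ?B0" by (auto simp: inj_on_def)
  have "finite ((\<lambda>u. u @ [k]) ` ?B0)" by (rule finite_subset[OF _ assms(1)]) auto
  then have "card B = card (B \<inter> desc_lists (Suc k) (Suc d)) + card ((\<lambda>u. u @ [k]) ` ?B0)"
    using card_Un_disjoint[OF _ _ disj] assms(1) eq by (metis finite_Int)
  then show ?thesis using card_image[OF inj] by simp
qed

lemma initial_seg_subset: "m \<in> desc_lists k d \<Longrightarrow> initial_seg k m \<subseteq> desc_lists k d"
  by (auto simp: initial_seg_def desc_lists_def)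

lemma initial_seg_tails:
  assumes "m \<in> desc_lists k (Suc d)"
  shows "{u. u @ [k] \<in> initial_seg k m} = initial_seg k (butlast m)"
proof -
  have "length m = Suc d" "length (butlast m) = d" using assms by (auto simp: desc_lists_def)
  then show ?thesis
    using snoc_le_iff_butlast[OF assms]
    by (auto simp: initial_seg_def desc_lists_snoc_iff) (auto simp: desc_lists_def)
qed

text \<open>In the first summand the bound \<open>m\<close> need not itself lie in
  \<open>desc_lists (Suc k)\<close>. The comparison in one variable less asks for such a bound,
  which the raised list below supplies.\<close>

lemma card_initial_seg:
  assumes "m \<in> desc_lists k (Suc d)"
  shows "card (initial_seg k m)
    = card {v \<in> desc_lists (Suc k) (Suc d). v \<le> m} + card (initial_seg k (butlast m))"
proof -
  have "initial_seg k m \<inter> desc_lists (Suc k) (Suc d) = {v \<in> desc_lists (Suc k) (Suc d). v \<le> m}"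
    using assms desc_lists_mono[of k "Suc k"] by (auto simp: initial_seg_def desc_lists_def)
  then show ?thesis
    using card_split[OF finite_initial_seg initial_seg_subset[OF assms]] initial_seg_tails[OF assms]
    by simp
qed

text \<open>The least list without entry \<open>k\<close> above a given list \<open>m\<close> is obtained by raising the entries \<open>k\<close>.\<close>

lemma less_raise_imp_le:
  assumes "length v = length m" "\<forall>x\<in>set v. k < x" "sorted_wrt (\<ge>) m" "\<forall>x\<in>set m. k \<le> x"
    "v < map (max (Suc k)) m"
  shows "v \<le> m"
  using assms
proof (induction v m rule: list_induct2)
  case Nil
  then show ?case by simp
next
  case (Cons y v x m)
  show ?case
  proof (cases "x = k")
    case True
    then have "\<forall>z\<in>set m. z = k" using Cons.prems by (auto intro: le_antisym)
    then have "map (max (Suc k)) m = replicate (length m) (Suc k)"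
      by (intro replicate_eqI) auto
    moreover have "\<not> v < replicate (length m) (Suc k)"
      using \<open>length v = length m\<close> \<open>\<forall>x\<in>set (y # v). k < x\<close>
      by (induction v m rule: list_induct2) auto
    ultimately show ?thesis using Cons.prems True by auto
  next
    case False
    then have "max (Suc k) x = x" using Cons.prems by auto
    then show ?thesis using Cons by auto
  qed
qed

lemma le_raise: "m \<le> map (max (Suc k)) m"
  by (induction m) (auto simp: less_max_iff_disj)

lemma raise_desc: "m \<in> desc_lists k d \<Longrightarrow> map (max (Suc k)) m \<in> desc_lists (Suc k) d"
  unfolding desc_lists_def by (induction m arbitrary: d) auto

text \<open>Everything strictly below the raised list is already below \<open>m\<close>, so at most
  the raised list itself is gained. This single element is the price that
  \<open>stable_shadow\<close> has to pay.\<close>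

lemma card_raise_le:
  assumes "m \<in> desc_lists k d"
  shows "card (initial_seg (Suc k) (map (max (Suc k)) m)) \<le> Suc (card {v \<in> desc_lists (Suc k) d. v \<le> m})"
proof -
  let ?m = "map (max (Suc k)) m"
  have len: "length m = d" using assms by (auto simp: desc_lists_def)
  have sub: "initial_seg (Suc k) ?m \<subseteq> insert ?m {v \<in> desc_lists (Suc k) d. v \<le> m}"
  proof
    fix v assume v: "v \<in> initial_seg (Suc k) ?m"
    then have "v \<in> desc_lists (Suc k) d" "v < ?m \<or> v = ?m" using len by (auto simp: initial_seg_def)
    moreover from this have "v < ?m \<Longrightarrow> v \<le> m"
      using assms by (intro less_raise_imp_le[of v m k]) (auto simp: desc_lists_def)
    ultimately show "v \<in> insert ?m {v \<in> desc_lists (Suc k) d. v \<le> m}" by auto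
  qed
  have "finite {v \<in> desc_lists (Suc k) d. v \<le> m}"
    by (rule finite_subset[OF _ finite_initial_seg[of k m]])
      (use desc_lists_mono[of k "Suc k"] len in \<open>auto simp: initial_seg_def\<close>)
  then show ?thesis using card_mono[OF _ sub] by (simp add: card_insert_if split: if_splits)
qed

lemma initial_seg_card_mono:
  assumes "length m = length m'" "m \<le> m'"
  shows "card (initial_seg k m) \<le> card (initial_seg k m')"
  using assms by (intro card_mono finite_initial_seg) (auto simp: initial_seg_def)

lemma butlast_le:
  fixes m m' :: "nat list"
  assumes "length m = length m'" "m \<le> m'"
  shows "butlast m \<le> butlast m'"
  using assms by (induction m m' rule: list_induct2) auto

lemma desc_lists_bounded_finite: "B \<subseteq> desc_lists k d \<inter> {xs. set xs \<subseteq> {..<n}} \<Longrightarrow> finite B"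
  by (rule finite_subset[OF _ finite_lists_length_eq[of "{..<n}" d]]) (auto simp: desc_lists_def)

lemma stable_tails: "adj_stable k B \<Longrightarrow> adj_stable k {u. u @ [k] \<in> B}"
  unfolding adj_stable_def
proof (intro allI impI)
  fix u j w
  assume a: "\<forall>u j w. k \<le> j \<longrightarrow> (\<forall>x\<in>set w. x \<le> j) \<longrightarrow> u @ Suc j # w \<in> B \<longrightarrow> u @ j # w \<in> B"
    "k \<le> j" "\<forall>x\<in>set w. x \<le> j" "u @ Suc j # w \<in> {u. u @ [k] \<in> B}"
  show "u @ j # w \<in> {u. u @ [k] \<in> B}"
    using a(1)[rule_format, of j "w @ [k]" u] a(2,3,4) by auto
qed

lemma stable_Suc:
  assumes "adj_stable k B"
  shows "adj_stable (Suc k) (B \<inter> desc_lists (Suc k) d)"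
  unfolding adj_stable_def
proof (intro allI impI)
  fix u j w assume a: "Suc k \<le> j" "\<forall>x\<in>set w. x \<le> j" "u @ Suc j # w \<in> B \<inter> desc_lists (Suc k) d"
  then have "u @ j # w \<in> B" using assms[unfolded adj_stable_def, rule_format, of j w u] by simp
  moreover have "u @ j # w \<in> desc_lists (Suc k) d"
    using a by (fastforce simp: desc_lists_def sorted_wrt_append)
  ultimately show "u @ j # w \<in> B \<inter> desc_lists (Suc k) d" by simp
qed

text \<open>The layers of a stable set: if \<open>u x\<^sub>k\<^sub>+\<^sub>1\<close> occurs, so does \<open>u x\<^sub>k\<close>.  Hence the shadow bound in one
  variable less propagates through all powers of \<open>x\<^sub>k\<close>.\<close>

lemma stable_card_tails:
  assumes shadow: "\<And>d B m. \<lbrakk>B \<subseteq> desc_lists (Suc k) (Suc d) \<inter> {xs. set xs \<subseteq> {..<n}}; adj_stable (Suc k) B;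
      m \<in> desc_lists (Suc k) (Suc d); card (initial_seg (Suc k) m) \<le> card B\<rbrakk>
      \<Longrightarrow> card (initial_seg (Suc k) (butlast m)) \<le> card {u. u @ [Suc k] \<in> B}"
    and "B \<subseteq> desc_lists k d \<inter> {xs. set xs \<subseteq> {..<n}}" "adj_stable k B" "m \<in> desc_lists (Suc k) d"
    and "card (initial_seg (Suc k) m) \<le> card (B \<inter> desc_lists (Suc k) d)"
  shows "card (initial_seg k m) \<le> card B \<and>
    (d > 0 \<longrightarrow> card (initial_seg k (butlast m)) \<le> card {u. u @ [k] \<in> B})"
  using assms(2-)
proof (induction d arbitrary: B m)
  case 0
  then have m: "m = []" by (auto simp: desc_lists_def)
  have "initial_seg k [] = {[]}" "initial_seg (Suc k) [] = {[]}"
    by (auto simp: initial_seg_def desc_lists_def)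
  moreover have "finite B" by (rule desc_lists_bounded_finite[OF 0(1)])
  then have "card (B \<inter> desc_lists (Suc k) 0) \<le> card B" by (intro card_mono) auto
  ultimately show ?case using 0(4) by (simp add: m)
next
  case (Suc d)
  let ?B0 = "{u. u @ [k] \<in> B}" and ?B1 = "B \<inter> desc_lists (Suc k) (Suc d)"
  have fin: "finite B" by (rule desc_lists_bounded_finite[OF Suc.prems(1)])
  have B0: "?B0 \<subseteq> desc_lists k d \<inter> {xs. set xs \<subseteq> {..<n}}"
    using Suc.prems(1) by (fastforce simp: desc_lists_snoc_iff)
  have fin0: "finite ?B0" by (rule desc_lists_bounded_finite[OF B0])
  have "card (initial_seg (Suc k) (butlast m)) \<le> card {u. u @ [Suc k] \<in> ?B1}"
    by (rule shadow) (use Suc.prems stable_Suc in auto)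
  also have "\<dots> \<le> card (?B0 \<inter> desc_lists (Suc k) d)"
  proof (rule card_mono)
    have "u @ [k] \<in> B" if "u @ [Suc k] \<in> B" for u
      using Suc.prems(2)[unfolded adj_stable_def, rule_format, of k "[]" u] that by simp
    then show "{u. u @ [Suc k] \<in> ?B1} \<subseteq> ?B0 \<inter> desc_lists (Suc k) d"
      by (auto simp: desc_lists_snoc_iff)
  qed (use fin0 in auto)
  finally have bound: "card (initial_seg k (butlast m)) \<le> card ?B0"
    using Suc.IH[OF B0 stable_tails[OF Suc.prems(2)] desc_lists_butlast[OF Suc.prems(3)]] by simp
  have mk: "m \<in> desc_lists k (Suc d)" using Suc.prems(3) desc_lists_mono[of k "Suc k"] by auto
  have "{v \<in> desc_lists (Suc k) (Suc d). v \<le> m} = initial_seg (Suc k) m"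
    using mk by (auto simp: initial_seg_def desc_lists_def)
  with bound have "card (initial_seg k m) \<le> card B"
    using card_split[OF fin, of k d] Suc.prems(1,4) card_initial_seg[OF mk] by simp
  then show ?case using bound by simp
qed

text \<open>If too few lists of \<open>B\<close> end in \<open>k\<close>, then the remaining ones
  outnumber the corresponding part of the segment by at least one, which pays for raising
  \<open>m\<close> to a list without \<open>k\<close>. Now \<open>stable_card_tails\<close> applies
  to the raised list and yields at least as many tails as a segment that is no smaller than that of
  \<open>butlast m\<close>, a contradiction.\<close>

theorem stable_shadow:
  assumes "B \<subseteq> desc_lists k (Suc d) \<inter> {xs. set xs \<subseteq> {..<n}}" "adj_stable k B"
    "m \<in> desc_lists k (Suc d)" "card (initial_seg k m) \<le> card B"
  shows "card (initial_seg k (butlast m)) \<le> card {u. u @ [k] \<in> B}"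
  using assms
proof (induction "n - k" arbitrary: k d B m)
  case 0
  have "v \<notin> B" for v
  proof
    assume "v \<in> B"
    then have "v \<noteq> []" "set v \<subseteq> {k..}" "set v \<subseteq> {..<n}"
      using 0(2) by (auto simp: desc_lists_def)
    then show False using 0(1) hd_in_set[of v] by fastforce
  qed
  then have "B = {}" by blast
  moreover have "m \<in> initial_seg k m" using 0 by (auto simp: initial_seg_def desc_lists_def)
  ultimately show ?case using 0(5) finite_initial_seg[of k m] by auto
next
  case (Suc N)
  have shadow: "\<And>d B m. \<lbrakk>B \<subseteq> desc_lists (Suc k) (Suc d) \<inter> {xs. set xs \<subseteq> {..<n}}; adj_stable (Suc k) B;
      m \<in> desc_lists (Suc k) (Suc d); card (initial_seg (Suc k) m) \<le> card B\<rbrakk>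
      \<Longrightarrow> card (initial_seg (Suc k) (butlast m)) \<le> card {u. u @ [Suc k] \<in> B}"
    by (rule Suc.hyps(1)) (use Suc.hyps(2) in linarith)
  have fin: "finite B" by (rule desc_lists_bounded_finite[OF Suc.prems(1)])
  have B: "B \<subseteq> desc_lists k (Suc d)" using Suc.prems(1) by blast
  let ?m = "map (max (Suc k)) m"
  show ?case
  proof (rule ccontr)
    assume neg: "\<not> ?thesis"
    have "card (initial_seg (Suc k) ?m) \<le> Suc (card {v \<in> desc_lists (Suc k) (Suc d). v \<le> m})"
      by (rule card_raise_le[OF Suc.prems(3)])
    also have "\<dots> \<le> card (B \<inter> desc_lists (Suc k) (Suc d))"
      using neg card_split[OF fin B] Suc.prems(4) card_initial_seg[OF Suc.prems(3)] by linarith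
    finally have large: "card (initial_seg (Suc k) ?m) \<le> card (B \<inter> desc_lists (Suc k) (Suc d))" .
    have "card (initial_seg k ?m) \<le> card B \<and>
        (Suc d > 0 \<longrightarrow> card (initial_seg k (butlast ?m)) \<le> card {u. u @ [k] \<in> B})"
    proof (rule stable_card_tails[where n = n])
      show "B \<subseteq> desc_lists k (Suc d) \<inter> {xs. set xs \<subseteq> {..<n}}" "adj_stable k B"
        by fact+
      show "?m \<in> desc_lists (Suc k) (Suc d)" by (rule raise_desc[OF Suc.prems(3)])
    qed (fact)+
    then have "card (initial_seg k (butlast ?m)) \<le> card {u. u @ [k] \<in> B}" by simp
    moreover have "card (initial_seg k (butlast m)) \<le> card (initial_seg k (butlast ?m))"
      by (intro initial_seg_card_mono butlast_le le_raise) auto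
    ultimately show False using neg by simp
  qed
qed

section \<open>Positions in the lexicographic order and Macaulay representations\<close>

text \<open>The position of a list in the lexicographic order.  If \<open>i\<^sub>1 \<le> \<dots> \<le> i\<^sub>q\<close> are the entries,
  then the numbers \<open>k\<^sub>j = i\<^sub>j + j - 1\<close> with \<open>i\<^sub>j > 0\<close> form the Macaulay representation of the
  position, and multiplication by \<open>x\<^sub>0\<close> raises it to \<open>a\<^bsup>\<langle>q\<rangle>\<^esup>\<close>.\<close>

primrec prank :: "nat list \<Rightarrow> nat" where
  "prank [] = 0"
| "prank (x # xs) = ((x + length xs) choose Suc (length xs)) + prank xs"

text \<open>The binomial coefficient is the number of decreasing lists of this length with entries
  at most \<open>x\<close>. The term of the head and the bound for the tail add up by Pascal's
  rule.\<close>

lemma prank_less_binomial: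
  assumes "\<forall>y\<in>set xs. y \<le> x" "sorted_wrt (\<ge>) xs"
  shows "prank xs < (x + length xs) choose length xs"
  using assms
proof (induction xs arbitrary: x)
  case Nil
  then show ?case by simp
next
  case (Cons y ys)
  have "prank (y # ys) < ((y + length ys) choose Suc (length ys)) + ((y + length ys) choose length ys)"
    using Cons.IH[of y] Cons.prems by simp
  also have "\<dots> = Suc (y + length ys) choose Suc (length ys)" by simp
  also have "\<dots> \<le> Suc (x + length ys) choose Suc (length ys)"
    using Cons.prems by (intro binomial_right_mono) auto
  finally show ?case by simp
qed

lemma prank_strict_mono:
  assumes "length xs = length ys" "xs < ys" "sorted_wrt (\<ge>) xs" "sorted_wrt (\<ge>) ys"
  shows "prank xs < prank ys"
  using assms
proof (induction xs ys rule: list_induct2)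
  case Nil
  then show ?case by simp
next
  case (Cons x xs y ys)
  show ?case
  proof (cases "x < y")
    case True
    have "prank (x # xs) < (x + length (x # xs)) choose length (x # xs)"
      by (rule prank_less_binomial) (use Cons.prems in auto)
    also have "\<dots> = (Suc x + length xs) choose Suc (length xs)" by simp
    also have "\<dots> \<le> (y + length xs) choose Suc (length xs)"
      using True by (intro binomial_right_mono) auto
    also have "\<dots> \<le> prank (y # ys)" using Cons.hyps by simp
    finally show ?thesis .
  next
    case False
    then show ?thesis using Cons by auto
  qed
qed

lemma prank_le_iff:
  assumes "xs \<in> desc_lists 0 d" "ys \<in> desc_lists 0 d"
  shows "prank xs \<le> prank ys \<longleftrightarrow> xs \<le> ys"
  using assms prank_strict_mono[of xs ys] prank_strict_mono[of ys xs]
  by (cases xs ys rule: linorder_cases) (auto simp: desc_lists_def)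

lemma prank_inj: "inj_on prank (desc_lists 0 d)"
  by (rule inj_onI) (metis prank_le_iff order_antisym order_refl)

text \<open>Greedy choice: the head \<open>y\<close> is least such that \<open>a\<close> is below
  the number of lists with entries at most \<open>y\<close>. After subtracting the term of the head,
  Pascal's rule leaves a number below the count of lists of length \<open>d\<close> with entries at
  most \<open>y\<close>, so the tail continues the list.\<close>

lemma prank_surj_bounded:
  assumes "a < (x + d) choose d"
  shows "\<exists>xs\<in>desc_lists 0 d. (\<forall>y\<in>set xs. y \<le> x) \<and> prank xs = a"
  using assms
proof (induction d arbitrary: a x)
  case 0
  then show ?case by (intro bexI[of _ "[]"]) (auto simp: desc_lists_def)
next
  case (Suc d)
  define y where "y = (LEAST y. a < (y + Suc d) choose Suc d)"
  have y: "a < (y + Suc d) choose Suc d" "y \<le> x"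
    using Suc.prems unfolding y_def by (auto intro: LeastI Least_le)
  have le: "(y + d) choose Suc d \<le> a"
  proof (cases y)
    case (Suc z)
    then have "\<not> a < (z + Suc d) choose Suc d"
      using not_less_Least[of z "\<lambda>y. a < (y + Suc d) choose Suc d"] unfolding y_def by (metis lessI)
    then show ?thesis using Suc by simp
  qed (simp add: binomial_eq_0)
  have "a - ((y + d) choose Suc d) < (y + d) choose d" using y(1) le by simp
  from Suc.IH[OF this] obtain ys where ys: "ys \<in> desc_lists 0 d" "\<forall>z\<in>set ys. z \<le> y"
    "prank ys = a - ((y + d) choose Suc d)" by blast
  have "y # ys \<in> desc_lists 0 (Suc d)" using ys by (simp add: desc_lists_Cons_iff)
  moreover have "prank (y # ys) = a" using ys le by (simp add: desc_lists_def)
  ultimately show ?case using ys(2) y(2) by (intro bexI[of _ "y # ys"]) (auto intro: order_trans)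
qed

lemma less_binomial: "a < (a + Suc d) choose Suc d"
  by (induction d) (auto intro: less_le_trans)

lemma prank_surj: "\<exists>xs\<in>desc_lists 0 (Suc d). prank xs = a"
  using prank_surj_bounded[OF less_binomial[of a d]] by blast

text \<open>Positive length is essential: only one list has length 0, whereas for each positive
  length \<open>prank\<close> is a bijection onto the naturals.\<close>

lemma card_prank_less: "card {v \<in> desc_lists 0 (Suc d). prank v < a} = a"
proof -
  have "bij_betw prank {v \<in> desc_lists 0 (Suc d). prank v < a} {..<a}"
    unfolding bij_betw_def
  proof
    show "inj_on prank {v \<in> desc_lists 0 (Suc d). prank v < a}"
      by (rule inj_on_subset[OF prank_inj]) auto
    show "prank ` {v \<in> desc_lists 0 (Suc d). prank v < a} = {..<a}"
    proof (intro subset_antisym subsetI)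
      fix b assume b: "b \<in> {..<a}"
      obtain xs where "xs \<in> desc_lists 0 (Suc d)" "prank xs = b" using prank_surj by blast
      then show "b \<in> prank ` {v \<in> desc_lists 0 (Suc d). prank v < a}" using b by auto
    qed auto
  qed
  then show ?thesis using bij_betw_same_card by fastforce
qed

text \<open>The extra 1 arises because a list belongs to its own initial segment.\<close>

lemma card_initial_seg_prank:
  assumes "m \<in> desc_lists 0 (Suc d)"
  shows "card (initial_seg 0 m) = Suc (prank m)"
proof -
  have "initial_seg 0 m = {v \<in> desc_lists 0 (Suc d). prank v < Suc (prank m)}"
    using prank_le_iff[OF _ assms] assms by (auto simp: initial_seg_def less_Suc_eq_le) (auto simp: desc_lists_def)
  then show ?thesis by (simp add: card_prank_less)
qed

lemma prank_rev_map: "prank (rev (map f [1..<Suc q])) = (\<Sum>i=1..q. (f i + i - 1) choose i)"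
  by (induction q) (auto simp: sum.nat_ivl_Suc' Suc_le_eq)

lemma prank_rev_map_snoc_0:
  "prank (rev (map f [1..<Suc q]) @ [0]) = (\<Sum>i=1..q. (f i + i) choose (i + 1))"
  by (induction q) (auto simp: sum.nat_ivl_Suc' Suc_le_eq)

lemma rev_map_in_desc_lists:
  assumes "\<And>i. \<lbrakk>1 \<le> i; i < q\<rbrakk> \<Longrightarrow> f i \<le> f (Suc i)"
  shows "rev (map f [1..<Suc q]) \<in> desc_lists 0 q"
  using assms
proof (induction q)
  case (Suc q)
  have "f x \<le> f (Suc q)" if "x \<in> {1..<Suc q}" for x
  proof -
    have "x \<le> Suc q" "1 \<le> x" using that by auto
    then show ?thesis
      by (induction rule: inc_induct) (use Suc.prems in \<open>auto intro: order_trans\<close>)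
  qed
  then show ?case using Suc by (auto simp: desc_lists_Cons_iff)
qed (simp add: desc_lists_def)

lemma desc_lists_obtain_fun:
  assumes "m \<in> desc_lists 0 q"
  obtains f where "m = rev (map f [1..<Suc q])" "\<And>i. \<lbrakk>1 \<le> i; i < q\<rbrakk> \<Longrightarrow> f i \<le> f (Suc i)"
proof
  let ?f = "\<lambda>i. m ! (q - i)"
  have len: "length m = q" and sorted: "sorted_wrt (\<ge>) m" using assms by (auto simp: desc_lists_def)
  show "m = rev (map ?f [1..<Suc q])"
    by (rule nth_equalityI) (auto simp: len rev_nth simp del: upt_Suc)
  show "?f i \<le> ?f (Suc i)" if "1 \<le> i" "i < q" for i
    using that sorted_wrt_nth_less[OF sorted, of "q - Suc i" "q - i"] len by simp
qed

lemma macaulay_rep_imp_prank: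
  assumes "macaulay_rep a q j k"
  shows "\<exists>m\<in>desc_lists 0 q. prank m = a \<and> prank (m @ [0]) = (\<Sum>i=j..q. (k i + 1) choose (i + 1))"
proof -
  have rep: "1 \<le> j" "j \<le> q" "\<And>i. j \<le> i \<Longrightarrow> i < q \<Longrightarrow> k i < k (Suc i)" "j \<le> k j"
    "a = (\<Sum>i=j..q. k i choose i)"
    using assms by (auto simp: macaulay_rep_def)
  have ge: "i \<le> q \<Longrightarrow> i \<le> k i" if "j \<le> i" for i
    using that by (induction i rule: dec_induct) (use rep(3,4) in \<open>auto dest!: Suc_leD simp: Suc_le_eq intro: le_less_trans\<close>)
  \<comment> \<open>This inverts k_i = f_i + i - 1. Indices below \<open>j\<close> are absent from
    the representation and become entries 0, whose binomial coefficients vanish in both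
    sums.\<close>
  define f where "f i = (if i < j then 0 else k i - (i - 1))" for i
  have "f i \<le> f (Suc i)" if "1 \<le> i" "i < q" for i
    using rep(3)[of i] that by (auto simp: f_def)
  then have "rev (map f [1..<Suc q]) \<in> desc_lists 0 q" by (rule rev_map_in_desc_lists)
  moreover have "(\<Sum>i=1..q. (f i + i - 1) choose i) = (\<Sum>i=j..q. k i choose i)"
    using rep(1) ge by (intro sum.mono_neutral_cong_right) (fastforce simp: f_def)+
  moreover have "(\<Sum>i=1..q. (f i + i) choose (i + 1)) = (\<Sum>i=j..q. (k i + 1) choose (i + 1))"
    using rep(1) ge by (intro sum.mono_neutral_cong_right) (fastforce simp: f_def)+
  ultimately show ?thesis
    using rep(5) by (intro bexI[of _ "rev (map f [1..<Suc q])"])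
      (simp_all only: prank_rev_map prank_rev_map_snoc_0 simp_thms)
qed

lemma prank_imp_macaulay_rep:
  assumes "m \<in> desc_lists 0 q" "prank m > 0"
  shows "\<exists>j k. macaulay_rep (prank m) q j k"
proof -
  obtain f where f: "m = rev (map f [1..<Suc q])" "\<And>i. \<lbrakk>1 \<le> i; i < q\<rbrakk> \<Longrightarrow> f i \<le> f (Suc i)"
    using desc_lists_obtain_fun[OF assms(1)] by metis
  have pr: "prank m = (\<Sum>i=1..q. (f i + i - 1) choose i)" by (simp only: f prank_rev_map)
  have "\<exists>i. 1 \<le> i \<and> i \<le> q \<and> f i > 0"
  proof (rule ccontr)
    assume "\<not> ?thesis"
    then have "(\<Sum>i=1..q. (f i + i - 1) choose i) = 0" by (intro sum.neutral) auto
    then have "prank m = 0" by (simp only: pr)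
    then show False using assms(2) by simp
  qed
  then obtain i0 where i0: "1 \<le> i0 \<and> i0 \<le> q \<and> f i0 > 0" by blast
  \<comment> \<open>Zero entries contribute nothing, so the representation starts at the first
    positive entry, where k_j = f_j + j - 1 is at least \<open>j\<close>.\<close>
  define j where "j = (LEAST i. 1 \<le> i \<and> i \<le> q \<and> f i > 0)"
  have j: "1 \<le> j" "j \<le> q" "f j > 0" using LeastI[of "\<lambda>i. 1 \<le> i \<and> i \<le> q \<and> f i > 0" i0, OF i0] by (auto simp: j_def)
  have below: "f i = 0" if "1 \<le> i" "i < j" for i
    using not_less_Least[of i "\<lambda>i. 1 \<le> i \<and> i \<le> q \<and> f i > 0"] that j by (auto simp: j_def)
  have "macaulay_rep (prank m) q j (\<lambda>i. f i + i - 1)"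
    unfolding macaulay_rep_def
  proof (intro conjI ballI)
    show "prank m = (\<Sum>i=j..q. (f i + i - 1) choose i)"
      unfolding pr using j below by (intro sum.mono_neutral_right) auto
    show "f i + i - 1 < f (Suc i) + Suc i - 1" if "i \<in> {j..<q}" for i
      using f(2)[of i] that j by auto
  qed (use j in auto)
  then show ?thesis by blast
qed

text \<open>Every representation comes from a list of the given rank, and \<open>prank\<close> is
  injective; so all representations yield the same raised sum, which evaluates the definite
  description. Rank 0 forces the list of zeros, in accordance with the convention for 0.\<close>

lemma macaulay_power_prank:
  assumes "m \<in> desc_lists 0 q"
  shows "macaulay_power (prank m) q = prank (m @ [0])"
proof (cases "prank m = 0")
  case True
  have "prank (replicate q 0) = 0" by (induction q) auto
  moreover have "replicate q 0 \<in> desc_lists 0 q"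
    by (auto simp: desc_lists_def sorted_wrt_iff_nth_less)
  ultimately have "m = replicate q 0" using True prank_inj[of q] assms by (metis inj_onD)
  then have "m @ [0] = replicate (Suc q) 0" by (simp add: replicate_append_same)
  moreover have "prank (replicate (Suc q) 0) = 0" by (induction q) auto
  ultimately show ?thesis using True by (simp add: macaulay_power_def)
next
  case False
  have unique: "b = prank (m @ [0])"
    if "macaulay_rep (prank m) q j k" "b = (\<Sum>i=j..q. (k i + 1) choose (i + 1))" for b j k
    using macaulay_rep_imp_prank[OF that(1)] that(2) inj_onD[OF prank_inj[of q] _ assms] by metis
  obtain j k where jk: "macaulay_rep (prank m) q j k"
    using prank_imp_macaulay_rep[OF assms] False by auto
  have "(THE b. \<exists>j k. macaulay_rep (prank m) q j k \<and> b = (\<Sum>i=j..q. (k i + 1) choose (i + 1)))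
      = prank (m @ [0])"
  proof (rule the_equality)
    show "\<exists>j k. macaulay_rep (prank m) q j k \<and> prank (m @ [0]) = (\<Sum>i=j..q. (k i + 1) choose (i + 1))"
      using jk unique[OF jk refl] by metis
  qed (use unique in blast)
  then show ?thesis using False by (simp add: macaulay_power_def)
qed

section \<open>Compression of order ideals\<close>

abbreviation lookup where "lookup \<equiv> Poly_Mapping.lookup"
abbreviation keys where "keys \<equiv> Poly_Mapping.keys"
abbreviation single where "single \<equiv> Poly_Mapping.single"

definition monomials :: "nat \<Rightarrow> monomial set" where
  "monomials n = {m. keys m \<subseteq> {..<n}}"

definition of_deg :: "nat \<Rightarrow> monomial set \<Rightarrow> monomial set" where
  "of_deg q M = {m \<in> M. mdeg m = q}"

definition down_closed :: "monomial set \<Rightarrow> bool" where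
  "down_closed M \<longleftrightarrow> (\<forall>m i. m + single i 1 \<in> M \<longrightarrow> m \<in> M)"

lemma mdeg_eq_sum:
  assumes "keys m \<subseteq> S" "finite S"
  shows "mdeg m = (\<Sum>i\<in>S. lookup m i)"
  unfolding mdeg_def by (rule sum.mono_neutral_left) (use assms in \<open>auto simp: in_keys_iff\<close>)

lemma mdeg_add: "mdeg (a + b) = mdeg a + mdeg b"
proof -
  let ?S = "keys a \<union> keys b"
  have "mdeg (a + b) = (\<Sum>i\<in>?S. lookup (a + b) i)" by (intro mdeg_eq_sum keys_add) auto
  then show ?thesis by (simp add: lookup_add sum.distrib mdeg_eq_sum[of a ?S] mdeg_eq_sum[of b ?S])
qed

lemma mdeg_zero [simp]: "mdeg 0 = 0"
  by (simp add: mdeg_def)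

lemma mdeg_single [simp]: "mdeg (single i c) = c"
  by (simp add: mdeg_def)

lemma mdeg_eq_0_iff: "mdeg m = 0 \<longleftrightarrow> m = 0"
  by (auto simp: mdeg_def in_keys_iff intro!: poly_mapping_eqI)

lemma mdeg_pos_obtain:
  assumes "0 < mdeg m"
  obtains i where "i \<in> keys m"
  using assms by (metis mdeg_eq_0_iff keys_eq_empty ex_in_conv less_irrefl)

lemma keys_add_nat: "keys (a + b :: 'a \<Rightarrow>\<^sub>0 nat) = keys a \<union> keys b"
  by (auto simp: in_keys_iff lookup_add)

lemma monomials_iff: "m \<in> monomials n \<longleftrightarrow> (\<forall>i. lookup m i \<noteq> 0 \<longrightarrow> i < n)"
  by (simp add: monomials_def subset_iff in_keys_iff)

lemma monomials_add [simp]: "a + b \<in> monomials n \<longleftrightarrow> a \<in> monomials n \<and> b \<in> monomials n"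
  by (auto simp: monomials_def keys_add_nat)

lemma monomials_single: "single i c \<in> monomials n \<longleftrightarrow> c = 0 \<or> i < n"
  by (auto simp: monomials_def)

lemma lookup_le_mdeg: "lookup m i \<le> mdeg m"
  by (cases "i \<in> keys m") (auto simp: mdeg_def in_keys_iff intro: member_le_sum)

lemma finite_monomials_deg_le: "finite {m \<in> monomials n. mdeg m \<le> q}"
proof (rule inj_on_finite[where f = lookup])
  show "inj_on lookup {m \<in> monomials n. mdeg m \<le> q}" by (intro inj_onI) (rule poly_mapping_eqI, simp)
  show "lookup ` {m \<in> monomials n. mdeg m \<le> q}
      \<subseteq> {f. \<forall>i. (i \<in> {..<n} \<longrightarrow> f i \<in> {..q}) \<and> (i \<notin> {..<n} \<longrightarrow> f i = 0)}"
  proof clarify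
    fix m i assume "m \<in> monomials n" "mdeg m \<le> q"
    then show "(i \<in> {..<n} \<longrightarrow> lookup m i \<in> {..q}) \<and> (i \<notin> {..<n} \<longrightarrow> lookup m i = 0)"
      using lookup_le_mdeg[of m i] by (auto simp: monomials_def subset_iff in_keys_iff)
  qed
  show "finite {f. \<forall>i. (i \<in> {..<n} \<longrightarrow> f i \<in> {..q}) \<and> (i \<notin> {..<n} \<longrightarrow> f i = (0::nat))}"
    by (rule finite_set_of_finite_funs) simp_all
qed

lemma finite_of_deg_monomials: "M \<subseteq> monomials n \<Longrightarrow> finite (of_deg q M)"
  by (rule finite_subset[OF _ finite_monomials_deg_le[of n q]]) (auto simp: of_deg_def)

lemma monomial_minus_single: "i \<in> keys m \<Longrightarrow> m = (m - single i 1) + single i (1::nat)"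
  by (intro poly_mapping_eqI) (auto simp: lookup_add lookup_minus lookup_single when_def in_keys_iff)

lemma down_closed_add:
  assumes "down_closed M" "x + y \<in> M"
  shows "x \<in> M"
  using assms(2)
proof (induction "mdeg y" arbitrary: y)
  case 0
  then show ?case by (simp add: mdeg_eq_0_iff)
next
  case (Suc d)
  then obtain i where i: "i \<in> keys y" by (metis mdeg_pos_obtain zero_less_Suc)
  have y: "y = (y - single i 1) + single i 1" by (rule monomial_minus_single[OF i])
  then have "mdeg y = mdeg (y - single i 1) + 1" by (metis mdeg_add mdeg_single)
  moreover have "(x + (y - single i 1)) + single i 1 \<in> M" using Suc.prems y by (simp add: add.assoc)
  then have "x + (y - single i 1) \<in> M" using assms(1) unfolding down_closed_def by blast
  ultimately show ?case using Suc.hyps by simp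
qed

text \<open>Compression: for a fixed value of the other exponents and of \<open>m\<^sub>j + m\<^sub>j\<^sub>+\<^sub>1\<close>, the occurring exponents
  \<open>m\<^sub>j\<^sub>+\<^sub>1\<close> are pushed down to an initial segment of the naturals.\<close>

definition shift :: "nat \<Rightarrow> nat \<Rightarrow> monomial \<Rightarrow> monomial" where
  "shift j a m = Poly_Mapping.update (Suc j) a
    (Poly_Mapping.update j (lookup m j + lookup m (Suc j) - a) m)"

lemma lookup_shift: "lookup (shift j a m) i =
    (if i = Suc j then a else if i = j then lookup m j + lookup m (Suc j) - a else lookup m i)"
  by (simp add: shift_def lookup_update)

definition slice :: "monomial set \<Rightarrow> nat \<Rightarrow> monomial \<Rightarrow> nat set" where
  "slice M j m = {a. a \<le> lookup m j + lookup m (Suc j) \<and> shift j a m \<in> M}"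

lemma finite_slice: "finite (slice M j m)"
  by (rule finite_subset[of _ "{..lookup m j + lookup m (Suc j)}"]) (auto simp: slice_def)

definition compress :: "monomial set \<Rightarrow> nat \<Rightarrow> monomial \<Rightarrow> monomial" where
  "compress M j m = shift j (card {a \<in> slice M j m. a < lookup m (Suc j)}) m"

lemma shift_shift: "a \<le> lookup m j + lookup m (Suc j) \<Longrightarrow> shift j b (shift j a m) = shift j b m"
  by (intro poly_mapping_eqI) (auto simp: lookup_shift)

lemma shift_self: "shift j (lookup m (Suc j)) m = m"
  by (intro poly_mapping_eqI) (auto simp: lookup_shift)

lemma slice_shift:
  "a \<le> lookup m j + lookup m (Suc j) \<Longrightarrow> slice M j (shift j a m) = slice M j m"
  by (auto simp: slice_def shift_shift lookup_shift)

lemma self_in_slice: "m \<in> M \<Longrightarrow> lookup m (Suc j) \<in> slice M j m"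
  by (simp add: slice_def shift_self)

lemma card_below_le: "card {a \<in> S. a < (b::nat)} \<le> b"
  using card_mono[of "{..<b}" "{a \<in> S. a < b}"] by auto

lemma compress_eq_shift:
  obtains r where "compress M j m = shift j r m" "r \<le> lookup m (Suc j)"
    "r = card {a \<in> slice M j m. a < lookup m (Suc j)}"
  using card_below_le[of "slice M j m" "lookup m (Suc j)"] compress_def by blast

lemma bij_betw_card_below:
  assumes "finite (S :: nat set)"
  shows "bij_betw (\<lambda>b. card {a \<in> S. a < b}) S {..<card S}"
proof -
  have less: "card {a \<in> S. a < b} < card {a \<in> S. a < c}" if "b \<in> S" "b < c" for b c
  proof (rule psubset_card_mono)
    show "{a \<in> S. a < b} \<subset> {a \<in> S. a < c}"
    proof (rule psubsetI)
      have "b \<in> {a \<in> S. a < c}" "b \<notin> {a \<in> S. a < b}" using that by simp_all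
      then show "{a \<in> S. a < b} \<noteq> {a \<in> S. a < c}" by metis
    qed (use that in \<open>simp add: subset_iff\<close>)
  qed (use assms in simp)
  have inj: "inj_on (\<lambda>b. card {a \<in> S. a < b}) S"
  proof (rule inj_onI)
    fix b c assume "b \<in> S" "c \<in> S" "card {a \<in> S. a < b} = card {a \<in> S. a < c}"
    then show "b = c" using less[of b c] less[of c b] by (cases b c rule: linorder_cases) auto
  qed
  have "(\<lambda>b. card {a \<in> S. a < b}) ` S \<subseteq> {..<card S}"
  proof clarify
    fix b assume "b \<in> S"
    then have "{a \<in> S. a < b} \<noteq> S" by force
    then have "{a \<in> S. a < b} \<subset> S" by blast
    then show "card {a \<in> S. a < b} < card S" using assms by (rule psubset_card_mono[rotated])
  qed
  then show ?thesis
    unfolding bij_betw_def using inj by (simp add: card_subset_eq card_image)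
qed

text \<open>The slice and the sum of the two exponents survive the shift, so the compressed monomial
  still determines its slice; its new exponent is the position of the old one in there.\<close>

lemma inj_on_compress: "inj_on (compress M j) M"
proof (rule inj_onI)
  fix m m' assume m: "m \<in> M" "m' \<in> M" and eq: "compress M j m = compress M j m'"
  obtain r where r: "compress M j m = shift j r m" "r \<le> lookup m (Suc j)"
    "r = card {a \<in> slice M j m. a < lookup m (Suc j)}" by (rule compress_eq_shift)
  obtain r' where r': "compress M j m' = shift j r' m'" "r' \<le> lookup m' (Suc j)"
    "r' = card {a \<in> slice M j m'. a < lookup m' (Suc j)}" by (rule compress_eq_shift)
  have "r = r'" using arg_cong[OF eq, of "\<lambda>m. lookup m (Suc j)"] r r' by (simp add: lookup_shift)
  have shift: "shift j b m = shift j b m'" for b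
    using shift_shift[of r m j b] shift_shift[of r' m' j b] r r' eq by simp
  have "slice M j m = slice M j m'"
    using slice_shift[of r m j M] slice_shift[of r' m' j M] r r' eq by simp
  then have "lookup m (Suc j) = lookup m' (Suc j)"
    using inj_onD[OF bij_betw_imp_inj_on[OF bij_betw_card_below[OF finite_slice[of M j m]]],
        of "lookup m (Suc j)" "lookup m' (Suc j)"]
      self_in_slice[OF m(1), of j] self_in_slice[OF m(2), of j] \<open>r = r'\<close> r(3) r'(3) by simp
  then show "m = m'" using shift_self[of j m] shift_self[of j m'] shift[of "lookup m (Suc j)"] by simp
qed

text \<open>Membership after compression depends only on the size of the slice; in this form no
  preimages have to be chosen when order ideals are shown to be preserved.\<close>

lemma mem_compress_iff: "m \<in> compress M j ` M \<longleftrightarrow> lookup m (Suc j) < card (slice M j m)"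
proof
  assume "m \<in> compress M j ` M"
  then obtain m' where m': "m' \<in> M" "m = compress M j m'" by blast
  obtain r where r: "compress M j m' = shift j r m'" "r \<le> lookup m' (Suc j)"
    "r = card {a \<in> slice M j m'. a < lookup m' (Suc j)}" by (rule compress_eq_shift)
  have "r < card (slice M j m')"
    using bij_betwE[OF bij_betw_card_below[OF finite_slice[of M j m']]] self_in_slice[OF m'(1), of j] r(3)
    by simp
  then show "lookup m (Suc j) < card (slice M j m)"
    using r slice_shift[of r m' j M] by (simp add: m' lookup_shift)
next
  assume "lookup m (Suc j) < card (slice M j m)"
  then have "lookup m (Suc j) \<in> (\<lambda>b. card {a \<in> slice M j m. a < b}) ` slice M j m"
    using bij_betw_imp_surj_on[OF bij_betw_card_below[OF finite_slice[of M j m]]] by simp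
  then obtain b where b: "b \<in> slice M j m" "lookup m (Suc j) = card {a \<in> slice M j m. a < b}"
    by (rule imageE)
  have le: "b \<le> lookup m j + lookup m (Suc j)" and mem: "shift j b m \<in> M"
    using b(1) by (auto simp: slice_def)
  have "compress M j (shift j b m) = m"
    by (simp add: b(2)[symmetric] compress_def shift_shift[OF le] slice_shift[OF le] lookup_shift shift_self)
  then show "m \<in> compress M j ` M" using mem by (metis imageI)
qed

lemma shift_monomials: "m \<in> monomials n \<Longrightarrow> Suc j < n \<Longrightarrow> shift j a m \<in> monomials n"
  by (simp add: monomials_iff lookup_shift)

lemma sum_split_two:
  fixes f :: "nat \<Rightarrow> nat"
  assumes "Suc j < n"
  shows "(\<Sum>i<n. f i) = f j + f (Suc j) + (\<Sum>i\<in>{..<n} - {j, Suc j}. f i)"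
proof -
  have "(\<Sum>i<n. f i) = sum f {j, Suc j} + sum f ({..<n} - {j, Suc j})"
    using sum.subset_diff[of "{j, Suc j}" "{..<n}" f] assms by (simp add: add.commute)
  then show ?thesis by simp
qed

lemma mdeg_shift:
  assumes "m \<in> monomials n" "Suc j < n" "a \<le> lookup m j + lookup m (Suc j)"
  shows "mdeg (shift j a m) = mdeg m"
proof -
  have "mdeg (shift j a m) = (\<Sum>i<n. lookup (shift j a m) i)" "mdeg m = (\<Sum>i<n. lookup m i)"
    using shift_monomials[OF assms(1,2), of a] assms(1) by (auto simp: monomials_def intro!: mdeg_eq_sum)
  moreover have "(\<Sum>i\<in>{..<n} - {j, Suc j}. lookup (shift j a m) i) = (\<Sum>i\<in>{..<n} - {j, Suc j}. lookup m i)"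
    by (intro sum.cong) (auto simp: lookup_shift)
  ultimately show ?thesis using assms by (simp add: sum_split_two lookup_shift)
qed

text \<open>Moving exponent from \<open>Suc j\<close> to \<open>j\<close> lowers this number, which
  makes it the potential to be minimised.\<close>

definition weight :: "nat \<Rightarrow> monomial \<Rightarrow> nat" where
  "weight n m = (\<Sum>i<n. i * lookup m i)"

lemma weight_shift:
  assumes "Suc j < n" "a \<le> lookup m j + lookup m (Suc j)"
  shows "weight n (shift j a m) + lookup m (Suc j) = weight n m + a"
proof -
  have "(\<Sum>i\<in>{..<n} - {j, Suc j}. i * lookup (shift j a m) i) = (\<Sum>i\<in>{..<n} - {j, Suc j}. i * lookup m i)"
    by (intro sum.cong) (auto simp: lookup_shift)
  moreover have "j * (lookup m j + lookup m (Suc j) - a) + (a + j * a)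
      = j * lookup m j + j * lookup m (Suc j) + a"
    using assms(2) by (simp flip: add_mult_distrib2 add.assoc)
  ultimately show ?thesis unfolding weight_def using assms by (simp add: sum_split_two lookup_shift)
qed

text \<open>Think of \<open>S\<close> as the slice of a monomial and of \<open>T\<close> as the
  slice of its product with x_j or x_(j+1). A value \<open>k\<close> missing in \<open>S\<close> is
  missing in \<open>T\<close> together with \<open>Suc k\<close>; closing this gap, by lowering
  everything above it by one, maps \<open>T\<close> injectively into \<open>S\<close>.\<close>

lemma slice_card_cases:
  assumes S: "S \<subseteq> {..s}" and T: "T \<subseteq> {..Suc s}"
    and low: "\<And>a. a \<in> T \<Longrightarrow> a \<le> s \<Longrightarrow> a \<in> S" and up: "\<And>a. Suc a \<in> T \<Longrightarrow> a \<in> S"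
  shows "card T \<le> card S \<or> card S = Suc s"
proof (cases "{..s} \<subseteq> S")
  case True
  then have "S = {..s}" using S by blast
  then show ?thesis by simp
next
  case False
  then obtain k where k: "k \<le> s" "k \<notin> S" by auto
  have "k \<notin> T" "Suc k \<notin> T" using k low up by auto
  have fin: "finite S" using S finite_subset by blast
  let ?f = "\<lambda>a. if a < k then a else a - 1"
  have "inj_on ?f T"
  proof (rule inj_onI)
    fix a b assume a: "a \<in> T" "b \<in> T" "?f a = ?f b"
    then have "a \<noteq> k" "a \<noteq> Suc k" "b \<noteq> k" "b \<noteq> Suc k"
      using \<open>k \<notin> T\<close> \<open>Suc k \<notin> T\<close> by blast+
    then show "a = b" using a(3) by (simp split: if_splits)
  qed
  moreover have "?f ` T \<subseteq> S"
  proof clarify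
    fix a assume a: "a \<in> T"
    then have "a \<noteq> k" using \<open>k \<notin> T\<close> by blast
    then show "?f a \<in> S" using low[OF a] up[of "a - 1"] a k by (cases a) auto
  qed
  ultimately show ?thesis using card_inj_on_le fin by blast
qed

text \<open>Only sizes of slices matter. A variable other than the two compressed ones gives an
  inclusion of slices. One of these two raises the sum of their exponents by one, and then the slice
  of \<open>m\<close> is either at least as large or full; a full slice admits every
  exponent.\<close>

lemma down_closed_compress:
  assumes M: "down_closed M"
  shows "down_closed (compress M j ` M)"
  unfolding down_closed_def mem_compress_iff
proof (intro allI impI)
  fix m :: monomial and i
  let ?m = "m + single i 1" and ?s = "lookup m j + lookup m (Suc j)"
  assume less: "lookup ?m (Suc j) < card (slice M j ?m)"
  have le: "lookup m (Suc j) \<le> ?s" by simp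
  have pred: "m' \<in> M" if "m' + single i 1 \<in> M" for m' i using M that by (auto simp: down_closed_def)
  show "lookup m (Suc j) < card (slice M j m)"
  proof (cases "i = j \<or> i = Suc j")
    case False
    have "shift j a ?m = shift j a m + single i 1" for a
      using False by (intro poly_mapping_eqI) (auto simp: lookup_shift lookup_add lookup_single when_def)
    then have "slice M j ?m \<subseteq> slice M j m"
      using False pred by (auto simp: slice_def lookup_add lookup_single)
    then have "card (slice M j ?m) \<le> card (slice M j m)" by (intro card_mono finite_slice)
    then show ?thesis using less False by (simp add: lookup_add lookup_single)
  next
    case True
    have eq1: "shift j a ?m = shift j a m + single j 1" if "a \<le> ?s" for a
      using True that by (intro poly_mapping_eqI) (auto simp: lookup_shift lookup_add lookup_single when_def)
    have eq2: "shift j (Suc a) ?m = shift j a m + single (Suc j) 1" if "a \<le> ?s" for a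
      using True that by (intro poly_mapping_eqI) (auto simp: lookup_shift lookup_add lookup_single when_def)
    have deg: "lookup ?m j + lookup ?m (Suc j) = Suc ?s" using True by (auto simp: lookup_add lookup_single)
    have "card (slice M j ?m) \<le> card (slice M j m) \<or> card (slice M j m) = Suc ?s"
    proof (rule slice_card_cases)
      show "slice M j m \<subseteq> {..?s}" "slice M j ?m \<subseteq> {..Suc ?s}"
        using deg by (auto simp: slice_def)
      show "a \<in> slice M j m" if "a \<in> slice M j ?m" "a \<le> ?s" for a
        using that pred eq1 by (auto simp: slice_def)
      show "a \<in> slice M j m" if "Suc a \<in> slice M j ?m" for a
        using that pred eq2[of a] deg by (auto simp: slice_def)
    qed
    then show ?thesis using less le by (auto simp: lookup_add)
  qed
qed

lemma compress_properties:
  assumes "M \<subseteq> monomials n" "Suc j < n" "m \<in> M"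
  shows "compress M j m \<in> monomials n" "mdeg (compress M j m) = mdeg m"
    "weight n (compress M j m) \<le> weight n m"
    "0 < b \<Longrightarrow> b \<le> lookup m (Suc j) \<Longrightarrow> shift j (lookup m (Suc j) - b) m \<notin> M
      \<Longrightarrow> weight n (compress M j m) < weight n m"
proof -
  obtain r where r: "compress M j m = shift j r m" "r \<le> lookup m (Suc j)"
    "r = card {a \<in> slice M j m. a < lookup m (Suc j)}" by (rule compress_eq_shift)
  have m: "m \<in> monomials n" and le: "r \<le> lookup m j + lookup m (Suc j)" using assms r by auto
  show "compress M j m \<in> monomials n" "mdeg (compress M j m) = mdeg m"
    unfolding r(1) using shift_monomials[OF m assms(2)] mdeg_shift[OF m assms(2) le] by auto
  have w: "weight n (compress M j m) + lookup m (Suc j) = weight n m + r"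
    unfolding r(1) by (rule weight_shift[OF assms(2) le])
  show "weight n (compress M j m) \<le> weight n m" using w r(2) by simp
  show "weight n (compress M j m) < weight n m"
    if b: "0 < b" "b \<le> lookup m (Suc j)" "shift j (lookup m (Suc j) - b) m \<notin> M"
  proof -
    \<comment> \<open>A missing value below the old exponent makes its position in the slice
      strictly smaller than the exponent itself.\<close>
    have "{a \<in> slice M j m. a < lookup m (Suc j)} \<subset> {..<lookup m (Suc j)}"
    proof (rule psubsetI)
      have "lookup m (Suc j) - b \<in> {..<lookup m (Suc j)}" using b by auto
      moreover have "lookup m (Suc j) - b \<notin> slice M j m" using b by (simp add: slice_def)
      ultimately show "{a \<in> slice M j m. a < lookup m (Suc j)} \<noteq> {..<lookup m (Suc j)}" by blast
    qed auto
    then have "r < lookup m (Suc j)" using psubset_card_mono[of "{..<lookup m (Suc j)}"] r(3) by auto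
    then show ?thesis using w by simp
  qed
qed

lemma of_deg_image:
  assumes "\<And>m. m \<in> M \<Longrightarrow> mdeg (f m) = mdeg m"
  shows "of_deg q (f ` M) = f ` of_deg q M"
  using assms by (auto simp: of_deg_def)

text \<open>A set of least total weight is not changed by any compression.\<close>

theorem exists_stable:
  assumes "finite M" "M \<subseteq> monomials n" "down_closed M"
  shows "\<exists>N. finite N \<and> N \<subseteq> monomials n \<and> down_closed N
    \<and> (\<forall>q. card (of_deg q N) = card (of_deg q M))
    \<and> (\<forall>m j. m + single (Suc j) 1 \<in> N \<longrightarrow> m + single j 1 \<in> N)"
proof -
  let ?P = "\<lambda>N. finite N \<and> N \<subseteq> monomials n \<and> down_closed N \<and> (\<forall>q. card (of_deg q N) = card (of_deg q M))"
  have PM: "?P M" using assms by simp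
  obtain N where N: "?P N" and min: "\<And>N'. ?P N' \<Longrightarrow> (\<Sum>m\<in>N. weight n m) \<le> (\<Sum>m\<in>N'. weight n m)"
    using ex_has_least_nat[of ?P M "\<lambda>N. \<Sum>m\<in>N. weight n m", OF PM] by metis
  have "m + single j 1 \<in> N" if m: "m + single (Suc j) 1 \<in> N" for m j
  proof (rule ccontr)
    assume neg: "m + single j 1 \<notin> N"
    let ?m = "m + single (Suc j) 1" and ?c = "compress N j"
    have j: "Suc j < n" using m N by (auto simp: monomials_def keys_add_nat)
    have sub: "N \<subseteq> monomials n" using N by simp
    have "shift j (lookup ?m (Suc j) - 1) ?m = m + single j 1"
      by (intro poly_mapping_eqI) (auto simp: lookup_shift lookup_add lookup_single when_def)
    then have less: "weight n (?c ?m) < weight n ?m"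
      using compress_properties(4)[OF sub j m, of 1] neg by (simp add: lookup_add)
    have "(\<Sum>m\<in>N. weight n (?c m)) < (\<Sum>m\<in>N. weight n m)"
    proof (rule sum_strict_mono_ex1)
      show "finite N" using N by simp
      show "\<forall>m\<in>N. weight n (?c m) \<le> weight n m" using compress_properties(3)[OF sub j] by simp
      show "\<exists>m\<in>N. weight n (?c m) < weight n m" using m less by blast
    qed
    moreover have "(\<Sum>m\<in>?c ` N. weight n m) = (\<Sum>m\<in>N. weight n (?c m))"
      by (simp add: sum.reindex[OF inj_on_compress])
    moreover have "(\<Sum>m\<in>N. weight n m) \<le> (\<Sum>m\<in>?c ` N. weight n m)"
    proof (rule min, intro conjI allI)
      show "card (of_deg q (?c ` N)) = card (of_deg q M)" for q
      proof -
        have "of_deg q (?c ` N) = ?c ` of_deg q N"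
          by (rule of_deg_image) (rule compress_properties(2)[OF sub j])
        moreover have "inj_on ?c (of_deg q N)"
          by (rule inj_on_subset[OF inj_on_compress]) (simp add: of_deg_def)
        ultimately have "card (of_deg q (?c ` N)) = card (of_deg q N)"
          by (simp add: card_image)
        then show ?thesis using N by simp
      qed
      show "?c ` N \<subseteq> monomials n" using compress_properties(1)[OF sub j] by blast
      show "finite (?c ` N)" "down_closed (?c ` N)" using N by (simp_all add: down_closed_compress)
    qed
    ultimately show False by linarith
  qed
  then show ?thesis using N by (intro exI[of _ N]) simp
qed

section \<open>Macaulay's bound for order ideals\<close>

definition mon_of :: "nat list \<Rightarrow> monomial" where
  "mon_of xs = (\<Sum>i\<leftarrow>xs. single i 1)"

lemma mon_of_Nil [simp]: "mon_of [] = 0"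
  and mon_of_Cons [simp]: "mon_of (x # xs) = single x 1 + mon_of xs"
  and mon_of_append [simp]: "mon_of (xs @ ys) = mon_of xs + mon_of ys"
  by (simp_all add: mon_of_def)

lemma lookup_mon_of: "lookup (mon_of xs) i = count (mset xs) i"
  by (induction xs) (auto simp: lookup_add lookup_single when_def)

lemma mon_of_eq_iff: "mon_of xs = mon_of ys \<longleftrightarrow> mset xs = mset ys"
  by (auto simp: poly_mapping_eq_iff multiset_eq_iff fun_eq_iff lookup_mon_of)

lemma mdeg_mon_of: "mdeg (mon_of xs) = length xs"
  by (induction xs) (auto simp: mdeg_add)

lemma mon_of_in_monomials_iff: "mon_of xs \<in> monomials n \<longleftrightarrow> set xs \<subseteq> {..<n}"
  by (induction xs) (auto simp: monomials_single, auto simp: monomials_def)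

lemma mon_of_surj: "\<exists>xs. mon_of xs = m"
proof (induction "mdeg m" arbitrary: m)
  case 0
  then show ?case by (intro exI[of _ "[]"]) (simp add: mdeg_eq_0_iff)
next
  case (Suc q)
  then obtain i where i: "i \<in> keys m" by (metis mdeg_pos_obtain zero_less_Suc)
  let ?m = "m - single i 1"
  have m: "m = ?m + single i 1" by (rule monomial_minus_single[OF i])
  have "mdeg m = mdeg ?m + 1" by (subst m) (simp only: mdeg_add mdeg_single)
  then obtain xs where "mon_of xs = ?m" using Suc.hyps by (metis Suc_eq_plus1 nat.inject)
  then have "mon_of (i # xs) = m" using m by (simp add: add.commute)
  then show ?case by blast
qed

lemma bij_betw_mon_of: "bij_betw mon_of {xs \<in> desc_lists 0 d. mon_of xs \<in> M} (of_deg d M)"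
  unfolding bij_betw_def
proof
  show "inj_on mon_of {xs \<in> desc_lists 0 d. mon_of xs \<in> M}"
  proof (rule inj_onI)
    fix xs ys assume "xs \<in> {xs \<in> desc_lists 0 d. mon_of xs \<in> M}" "ys \<in> {xs \<in> desc_lists 0 d. mon_of xs \<in> M}"
      "mon_of xs = mon_of ys"
    then have "mset (rev xs) = mset (rev ys)" "sorted (rev xs)" "sorted (rev ys)"
      by (simp_all add: mon_of_eq_iff desc_lists_def sorted_wrt_rev)
    then have "rev xs = rev ys" by (metis properties_for_sort)
    then show "xs = ys" by simp
  qed
  show "mon_of ` {xs \<in> desc_lists 0 d. mon_of xs \<in> M} = of_deg d M"
  proof (intro subset_antisym subsetI)
    fix m assume "m \<in> mon_of ` {xs \<in> desc_lists 0 d. mon_of xs \<in> M}"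
    then show "m \<in> of_deg d M" by (auto simp: of_deg_def mdeg_mon_of desc_lists_def)
  next
    fix m assume m: "m \<in> of_deg d M"
    obtain xs where xs: "mon_of xs = m" using mon_of_surj by blast
    let ?xs = "rev (sort xs)"
    have "mon_of ?xs = m" using xs by (metis mon_of_eq_iff mset_rev mset_sort)
    moreover have "?xs \<in> desc_lists 0 d"
      using m xs by (auto simp: desc_lists_def sorted_wrt_rev of_deg_def mdeg_mon_of)
    ultimately show "m \<in> mon_of ` {xs \<in> desc_lists 0 d. mon_of xs \<in> M}"
      using m by (intro image_eqI[of _ _ ?xs]) (auto simp: of_deg_def)
  qed
qed

text \<open>Take the list \<open>m\<close> whose rank is the size of M_q; its initial segment has
  one element more than M_q. If M_(q+1) exceeded the bound, it would be at least as large as the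
  segment of \<open>m @ [0]\<close>, and \<open>stable_shadow\<close> would make M_q at least as
  large as the segment of \<open>m\<close>.\<close>

theorem macaulay_bound:
  assumes "M \<subseteq> monomials n" "down_closed M" "1 \<le> q"
  shows "card (of_deg (q + 1) M) \<le> macaulay_power (card (of_deg q M)) q"
proof -
  obtain d where q: "q = Suc d" using assms(3) by (cases q) auto
  \<comment> \<open>Truncation makes the order ideal finite, as a total weight requires, and leaves
    the two compared degrees unchanged.\<close>
  define M' where "M' = {m \<in> M. mdeg m \<le> Suc q}"
  have "finite M'"
    by (rule finite_subset[OF _ finite_monomials_deg_le[of n "Suc q"]]) (use assms(1) in \<open>auto simp: M'_def\<close>)
  moreover have "M' \<subseteq> monomials n" using assms(1) by (auto simp: M'_def)
  moreover have "down_closed M'"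
    using assms(2) by (auto simp: down_closed_def M'_def mdeg_add)
  ultimately obtain N where N: "finite N" "N \<subseteq> monomials n" "down_closed N"
    "\<And>q. card (of_deg q N) = card (of_deg q M')"
    and stable: "\<And>m j. m + single (Suc j) 1 \<in> N \<Longrightarrow> m + single j 1 \<in> N"
    using exists_stable by metis
  have deg: "of_deg q M' = of_deg q M" "of_deg (Suc q) M' = of_deg (Suc q) M"
    by (auto simp: of_deg_def M'_def)
  define B where "B d = {xs \<in> desc_lists 0 d. mon_of xs \<in> N}" for d
  have card_B: "card (B d) = card (of_deg d N)" for d
    unfolding B_def by (rule bij_betw_same_card[OF bij_betw_mon_of])
  have fin: "finite (B d)" for d
    using bij_betw_finite[OF bij_betw_mon_of[of d N]] N(1) by (simp add: B_def of_deg_def)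
  obtain m where m: "m \<in> desc_lists 0 q" "prank m = card (of_deg q M)"
    using prank_surj unfolding q by blast
  have m0: "m @ [0] \<in> desc_lists 0 (Suc q)" using m(1) by (simp add: desc_lists_snoc_iff)
  show ?thesis
  proof (rule ccontr)
    assume "\<not> ?thesis"
    then have "Suc (prank (m @ [0])) \<le> card (B (Suc q))"
      using m macaulay_power_prank[OF m(1)] N(4) deg by (simp add: card_B)
    then have large: "card (initial_seg 0 (m @ [0])) \<le> card (B (Suc q))"
      using card_initial_seg_prank[OF m0] by simp
    have "card (initial_seg 0 (butlast (m @ [0]))) \<le> card {u. u @ [0] \<in> B (Suc q)}"
    proof (rule stable_shadow[OF _ _ m0 large])
      show "B (Suc q) \<subseteq> desc_lists 0 (Suc q) \<inter> {xs. set xs \<subseteq> {..<n}}"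
        using N(2) by (auto simp: B_def mon_of_in_monomials_iff dest!: subsetD[of N])
      show "adj_stable 0 (B (Suc q))"
        unfolding adj_stable_def
      proof (intro allI impI)
        fix u j w assume w: "\<forall>x\<in>set w. x \<le> (j::nat)" and mem: "u @ Suc j # w \<in> B (Suc q)"
        have "mon_of (u @ w) + single (Suc j) 1 \<in> N"
          using mem by (simp add: B_def ac_simps)
        then have "mon_of (u @ w) + single j 1 \<in> N" by (rule stable)
        moreover have "u @ j # w \<in> desc_lists 0 (Suc q)"
          using mem w by (auto simp: B_def desc_lists_def sorted_wrt_append)
        ultimately show "u @ j # w \<in> B (Suc q)" by (simp add: B_def ac_simps)
      qed
    qed
    also have "\<dots> \<le> card (B q)"
    proof (rule card_mono[OF fin])
      show "{u. u @ [0] \<in> B (Suc q)} \<subseteq> B q"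
        using N(3) by (auto simp: B_def desc_lists_snoc_iff down_closed_def)
    qed
    finally have "card (initial_seg 0 m) \<le> card (of_deg q M)" using N(4) deg by (simp add: card_B)
    moreover have "card (initial_seg 0 m) = Suc (card (of_deg q M))"
      using card_initial_seg_prank[of m d] m by (simp add: q)
    ultimately show False by simp
  qed
qed

section \<open>Lexicographic order ideals with a prescribed Hilbert function\<close>

text \<open>Insertion after the equal entries, which keeps the comparison with appending \<open>0\<close> strict.\<close>

primrec desc_insert :: "nat \<Rightarrow> nat list \<Rightarrow> nat list" where
  "desc_insert i [] = [i]"
| "desc_insert i (y # ys) = (if i \<le> y then y # desc_insert i ys else i # y # ys)"

lemma mset_desc_insert: "mset (desc_insert i ys) = add_mset i (mset ys)"
  by (induction ys) auto

lemma set_desc_insert: "set (desc_insert i ys) = insert i (set ys)"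
  by (induction ys) auto

lemma sorted_desc_insert: "sorted_wrt (\<ge>) ys \<Longrightarrow> sorted_wrt (\<ge>) (desc_insert i ys)"
  by (induction ys) (auto simp: set_desc_insert)

lemma desc_insert_mem: "ys \<in> desc_lists 0 d \<Longrightarrow> desc_insert i ys \<in> desc_lists 0 (Suc d)"
  using arg_cong[OF mset_desc_insert[of i ys], of size]
  by (simp add: desc_lists_def sorted_desc_insert)

lemma snoc_0_le_desc_insert: "ys @ [0] \<le> desc_insert i ys"
  by (induction ys) auto

text \<open>In each degree the first \<open>h q\<close> lists are taken. If \<open>ys\<close> is
  omitted, so is every multiple by a variable: the first omitted list \<open>w\<close> satisfies
  \<open>w @ [0] \<le> ys @ [0]\<close>, the latter is the least such multiple of \<open>ys\<close>,
  and the rank of \<open>w @ [0]\<close> is \<open>macaulay_power (h q) q\<close>, hence at least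
  \<open>h (q + 1)\<close>.\<close>

theorem exists_down_closed:
  assumes h0: "h 0 = 1" and h1: "h 1 \<le> n" and growth: "\<And>q. 1 \<le> q \<Longrightarrow> h (q + 1) \<le> macaulay_power (h q) q"
  shows "\<exists>M. M \<subseteq> monomials n \<and> down_closed M \<and> (\<forall>q. card (of_deg q M) = h q)"
proof (intro exI conjI allI)
  define L where "L q = {xs \<in> desc_lists 0 q. prank xs < h q}" for q
  define M where "M = mon_of ` (\<Union>q. L q)"
  have inj: "xs = ys" if "xs \<in> desc_lists 0 q" "ys \<in> desc_lists 0 q'" "mon_of xs = mon_of ys" for xs ys q q'
  proof -
    have "q = q'" using that(1,2) arg_cong[OF that(3), of mdeg] by (simp add: mdeg_mon_of desc_lists_def)
    then show ?thesis using that inj_onD[OF bij_betw_imp_inj_on[OF bij_betw_mon_of[of q UNIV]]] by simp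
  qed
  have mem_M: "mon_of xs \<in> M \<longleftrightarrow> xs \<in> L q" if xs: "xs \<in> desc_lists 0 q" for xs q
  proof
    assume "mon_of xs \<in> M"
    then obtain ys q' where ys: "ys \<in> L q'" "mon_of xs = mon_of ys" by (auto simp: M_def)
    then have "xs = ys" using inj[OF xs, of ys q'] by (simp add: L_def)
    moreover have "q = q'" using ys(1) xs \<open>xs = ys\<close> by (simp add: L_def desc_lists_def)
    ultimately show "xs \<in> L q" using ys by simp
  qed (auto simp: M_def)
  show dc: "down_closed M"
    unfolding down_closed_def
  proof (intro allI impI)
    fix m i assume mem: "m + single i 1 \<in> M"
    define q where "q = mdeg m"
    have "m \<in> of_deg q UNIV" by (simp add: of_deg_def q_def)
    then obtain ys where ys: "ys \<in> desc_lists 0 q" "m = mon_of ys"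
      using bij_betw_imp_surj_on[OF bij_betw_mon_of[of q UNIV]] by auto
    define zs where "zs = desc_insert i ys"
    have zs: "zs \<in> desc_lists 0 (Suc q)" by (simp add: zs_def desc_insert_mem[OF ys(1)])
    have "mon_of zs = mon_of (i # ys)" unfolding mon_of_eq_iff zs_def by (simp add: mset_desc_insert)
    then have "mon_of zs \<in> M" using mem ys by (simp add: add.commute)
    then have small: "prank zs < h (Suc q)" using mem_M[OF zs] by (simp add: L_def)
    have "prank ys < h q"
    proof (cases q)
      case 0
      then show ?thesis using ys h0 by (simp add: desc_lists_def)
    next
      case (Suc d)
      obtain w where w: "w \<in> desc_lists 0 q" "prank w = h q" using prank_surj unfolding Suc by blast
      show ?thesis
      proof (rule ccontr)
        assume "\<not> ?thesis"
        then have "w \<le> ys" using prank_le_iff[OF w(1) ys(1)] w(2) by simp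
        then have "w @ [0] \<le> ys @ [0]"
          using snoc_le_snoc_iff[of w ys 0 0] w(1) ys(1) by (auto simp: desc_lists_def)
        also have "\<dots> \<le> zs" unfolding zs_def by (rule snoc_0_le_desc_insert)
        finally have "prank (w @ [0]) \<le> prank zs"
          using prank_le_iff[OF _ zs, of "w @ [0]"] w(1) by (simp add: desc_lists_snoc_iff)
        moreover have "h (Suc q) \<le> prank (w @ [0])"
          using growth[of q] macaulay_power_prank[OF w(1)] w(2) Suc by simp
        ultimately show False using small by simp
      qed
    qed
    then show "m \<in> M" using mem_M[OF ys(1)] ys by (simp add: L_def)
  qed
  show card: "card (of_deg q M) = h q" for q
  proof -
    have "{xs \<in> desc_lists 0 q. mon_of xs \<in> M} = {xs \<in> desc_lists 0 q. prank xs < h q}"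
      using mem_M by (auto simp: L_def)
    then have "card (of_deg q M) = card {xs \<in> desc_lists 0 q. prank xs < h q}"
      using bij_betw_same_card[OF bij_betw_mon_of[of q M]] by simp
    also have "\<dots> = h q"
    proof (cases q)
      case 0
      have "{xs \<in> desc_lists 0 0. prank xs < h 0} = {[]}" using h0 by (auto simp: desc_lists_def)
      then show ?thesis using 0 h0 by simp
    next
      case (Suc d)
      then show ?thesis by (simp add: card_prank_less)
    qed
    finally show ?thesis .
  qed
  \<comment> \<open>Degree one consists of the lists \<open>[i]\<close> with \<open>i < h 1\<close>,
    so no other variable can divide an element.\<close>
  show "M \<subseteq> monomials n"
  proof
    fix m assume m: "m \<in> M"
    have "i < n" if i: "i \<in> keys m" for i
    proof -
      have "m = single i 1 + (m - single i 1)" using monomial_minus_single[OF i] by (simp add: add.commute)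
      then have "single i 1 \<in> M" using m down_closed_add[OF dc] by metis
      then have "mon_of [i] \<in> M" by simp
      then have "[i] \<in> L 1" using mem_M[of "[i]" 1] by (simp add: desc_lists_def)
      then show ?thesis using h1 by (simp add: L_def)
    qed
    then show "m \<in> monomials n" by (auto simp: monomials_def)
  qed
qed

section \<open>Polynomials and ideals\<close>

abbreviation polys :: "nat \<Rightarrow> 'k::field mpoly set" where
  "polys n \<equiv> carrier (mpoly_ring n)"

lemma mpoly_ring_simps [simp]:
  "p \<otimes>\<^bsub>mpoly_ring n\<^esub> r = p * r" "p \<oplus>\<^bsub>mpoly_ring n\<^esub> r = p + r"
  "\<one>\<^bsub>mpoly_ring n\<^esub> = 1" "\<zero>\<^bsub>mpoly_ring n\<^esub> = 0"
  by (simp_all add: mpoly_ring_def)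

lemma polys_iff: "p \<in> polys n \<longleftrightarrow> keys p \<subseteq> monomials n"
  by (auto simp: mpoly_ring_def monomials_def)

lemma polys_0 [simp]: "0 \<in> polys n" and polys_1 [simp]: "1 \<in> polys n"
  using cring.cring_simprules(2,6)[OF mpoly_ring_cring[of n]] by auto

lemma polys_add [simp]: "p \<in> polys n \<Longrightarrow> r \<in> polys n \<Longrightarrow> p + r \<in> polys n"
  and polys_mult [simp]: "p \<in> polys n \<Longrightarrow> r \<in> polys n \<Longrightarrow> p * r \<in> polys n"
  using cring.cring_simprules(1,5)[OF mpoly_ring_cring, of p n r] by auto

lemma polys_single: "single m c \<in> polys n \<longleftrightarrow> c = 0 \<or> m \<in> monomials n"
  by (auto simp: polys_iff)

lemma zero_in_monomials [simp]: "0 \<in> monomials n"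
  by (simp add: monomials_def)

lemma polys_const [simp]: "const c \<in> polys n"
  by (simp add: const_def polys_single)

lemma polys_var: "i < n \<Longrightarrow> var i \<in> polys n"
  by (simp add: var_def polys_single monomials_single)

lemma const_0 [simp]: "const 0 = 0" and const_1 [simp]: "const 1 = 1"
  and const_add: "const (a + b) = const a + const b"
  and const_mult: "const (a * b) = const a * const b"
  and const_uminus: "const (- a) = - const a"
  by (simp_all add: const_def single_add mult_single single_uminus)

lemma const_diff: "const (a - b) = const a - const b"
  by (simp add: const_def single_diff)

lemma lookup_const_mult: "lookup (const c * p) m = c * lookup p m"
  unfolding const_def mult_map_scale_conv_mult[symmetric] by (simp add: map.rep_eq when_def)

lemma uminus_eq_const_mult: "- p = const (- 1) * p"
  by (simp add: const_uminus)

lemma polys_uminus [simp]: "p \<in> polys n \<Longrightarrow> - p \<in> polys n"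
  unfolding uminus_eq_const_mult[of p] by (intro polys_mult polys_const)

lemma polys_diff [simp]: "p \<in> polys n \<Longrightarrow> r \<in> polys n \<Longrightarrow> p - r \<in> polys n"
  using polys_add[of p n "- r"] by simp

lemma polys_sum: "(\<And>i. i \<in> S \<Longrightarrow> f i \<in> polys n) \<Longrightarrow> sum f S \<in> polys n"
  by (induction S rule: infinite_finite_induct) auto

lemma poly_mapping_expand: "(\<Sum>m\<in>keys p. single m (lookup p m)) = p"
  by (intro poly_mapping_eqI) (auto simp: lookup_sum lookup_single when_def in_keys_iff sum.delta)

lemma single_eq_const_mult: "single m c = const c * single m 1"
  by (simp add: const_def mult_single)

lemma lookup_sum_single:
  "finite S \<Longrightarrow> lookup (\<Sum>m\<in>S. single m (c m)) k = (if k \<in> S then c k else 0)"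
  by (simp add: lookup_sum lookup_single when_def sum.delta)

lemma lookup_single_mult: "lookup (single m c * p) (m + k) = c * lookup p k"
  for m :: monomial and p :: "'k::field mpoly"
proof -
  have "single m c * p = (\<Sum>l\<in>keys p. single (m + l) (c * lookup p l))"
    by (subst poly_mapping_expand[of p, symmetric]) (simp add: sum_distrib_left mult_single)
  also have "lookup \<dots> (m + k) = (\<Sum>l\<in>keys p. if l = k then c * lookup p l else 0)"
    unfolding lookup_sum by (intro sum.cong) (auto simp: lookup_single when_def)
  also have "\<dots> = c * lookup p k" by (auto simp: sum.delta in_keys_iff)
  finally show ?thesis .
qed

lemma keys_single_mult: "c \<noteq> 0 \<Longrightarrow> keys (single m c * p) = (+) m ` keys p"
  for m :: monomial and p :: "'k::field mpoly"
proof
  assume "c \<noteq> 0"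
  then show "(+) m ` keys p \<subseteq> keys (single m c * p)"
    by (auto simp: in_keys_iff lookup_single_mult)
  show "keys (single m c * p) \<subseteq> (+) m ` keys p"
    using keys_mult[of "single m c" p] by (auto split: if_splits)
qed

text \<open>Phrased with the operations of the type, so that ring arithmetic can be left to the
  simplifier; \<open>is_ideal_iff\<close> links it to the library notion.\<close>

definition is_ideal :: "nat \<Rightarrow> 'k::field mpoly set \<Rightarrow> bool" where
  "is_ideal n J \<longleftrightarrow> J \<subseteq> polys n \<and> 0 \<in> J \<and> (\<forall>p\<in>J. \<forall>r\<in>J. p + r \<in> J) \<and> (\<forall>a\<in>polys n. \<forall>p\<in>J. a * p \<in> J)"

lemma is_idealD:
  assumes "is_ideal n J"
  shows "p \<in> J \<Longrightarrow> p \<in> polys n" "0 \<in> J" "p \<in> J \<Longrightarrow> r \<in> J \<Longrightarrow> p + r \<in> J"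
    "a \<in> polys n \<Longrightarrow> p \<in> J \<Longrightarrow> a * p \<in> J"
  using assms by (auto simp: is_ideal_def)

lemma is_ideal_mult2: "is_ideal n J \<Longrightarrow> a \<in> polys n \<Longrightarrow> p \<in> J \<Longrightarrow> p * a \<in> J"
  using is_idealD(4)[of n J a p] by (simp add: mult.commute)

lemma is_ideal_uminus: "is_ideal n J \<Longrightarrow> p \<in> J \<Longrightarrow> - p \<in> J"
  unfolding uminus_eq_const_mult[of p] by (intro is_idealD(4) polys_const)

lemma is_ideal_diff: "is_ideal n J \<Longrightarrow> p \<in> J \<Longrightarrow> r \<in> J \<Longrightarrow> p - r \<in> J"
  using is_idealD(3)[of n J p "- r"] is_ideal_uminus[of n J r] by simp

lemma is_ideal_sum: "is_ideal n J \<Longrightarrow> (\<And>i. i \<in> S \<Longrightarrow> f i \<in> J) \<Longrightarrow> sum f S \<in> J"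
  by (induction S rule: infinite_finite_induct) (auto intro: is_idealD)

lemma a_inv_mpoly_ring: "p \<in> polys n \<Longrightarrow> \<ominus>\<^bsub>mpoly_ring n\<^esub> p = - p"
proof -
  assume p: "p \<in> polys n"
  interpret cring "mpoly_ring n" by (rule mpoly_ring_cring)
  show ?thesis using minus_equality[of "- p" p] p by simp
qed

lemma is_ideal_iff: "is_ideal n J \<longleftrightarrow> ideal J (mpoly_ring n)"
proof
  interpret R: cring "mpoly_ring n :: 'a mpoly ring" by (rule mpoly_ring_cring)
  assume J: "is_ideal n J"
  show "ideal J (mpoly_ring n)"
  proof (rule idealI)
    show "subgroup J (add_monoid (mpoly_ring n))"
    proof (rule R.add.subgroupI)
      show "J \<noteq> {}" using is_idealD(2)[OF J] by blast
      show "\<ominus>\<^bsub>mpoly_ring n\<^esub> a \<in> J" if "a \<in> J" for a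
        using is_ideal_uminus[OF J that] is_idealD(1)[OF J that] by (simp add: a_inv_mpoly_ring)
    qed (use is_idealD[OF J] in auto)
  qed (use is_idealD(4)[OF J] is_ideal_mult2[OF J] R.ring_axioms in auto)
next
  assume "ideal J (mpoly_ring n)"
  then interpret ideal J "mpoly_ring n" .
  show "is_ideal n J"
    unfolding is_ideal_def
  proof (intro conjI ballI)
    show "J \<subseteq> polys n" by (rule a_subset)
    show "0 \<in> J" using additive_subgroup.zero_closed[OF is_additive_subgroup] by simp
    show "p + r \<in> J" if "p \<in> J" "r \<in> J" for p r using additive_subgroup.a_closed[OF is_additive_subgroup that] by simp
    show "a * p \<in> J" if "a \<in> polys n" "p \<in> J" for p a using I_l_closed[OF that(2,1)] by simp
  qed
qed

lemma Idl_is_ideal: "S \<subseteq> polys n \<Longrightarrow> is_ideal n (Idl\<^bsub>mpoly_ring n\<^esub> S)"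
  unfolding is_ideal_iff by (rule ring.genideal_ideal[OF cring.axioms(1)[OF mpoly_ring_cring]])

lemma Idl_superset: "S \<subseteq> polys n \<Longrightarrow> S \<subseteq> Idl\<^bsub>mpoly_ring n\<^esub> S"
  by (rule ring.genideal_self[OF cring.axioms(1)[OF mpoly_ring_cring]])

lemma Idl_minimal: "is_ideal n J \<Longrightarrow> S \<subseteq> J \<Longrightarrow> Idl\<^bsub>mpoly_ring n\<^esub> S \<subseteq> J"
  unfolding is_ideal_iff by (rule ring.genideal_minimal[OF cring.axioms(1)[OF mpoly_ring_cring]])

section \<open>Adjoining one element to an ideal\<close>

definition adjoin :: "nat \<Rightarrow> 'k::field mpoly set \<Rightarrow> 'k mpoly \<Rightarrow> 'k mpoly set" where
  "adjoin n J f = {g + a * f | g a. g \<in> J \<and> a \<in> polys n}"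

text \<open>The nonzerodivisor condition on A/J alone. Properness is carried along separately, as
  \<open>1 \<notin> J\<close>.\<close>

definition regular_on :: "nat \<Rightarrow> 'k::field mpoly set \<Rightarrow> 'k mpoly \<Rightarrow> bool" where
  "regular_on n J f \<longleftrightarrow> (\<forall>g\<in>polys n. f * g \<in> J \<longrightarrow> g \<in> J)"

lemma adjoin_ideal:
  assumes J: "is_ideal n J" and f: "f \<in> polys n"
  shows "is_ideal n (adjoin n J f)"
  unfolding is_ideal_def
proof (intro conjI ballI)
  show "adjoin n J f \<subseteq> polys n" using is_idealD(1)[OF J] f by (auto simp: adjoin_def)
  have "0 = 0 + 0 * f" by simp
  then show "0 \<in> adjoin n J f" using is_idealD(2)[OF J] polys_0 unfolding adjoin_def by blast
  show "p + r \<in> adjoin n J f" if pr: "p \<in> adjoin n J f" "r \<in> adjoin n J f" for p r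
  proof -
    obtain g a h b where "p = g + a * f" "r = h + b * f" "g \<in> J" "h \<in> J" "a \<in> polys n" "b \<in> polys n"
      using pr unfolding adjoin_def by blast
    then have "p + r = (g + h) + (a + b) * f" "g + h \<in> J" "a + b \<in> polys n"
      using is_idealD(3)[OF J] by (auto simp: algebra_simps)
    then show ?thesis unfolding adjoin_def by blast
  qed
  show "a * p \<in> adjoin n J f" if ap: "a \<in> polys n" "p \<in> adjoin n J f" for a p
  proof -
    obtain g b where "p = g + b * f" "g \<in> J" "b \<in> polys n" using ap unfolding adjoin_def by blast
    then have "a * p = a * g + (a * b) * f" "a * g \<in> J" "a * b \<in> polys n"
      using is_idealD(4)[OF J] ap by (auto simp: algebra_simps)
    then show ?thesis unfolding adjoin_def by blast
  qed
qed

lemma adjoin_superset: "is_ideal n J \<Longrightarrow> J \<subseteq> adjoin n J f"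
proof
  fix g assume "g \<in> J"
  then have "g = g + 0 * f" "g \<in> J" by auto
  then show "g \<in> adjoin n J f" using polys_0 unfolding adjoin_def by blast
qed

lemma adjoin_mem: "is_ideal n J \<Longrightarrow> a \<in> polys n \<Longrightarrow> a * f \<in> adjoin n J f"
proof -
  assume "is_ideal n J" "a \<in> polys n"
  then have "a * f = 0 + a * f" "0 \<in> J" using is_idealD(2) by auto
  then show ?thesis using \<open>a \<in> polys n\<close> unfolding adjoin_def by blast
qed

lemma adjoin_minimal: "is_ideal n K \<Longrightarrow> J \<subseteq> K \<Longrightarrow> f \<in> K \<Longrightarrow> adjoin n J f \<subseteq> K"
  by (auto simp: adjoin_def intro!: is_idealD(3) is_idealD(4))

lemma adjoin_self: "is_ideal n J \<Longrightarrow> f \<in> adjoin n J f"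
  using adjoin_mem[of n J 1 f] by simp

lemma adjoin_commute:
  assumes "is_ideal n J" "f \<in> polys n" "g \<in> polys n"
  shows "adjoin n (adjoin n J f) g = adjoin n (adjoin n J g) f"
proof -
  have "adjoin n (adjoin n J f) g \<subseteq> adjoin n (adjoin n J g) f"
    if f: "f \<in> polys n" and g: "g \<in> polys n" for f g
  proof -
    note i1 = adjoin_ideal[OF assms(1) g] and i2 = adjoin_ideal[OF adjoin_ideal[OF assms(1) g] f]
    have "J \<subseteq> adjoin n (adjoin n J g) f"
      using adjoin_superset[OF assms(1)] adjoin_superset[OF i1] by (rule order_trans)
    then have "adjoin n J f \<subseteq> adjoin n (adjoin n J g) f"
      by (rule adjoin_minimal[OF i2 _ adjoin_self[OF i1]])
    moreover have "g \<in> adjoin n (adjoin n J g) f"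
      by (rule subsetD[OF adjoin_superset[OF i1] adjoin_self[OF assms(1)]])
    ultimately show ?thesis by (rule adjoin_minimal[OF i2])
  qed
  then show ?thesis using assms(2,3) by (intro subset_antisym)
qed

lemma Idl_insert:
  assumes "S \<subseteq> polys n" "f \<in> polys n"
  shows "Idl\<^bsub>mpoly_ring n\<^esub> (insert f S) = adjoin n (Idl\<^bsub>mpoly_ring n\<^esub> S) f"
proof (rule subset_antisym)
  note I = Idl_is_ideal[OF assms(1)]
  have "insert f S \<subseteq> polys n" using assms by blast
  note I' = Idl_is_ideal[OF this] Idl_superset[OF this]
  show "Idl\<^bsub>mpoly_ring n\<^esub> (insert f S) \<subseteq> adjoin n (Idl\<^bsub>mpoly_ring n\<^esub> S) f"
    using Idl_superset[OF assms(1)] adjoin_superset[OF I, of f] adjoin_self[OF I, of f]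
    by (intro Idl_minimal adjoin_ideal I assms) blast
  show "adjoin n (Idl\<^bsub>mpoly_ring n\<^esub> S) f \<subseteq> Idl\<^bsub>mpoly_ring n\<^esub> (insert f S)"
    using I' by (intro adjoin_minimal Idl_minimal) auto
qed

section \<open>Hilbert functions via graded bases\<close>

definition spanned :: "'k::field mpoly set \<Rightarrow> 's set \<Rightarrow> ('s \<Rightarrow> 'k mpoly) \<Rightarrow> 'k mpoly \<Rightarrow> bool" where
  "spanned J S b p \<longleftrightarrow> (\<exists>c. p - (\<Sum>s\<in>S. const (c s) * b s) \<in> J)"

text \<open>The classes of the family \<open>b\<close> form a basis of (A/J)_q. The index type is
  arbitrary because a basis will be assembled over a disjoint sum of two index sets.\<close>

definition graded_basis :: "nat \<Rightarrow> 'k::field mpoly set \<Rightarrow> nat \<Rightarrow> 's set \<Rightarrow> ('s \<Rightarrow> 'k mpoly) \<Rightarrow> bool" where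
  "graded_basis n J q S b \<longleftrightarrow> finite S \<and> b ` S \<subseteq> graded_part n q \<and>
    (\<forall>c. (\<Sum>s\<in>S. const (c s) * b s) \<in> J \<longrightarrow> (\<forall>s\<in>S. c s = 0)) \<and>
    (\<forall>p\<in>graded_part n q. spanned J S b p)"

lemma graded_part_iff: "p \<in> graded_part n q \<longleftrightarrow> keys p \<subseteq> of_deg q (monomials n)"
  by (auto simp: graded_part_def polys_iff of_deg_def)

lemma graded_part_polys: "p \<in> graded_part n q \<Longrightarrow> p \<in> polys n"
  by (simp add: graded_part_def)

lemma graded_part_0 [simp]: "0 \<in> graded_part n q"
  by (simp add: graded_part_iff)

lemma graded_part_add: "p \<in> graded_part n q \<Longrightarrow> r \<in> graded_part n q \<Longrightarrow> p + r \<in> graded_part n q"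
  unfolding graded_part_iff using Poly_Mapping.keys_add[of p r] by blast

lemma graded_part_const_mult: "p \<in> graded_part n q \<Longrightarrow> const c * p \<in> graded_part n q"
  unfolding graded_part_iff by (auto simp: in_keys_iff lookup_const_mult subset_iff)

lemma graded_part_diff: "p \<in> graded_part n q \<Longrightarrow> r \<in> graded_part n q \<Longrightarrow> p - r \<in> graded_part n q"
  using graded_part_add[of p n q "const (- 1) * r"] graded_part_const_mult[of r n q "- 1"]
  by (simp add: const_uminus)

lemma graded_part_sum: "(\<And>i. i \<in> S \<Longrightarrow> f i \<in> graded_part n q) \<Longrightarrow> sum f S \<in> graded_part n q"
  by (induction S rule: infinite_finite_induct) (auto intro: graded_part_add)

lemma graded_part_mult: "p \<in> graded_part n q \<Longrightarrow> r \<in> graded_part n q' \<Longrightarrow> p * r \<in> graded_part n (q + q')"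
  unfolding graded_part_iff
proof
  fix m assume "keys p \<subseteq> of_deg q (monomials n)" "keys r \<subseteq> of_deg q' (monomials n)" "m \<in> keys (p * r)"
  moreover obtain a b where "m = a + b" "a \<in> keys p" "b \<in> keys r"
    using keys_mult[of p r] calculation(3) by blast
  ultimately show "m \<in> of_deg (q + q') (monomials n)" by (auto simp: of_deg_def mdeg_add)
qed

lemma coset_eq_iff:
  assumes "is_ideal n J" "f \<in> polys n" "g \<in> polys n"
  shows "J +>\<^bsub>mpoly_ring n\<^esub> f = J +>\<^bsub>mpoly_ring n\<^esub> g \<longleftrightarrow> f - g \<in> J"
proof -
  have coset: "J +>\<^bsub>mpoly_ring n\<^esub> h = {j + h | j. j \<in> J}" for h
    by (auto simp: a_r_coset_def')
  show ?thesis
  proof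
    assume "J +>\<^bsub>mpoly_ring n\<^esub> f = J +>\<^bsub>mpoly_ring n\<^esub> g"
    moreover have "0 + f \<in> J +>\<^bsub>mpoly_ring n\<^esub> f" unfolding coset using is_idealD(2)[OF assms(1)] by blast
    ultimately obtain j where "0 + f = j + g" "j \<in> J" unfolding coset by blast
    then show "f - g \<in> J" by simp
  next
    assume d: "f - g \<in> J"
    have "j + f \<in> {j + g | j. j \<in> J}" if "j \<in> J" for j
    proof -
      have "j + f = (j + (f - g)) + g" "j + (f - g) \<in> J" using d that is_idealD(3)[OF assms(1)] by auto
      then show ?thesis by blast
    qed
    moreover have "j + g \<in> {j + f | j. j \<in> J}" if "j \<in> J" for j
    proof -
      have "j + g = (j - (f - g)) + f" "j - (f - g) \<in> J" using d that is_ideal_diff[OF assms(1)] by auto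
      then show ?thesis by blast
    qed
    ultimately show "J +>\<^bsub>mpoly_ring n\<^esub> f = J +>\<^bsub>mpoly_ring n\<^esub> g" unfolding coset by blast
  qed
qed

lemma subfield_const: "subfield (range const) (mpoly_ring n :: 'k::field mpoly ring)"
proof -
  interpret R: cring "mpoly_ring n :: 'k mpoly ring" by (rule mpoly_ring_cring)
  show ?thesis
  proof (rule R.subfieldI)
    show "subcring (range const) (mpoly_ring n :: 'k mpoly ring)"
    proof (rule R.subcringI'[OF R.subringI])
      show "\<one>\<^bsub>mpoly_ring n\<^esub> \<in> range (const :: 'k \<Rightarrow> _)" using const_1 by (metis mpoly_ring_simps(3) rangeI)
    qed (auto simp: a_inv_mpoly_ring simp flip: const_uminus const_add const_mult)
    show "Units (mpoly_ring n \<lparr>carrier := range const\<rparr>) = range const - {\<zero>\<^bsub>mpoly_ring n :: 'k mpoly ring\<^esub>}"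
    proof (intro subset_antisym subsetI)
      fix x :: "'k mpoly" assume "x \<in> Units (mpoly_ring n \<lparr>carrier := range const\<rparr>)"
      then show "x \<in> range const - {\<zero>\<^bsub>mpoly_ring n :: 'k mpoly ring\<^esub>}" by (auto simp: Units_def)
    next
      fix x :: "'k mpoly" assume "x \<in> range const - {\<zero>\<^bsub>mpoly_ring n :: 'k mpoly ring\<^esub>}"
      then obtain c where "x = const c" "const c \<noteq> (0 :: 'k mpoly)" by auto
      then have c: "x = const c" "c \<noteq> 0" by auto
      then have "const (inverse c) * x = 1" "x * const (inverse c) = 1" by (simp_all flip: const_mult)
      then show "x \<in> Units (mpoly_ring n \<lparr>carrier := range const\<rparr>)"
        using c by (auto simp: Units_def)
    qed
  qed
qed

text \<open>The bridge from the dimension in the quotient ring to graded bases, through which every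
  Hilbert function below is computed: combinations of lists of cosets become sums over the index
  set, and equality of cosets becomes congruence modulo \<open>J\<close>.\<close>

lemma hilbert_fun_eq_card:
  fixes J :: "'k::field mpoly set"
  assumes J: "is_ideal n J" and proper: "1 \<notin> J" and basis: "graded_basis n J q S b"
  shows "hilbert_fun n J q = card S"
proof -
  let ?A = "mpoly_ring n :: 'k mpoly ring"
  let ?Q = "?A Quot J" and ?\<pi> = "\<lambda>f. J +>\<^bsub>?A\<^esub> f"
  interpret R: cring ?A by (rule mpoly_ring_cring)
  interpret I: ideal J ?A using J by (simp add: is_ideal_iff)
  interpret Q: cring ?Q by (rule I.quotient_is_cring) (rule mpoly_ring_cring)
  interpret h: ring_hom_ring ?A ?Q ?\<pi> by (rule I.rcos_ring_hom_ring)
  have S: "finite S" "\<And>s. s \<in> S \<Longrightarrow> b s \<in> graded_part n q"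
    and indep: "\<And>c s. (\<Sum>s\<in>S. const (c s) * b s) \<in> J \<Longrightarrow> s \<in> S \<Longrightarrow> c s = 0"
    and span: "\<And>p. p \<in> graded_part n q \<Longrightarrow> spanned J S b p"
    using basis by (auto simp: graded_basis_def)
  have b: "s \<in> S \<Longrightarrow> b s \<in> polys n" for s using S(2) graded_part_polys by blast
  have "\<one>\<^bsub>?Q\<^esub> \<noteq> \<zero>\<^bsub>?Q\<^esub>"
    using coset_eq_iff[OF J polys_1 polys_0] proper h.hom_one h.hom_zero by auto
  then have K: "subfield (?\<pi> ` range const) ?Q" by (rule h.img_is_subfield(2)[OF subfield_const])
  let ?K = "?\<pi> ` range const"
  have lin: "(\<Sum>s\<in>T. const (c s) * b s) \<in> polys n" if "T \<subseteq> S" for c T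
    using that b by (intro polys_sum polys_mult) auto
  have combine: "Q.combine (map (\<lambda>s. ?\<pi> (const (c s))) ss) (map (\<lambda>s. ?\<pi> (b s)) ss)
      = ?\<pi> (\<Sum>s\<in>set ss. const (c s) * b s)" if "distinct ss" "set ss \<subseteq> S" for ss c
    using that
  proof (induction ss)
    case Nil
    then show ?case using h.hom_zero by simp
  next
    case (Cons s ss)
    then show ?case
      using h.hom_mult[of "const (c s)" "b s"] h.hom_add[of "const (c s) * b s" "\<Sum>s\<in>set ss. const (c s) * b s"]
        b[of s] lin[of "set ss" c] by simp
  qed
  have scalars: "\<exists>c. Ks = map (\<lambda>s. ?\<pi> (const (c s))) ss"
    if "set Ks \<subseteq> ?K" "length Ks = length ss" "distinct ss" for Ks ss
    using that(2,1,3)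
  proof (induction Ks ss rule: list_induct2)
    case (Cons k Ks s ss)
    then obtain c a where c: "Ks = map (\<lambda>s. ?\<pi> (const (c s))) ss" "k = ?\<pi> (const a)" by auto
    then show ?case using Cons.prems by (intro exI[of _ "c(s := a)"]) auto
  qed simp
  have span_iff: "x \<in> Q.Span ?K (map (\<lambda>s. ?\<pi> (b s)) ss) \<longleftrightarrow>
      (\<exists>c. x = ?\<pi> (\<Sum>s\<in>set ss. const (c s) * b s))" if ss: "distinct ss" "set ss \<subseteq> S" for ss x
  proof -
    have carr: "set (map (\<lambda>s. ?\<pi> (b s)) ss) \<subseteq> carrier ?Q" using ss b h.hom_closed by auto
    show ?thesis
      unfolding Q.Span_mem_iff_length_version[OF K carr]
    proof
      assume "\<exists>Ks. set Ks \<subseteq> ?K \<and> length Ks = length (map (\<lambda>s. ?\<pi> (b s)) ss) \<and> x = Q.combine Ks (map (\<lambda>s. ?\<pi> (b s)) ss)"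
      then obtain Ks where Ks: "set Ks \<subseteq> ?K" "length Ks = length ss" "x = Q.combine Ks (map (\<lambda>s. ?\<pi> (b s)) ss)"
        by auto
      obtain c where "Ks = map (\<lambda>s. ?\<pi> (const (c s))) ss" using scalars[OF Ks(1,2) ss(1)] by blast
      then show "\<exists>c. x = ?\<pi> (\<Sum>s\<in>set ss. const (c s) * b s)"
        using combine[OF ss, of c] Ks(3) by blast
    next
      assume "\<exists>c. x = ?\<pi> (\<Sum>s\<in>set ss. const (c s) * b s)"
      then obtain c where "x = ?\<pi> (\<Sum>s\<in>set ss. const (c s) * b s)" by blast
      then show "\<exists>Ks. set Ks \<subseteq> ?K \<and> length Ks = length (map (\<lambda>s. ?\<pi> (b s)) ss) \<and> x = Q.combine Ks (map (\<lambda>s. ?\<pi> (b s)) ss)"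
        using combine[OF ss, of c] by (intro exI[of _ "map (\<lambda>s. ?\<pi> (const (c s))) ss"]) auto
    qed
  qed
  have independent: "Q.independent ?K (map (\<lambda>s. ?\<pi> (b s)) ss)" if "distinct ss" "set ss \<subseteq> S" for ss
    using that
  proof (induction ss)
    case (Cons s ss)
    have "?\<pi> (b s) \<notin> Q.Span ?K (map (\<lambda>s. ?\<pi> (b s)) ss)"
    proof
      assume "?\<pi> (b s) \<in> Q.Span ?K (map (\<lambda>s. ?\<pi> (b s)) ss)"
      then obtain c where "?\<pi> (b s) = ?\<pi> (\<Sum>t\<in>set ss. const (c t) * b t)"
        using span_iff Cons.prems by auto
      then have rel: "b s - (\<Sum>t\<in>set ss. const (c t) * b t) \<in> J"
        using coset_eq_iff[OF J b lin] Cons.prems by auto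
      \<comment> \<open>The expression of \<open>b s\<close> through the other elements, rewritten
        as one relation over all of \<open>S\<close> with coefficient 1 at \<open>s\<close>.\<close>
      define d where "d t = (if t = s then 1 else if t \<in> set ss then - c t else 0)" for t
      have "(\<Sum>t\<in>S. const (d t) * b t) = (\<Sum>t\<in>set (s # ss). const (d t) * b t)"
        using Cons.prems S(1) by (intro sum.mono_neutral_right) (auto simp: d_def)
      also have "\<dots> = b s + (\<Sum>t\<in>set ss. const (d t) * b t)"
        using Cons.prems by (simp add: d_def)
      also have "(\<Sum>t\<in>set ss. const (d t) * b t) = - (\<Sum>t\<in>set ss. const (c t) * b t)"
        unfolding sum_negf[symmetric] using Cons.prems
        by (intro sum.cong) (auto simp: d_def const_uminus)
      finally have "(\<Sum>t\<in>S. const (d t) * b t) \<in> J" using rel by simp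
      then have "d s = 0" using indep Cons.prems by auto
      then show False by (simp add: d_def)
    qed
    then show ?case using Cons b h.hom_closed by (auto intro!: Q.li_Cons)
  qed simp
  obtain ss where ss: "set ss = S" "distinct ss" using finite_distinct_list[OF S(1)] by blast
  have "Q.Span ?K (map (\<lambda>s. ?\<pi> (b s)) ss) = ?\<pi> ` graded_part n q"
  proof (intro subset_antisym subsetI)
    fix x assume "x \<in> Q.Span ?K (map (\<lambda>s. ?\<pi> (b s)) ss)"
    then obtain c where "x = ?\<pi> (\<Sum>s\<in>S. const (c s) * b s)" using span_iff ss by auto
    moreover have "(\<Sum>s\<in>S. const (c s) * b s) \<in> graded_part n q"
      using S(2) by (intro graded_part_sum graded_part_const_mult)
    ultimately show "x \<in> ?\<pi> ` graded_part n q" by blast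
  next
    fix x assume "x \<in> ?\<pi> ` graded_part n q"
    then obtain p where p: "p \<in> graded_part n q" "x = ?\<pi> p" by blast
    then obtain c where "p - (\<Sum>s\<in>S. const (c s) * b s) \<in> J" using span by (auto simp: spanned_def)
    then have "x = ?\<pi> (\<Sum>s\<in>S. const (c s) * b s)"
      using coset_eq_iff[OF J graded_part_polys[OF p(1)] lin] p by auto
    then show "x \<in> Q.Span ?K (map (\<lambda>s. ?\<pi> (b s)) ss)" using span_iff ss by auto
  qed
  then have "Q.dimension (length (map (\<lambda>s. ?\<pi> (b s)) ss)) ?K (?\<pi> ` graded_part n q)"
    using independent[of ss] ss by (intro Q.dimensionI[OF K]) auto
  then have dim: "Q.dimension (card S) ?K (?\<pi> ` graded_part n q)" using ss distinct_card by force
  then have "(THE d. Q.dimension d ?K (?\<pi> ` graded_part n q)) = card S"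
    by (intro the_equality) (use Q.dimension_is_inj[OF K] in blast)+
  then show ?thesis by (simp add: hilbert_fun_def Let_def)
qed

section \<open>Homogeneous components\<close>

definition part :: "monomial set \<Rightarrow> 'k::field mpoly \<Rightarrow> 'k mpoly" where
  "part S p = (\<Sum>m\<in>keys p \<inter> S. single m (lookup p m))"

abbreviation hcomp :: "nat \<Rightarrow> 'k::field mpoly \<Rightarrow> 'k mpoly" where
  "hcomp q \<equiv> part {m. mdeg m = q}"

lemma lookup_part: "lookup (part S p) m = (if m \<in> S then lookup p m else 0)"
  unfolding part_def by (subst lookup_sum_single) (auto simp: in_keys_iff)

lemma keys_part: "keys (part S p) = keys p \<inter> S"
  by (auto simp: in_keys_iff lookup_part split: if_splits)

lemma part_add: "part S (p + r) = part S p + part S r"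
  by (intro poly_mapping_eqI) (simp add: lookup_part lookup_add)

lemma part_eq_self: "keys p \<subseteq> S \<Longrightarrow> part S p = p"
  by (intro poly_mapping_eqI) (auto simp: lookup_part in_keys_iff)

lemma part_eq_0: "keys p \<inter> S = {} \<Longrightarrow> part S p = 0"
  by (intro poly_mapping_eqI) (auto simp: lookup_part in_keys_iff)

lemma part_split: "part S p + part (- S) p = p"
  by (intro poly_mapping_eqI) (auto simp: lookup_part lookup_add)

lemma part_polys: "p \<in> polys n \<Longrightarrow> part S p \<in> polys n"
  by (auto simp: polys_iff keys_part)

lemma hcomp_graded: "p \<in> polys n \<Longrightarrow> hcomp q p \<in> graded_part n q"
  by (auto simp: graded_part_iff polys_iff keys_part of_deg_def)

lemma hcomp_graded_self: "p \<in> graded_part n q \<Longrightarrow> hcomp q p = p"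
  by (rule part_eq_self) (auto simp: graded_part_iff of_deg_def)

lemma keys_mult_mdeg:
  assumes "m \<in> keys (p * r)" "\<And>a. a \<in> keys p \<Longrightarrow> P (mdeg a)" "\<And>b. b \<in> keys r \<Longrightarrow> mdeg b = d"
  shows "\<exists>e. P e \<and> mdeg m = e + d"
proof -
  obtain a b where "m = a + b" "a \<in> keys p" "b \<in> keys r" using keys_mult[of p r] assms(1) by blast
  then show ?thesis using assms(2,3) by (intro exI[of _ "mdeg a"]) (simp add: mdeg_add)
qed

lemma hcomp_mult_homogeneous:
  assumes l: "\<And>m. m \<in> keys l \<Longrightarrow> mdeg m = d"
  shows "hcomp (q + d) (a * l) = hcomp q a * l" "q < d \<Longrightarrow> hcomp q (a * l) = 0"
proof -
  let ?r = "part (- {m. mdeg m = q}) a"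
  have "hcomp (q + d) (hcomp q a * l) = hcomp q a * l"
  proof (rule part_eq_self, rule subsetI)
    fix m assume "m \<in> keys (hcomp q a * l)"
    then have "\<exists>e. e = q \<and> mdeg m = e + d" by (rule keys_mult_mdeg) (auto simp: keys_part l)
    then show "m \<in> {m. mdeg m = q + d}" by simp
  qed
  moreover have "hcomp (q + d) (?r * l) = 0"
  proof -
    have "mdeg m \<noteq> q + d" if "m \<in> keys (?r * l)" for m
    proof -
      have "\<exists>e. e \<noteq> q \<and> mdeg m = e + d" by (rule keys_mult_mdeg[OF that]) (auto simp: keys_part l)
      then show ?thesis by auto
    qed
    then show ?thesis by (intro part_eq_0) auto
  qed
  moreover have "a * l = hcomp q a * l + ?r * l"
    by (simp add: part_split flip: distrib_right)
  ultimately show "hcomp (q + d) (a * l) = hcomp q a * l" by (simp add: part_add)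
  show "hcomp q (a * l) = 0" if "q < d"
  proof -
    have "mdeg m \<noteq> q" if m: "m \<in> keys (a * l)" for m
    proof -
      have "\<exists>e. True \<and> mdeg m = e + d" by (rule keys_mult_mdeg[OF m]) (auto simp: l)
      then show ?thesis using \<open>q < d\<close> by auto
    qed
    then show ?thesis by (intro part_eq_0) auto
  qed
qed

definition homog :: "nat \<Rightarrow> 'k::field mpoly set \<Rightarrow> bool" where
  "homog n J \<longleftrightarrow> is_ideal n J \<and> (\<forall>p\<in>J. \<forall>q. hcomp q p \<in> J)"

lemma homog_ideal: "homog n J \<Longrightarrow> is_ideal n J"
  by (simp add: homog_def)

text \<open>The elements of \<open>J\<close> all of whose components lie in \<open>J\<close> again
  form an ideal: multiplication by a single term only shifts degrees, and every multiplier is a sum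
  of terms. This ideal contains the homogeneous generators, hence equals \<open>J\<close>.\<close>

lemma homogeneous_ideal_homog:
  assumes "homogeneous_ideal n J"
  shows "homog n J"
proof -
  obtain G where G: "G \<subseteq> (\<Union>q. graded_part n q)" "J = Idl\<^bsub>mpoly_ring n\<^esub> G"
    using assms by (auto simp: homogeneous_ideal_def)
  have sub: "G \<subseteq> polys n" using G(1) graded_part_polys by blast
  have J: "is_ideal n J" unfolding G(2) by (rule Idl_is_ideal[OF sub])
  let ?K = "{p \<in> J. \<forall>q. hcomp q p \<in> J}"
  have zero: "hcomp q (0 :: 'a mpoly) = 0" for q by (rule part_eq_0) simp
  have "is_ideal n ?K"
    unfolding is_ideal_def
  proof (intro conjI ballI)
    show add: "p + r \<in> ?K" if "p \<in> ?K" "r \<in> ?K" for p r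
      using that is_idealD(3)[OF J] by (simp add: part_add)
    show 0: "0 \<in> ?K" using is_idealD(2)[OF J] zero by simp
    show "a * p \<in> ?K" if a: "a \<in> polys n" and p: "p \<in> ?K" for a p
    proof -
      have term_mem: "single m c * p \<in> ?K" if m: "m \<in> monomials n" for m c
      proof -
        have sm: "single m c \<in> polys n" using m by (simp add: polys_single)
        have hom: "mdeg k = mdeg m" if "k \<in> keys (single m c)" for k using that by (simp split: if_splits)
        have "hcomp q (single m c * p) \<in> J" for q
        proof (cases "mdeg m \<le> q")
          case True
          have "hcomp (q - mdeg m + mdeg m) (p * single m c) = hcomp (q - mdeg m) p * single m c"
            by (rule hcomp_mult_homogeneous(1)[OF hom])
          then show ?thesis using True p is_idealD(4)[OF J sm, of "hcomp (q - mdeg m) p"] by (simp add: mult.commute)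
        next
          case False
          then have "hcomp q (p * single m c) = 0" by (intro hcomp_mult_homogeneous(2)[OF hom]) auto
          then show ?thesis using is_idealD(2)[OF J] by (simp add: mult.commute)
        qed
        then show ?thesis using is_idealD(4)[OF J sm] p by simp
      qed
      have "(\<Sum>m\<in>T. single m (lookup a m) * p) \<in> ?K" if "T \<subseteq> monomials n" for T
        using that
      proof (induction T rule: infinite_finite_induct)
        case (insert x F)
        have "single x (lookup a x) * p + (\<Sum>m\<in>F. single m (lookup a m) * p) \<in> ?K"
          by (rule add) (use insert term_mem in auto)
        then show ?case using insert.hyps by simp
      qed (use 0 in simp_all)
      moreover have "a * p = (\<Sum>m\<in>keys a. single m (lookup a m) * p)"
        by (simp add: poly_mapping_expand flip: sum_distrib_right)
      ultimately show ?thesis using a by (simp add: polys_iff)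
    qed
  qed (use is_idealD(1)[OF J] in auto)
  moreover have "G \<subseteq> ?K"
  proof
    fix g assume g: "g \<in> G"
    then obtain q where q: "g \<in> graded_part n q" using G(1) by blast
    have gJ: "g \<in> J" using Idl_superset[OF sub] g G(2) by blast
    have "hcomp r g \<in> J" for r
    proof (cases "r = q")
      case True
      then show ?thesis using gJ hcomp_graded_self[OF q] by simp
    next
      case False
      then have "hcomp r g = 0" using q by (intro part_eq_0) (auto simp: graded_part_iff of_deg_def)
      then show ?thesis using is_idealD(2)[OF J] by simp
    qed
    then show "g \<in> ?K" using gJ by simp
  qed
  ultimately have "J \<subseteq> ?K" unfolding G(2) by (rule Idl_minimal)
  then show ?thesis using J by (auto simp: homog_def)
qed

section \<open>Standard monomials\<close>

definition lead :: "'k::field mpoly \<Rightarrow> monomial" where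
  "lead p = Max (keys p)"

text \<open>Leading monomials refer to the library's linear order on finitely supported functions,
  which is compatible with addition. Termination of division comes from staying in one degree, where
  there are only finitely many monomials.\<close>

definition std :: "nat \<Rightarrow> 'k::field mpoly set \<Rightarrow> monomial set" where
  "std n J = {m \<in> monomials n. \<forall>p\<in>J. p \<noteq> 0 \<longrightarrow> lead p \<noteq> m}"

lemma lead_in_keys: "p \<noteq> 0 \<Longrightarrow> lead p \<in> keys p"
  by (simp add: lead_def)

lemma le_lead: "m \<in> keys p \<Longrightarrow> m \<le> lead p"
  by (simp add: lead_def)

lemma leadI: "m \<in> keys p \<Longrightarrow> (\<And>k. k \<in> keys p \<Longrightarrow> k \<le> m) \<Longrightarrow> lead p = m"
  unfolding lead_def by (rule Max_eqI) auto

lemma lead_single_mult: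
  fixes p :: "'k::field mpoly"
  assumes "p \<noteq> 0"
  shows "single m 1 * p \<noteq> 0" "lead (single m 1 * p) = m + lead p"
proof -
  have keys: "keys (single m 1 * p) = (+) m ` keys p" by (simp add: keys_single_mult)
  then have "keys (single m 1 * p) \<noteq> {}" using assms by simp
  then show "single m 1 * p \<noteq> 0" by auto
  show "lead (single m 1 * p) = m + lead p"
    using lead_in_keys[OF assms] le_lead[of _ p] by (intro leadI) (auto simp: keys add_left_mono)
qed

text \<open>Multiplying by a monomial multiplies the leading monomial, so the leading monomials of
  an ideal are closed under multiplication.\<close>

lemma down_closed_std:
  assumes "is_ideal n J"
  shows "down_closed (std n J)"
  unfolding down_closed_def
proof (intro allI impI)
  fix m i assume std: "m + single i 1 \<in> std n J"
  then have mon: "m \<in> monomials n" "single i 1 \<in> monomials n" by (auto simp: std_def)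
  have "lead p \<noteq> m" if "p \<in> J" "p \<noteq> 0" for p
  proof
    assume "lead p = m"
    then have "lead (single (single i 1) 1 * p) = m + single i 1"
      using lead_single_mult(2)[OF that(2)] by (simp add: add.commute)
    moreover have "single (single i 1) 1 * p \<in> J"
      by (rule is_idealD(4)[OF assms _ that(1)]) (simp only: polys_single mon simp_thms)
    ultimately show False using std lead_single_mult(1)[OF that(2)] by (auto simp: std_def)
  qed
  then show "m \<in> std n J" using mon by (auto simp: std_def)
qed

lemma spannedI: "p - (\<Sum>s\<in>S. const (c s) * b s) \<in> J \<Longrightarrow> spanned J S b p"
  unfolding spanned_def by (rule exI[of _ c])

lemma graded_basis_independent:
  "graded_basis n J q S b \<Longrightarrow> (\<Sum>s\<in>S. const (c s) * b s) \<in> J \<Longrightarrow> s \<in> S \<Longrightarrow> c s = 0"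
  by (simp add: graded_basis_def)

lemma spanned_ideal: "is_ideal n J \<Longrightarrow> p \<in> J \<Longrightarrow> spanned J S b p"
  unfolding spanned_def by (intro exI[of _ "\<lambda>_. 0"]) simp

lemma spanned_add:
  assumes "is_ideal n J" "spanned J S b p" "spanned J S b r"
  shows "spanned J S b (p + r)"
proof -
  obtain c d where "p - (\<Sum>s\<in>S. const (c s) * b s) \<in> J" "r - (\<Sum>s\<in>S. const (d s) * b s) \<in> J"
    using assms by (auto simp: spanned_def)
  then have "(p - (\<Sum>s\<in>S. const (c s) * b s)) + (r - (\<Sum>s\<in>S. const (d s) * b s)) \<in> J"
    using assms(1) is_idealD(3) by blast
  moreover have "(p - (\<Sum>s\<in>S. const (c s) * b s)) + (r - (\<Sum>s\<in>S. const (d s) * b s))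
      = (p + r) - (\<Sum>s\<in>S. const (c s + d s) * b s)"
    by (simp add: const_add distrib_right sum.distrib)
  ultimately have "(p + r) - (\<Sum>s\<in>S. const (c s + d s) * b s) \<in> J" by (simp only:)
  then show ?thesis by (rule spannedI)
qed

lemma spanned_const_mult:
  assumes "is_ideal n J" "spanned J S b p"
  shows "spanned J S b (const a * p)"
proof -
  obtain c where "p - (\<Sum>s\<in>S. const (c s) * b s) \<in> J" using assms by (auto simp: spanned_def)
  then have "const a * (p - (\<Sum>s\<in>S. const (c s) * b s)) \<in> J"
    using assms(1) is_idealD(4) polys_const by blast
  moreover have "const a * (p - (\<Sum>s\<in>S. const (c s) * b s)) = const a * p - (\<Sum>s\<in>S. const (a * c s) * b s)"
    by (simp add: const_mult right_diff_distrib sum_distrib_left mult.assoc)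
  ultimately have "const a * p - (\<Sum>s\<in>S. const (a * c s) * b s) \<in> J" by (simp only:)
  then show ?thesis by (rule spannedI)
qed

lemma spanned_generator:
  assumes "is_ideal n J" "finite S" "s \<in> S"
  shows "spanned J S b (b s)"
proof -
  have "(\<Sum>t\<in>S. const (if t = s then 1 else 0) * b t) = (\<Sum>t\<in>S. if t = s then b t else 0)"
    by (intro sum.cong) auto
  also have "\<dots> = b s" using assms by simp
  finally have "b s - (\<Sum>t\<in>S. const (if t = s then 1 else 0) * b t) = 0" by simp
  then have "b s - (\<Sum>t\<in>S. const (if t = s then 1 else 0) * b t) \<in> J"
    using is_idealD(2)[OF assms(1)] by (simp only:)
  then show ?thesis by (rule spannedI)
qed

lemma keys_diff_less_lead:
  assumes "p \<noteq> 0" "g \<noteq> 0" "lead g = lead p" "k \<in> keys (p - const (lookup p (lead p) / lookup g (lead p)) * g)"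
  shows "k < lead p"
proof -
  have "lookup g (lead p) \<noteq> 0" using lead_in_keys[OF assms(2)] assms(3) by (simp add: in_keys_iff)
  then have "k \<noteq> lead p" using assms(4) by (auto simp: in_keys_iff lookup_minus lookup_const_mult)
  moreover have "k \<in> keys p \<or> k \<in> keys g"
    using assms(4) by (auto simp: in_keys_iff lookup_minus lookup_const_mult)
  ultimately show ?thesis using le_lead[of k p] le_lead[of k g] assms(3) by fastforce
qed

text \<open>Spanning is the division algorithm: the leading term is cancelled by the monomial itself
  if it is standard, and otherwise by an element of \<open>J\<close>, which homogeneity allows to be
  replaced by its component of degree \<open>q\<close>. The number of degree \<open>q\<close>
  monomials bounded by some occurring monomial drops. Independence holds because a nontrivial
  combination has a standard leading monomial.\<close>

theorem std_basis:
  assumes J: "homog n J"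
  shows "graded_basis n J q (of_deg q (std n J)) (\<lambda>m. single m 1)"
proof -
  let ?S = "of_deg q (std n J)" and ?b = "\<lambda>m. single m (1::'a)"
  note ideal = homog_ideal[OF J]
  have fin: "finite ?S" by (rule finite_of_deg_monomials[of _ n]) (auto simp: std_def)
  have "spanned J ?S ?b p" if "p \<in> graded_part n q" for p
    using that
  proof (induction "card {m \<in> of_deg q (monomials n). \<exists>k\<in>keys p. m \<le> k}" arbitrary: p rule: less_induct)
    case less
    show ?case
    proof (cases "p = 0")
      case True
      then show ?thesis using spanned_ideal[OF ideal] is_idealD(2)[OF ideal] by blast
    next
      case False
      let ?m = "lead p"
      have m: "?m \<in> of_deg q (monomials n)" using lead_in_keys[OF False] less.prems by (auto simp: graded_part_iff)
      have "\<exists>g. g \<noteq> 0 \<and> g \<in> graded_part n q \<and> lead g = ?m \<and> spanned J ?S ?b g"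
      proof (cases "?m \<in> std n J")
        case True
        then have "?m \<in> ?S" using m by (simp add: of_deg_def)
        then have "spanned J ?S ?b (?b ?m)" using spanned_generator[OF ideal fin] by blast
        moreover have "?b ?m \<noteq> 0" "?b ?m \<in> graded_part n q" "lead (?b ?m) = ?m"
          using m by (auto simp: graded_part_iff lead_def simp flip: keys_eq_empty)
        ultimately show ?thesis by blast
      next
        case False
        then obtain g where g: "g \<in> J" "g \<noteq> 0" "lead g = ?m" using m by (auto simp: std_def of_deg_def)
        have mem: "?m \<in> keys (hcomp q g)" using lead_in_keys[OF g(2)] g(3) m by (auto simp: keys_part of_deg_def)
        have "lead (hcomp q g) = ?m"
          by (rule leadI[OF mem]) (use le_lead[of _ g] g(3) in \<open>auto simp: keys_part\<close>)
        moreover have "hcomp q g \<in> J" using J g(1) by (simp add: homog_def)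
        moreover have "hcomp q g \<in> graded_part n q" using is_idealD(1)[OF ideal g(1)] by (rule hcomp_graded)
        ultimately show ?thesis using mem spanned_ideal[OF ideal] by (intro exI[of _ "hcomp q g"]) auto
      qed
      then obtain g where g: "g \<noteq> 0" "g \<in> graded_part n q" "lead g = ?m" "spanned J ?S ?b g" by blast
      define a where "a = lookup p ?m / lookup g ?m"
      define r where "r = p - const a * g"
      have r: "r \<in> graded_part n q"
        unfolding r_def by (intro graded_part_diff graded_part_const_mult less.prems g)
      have lt: "k < ?m" if "k \<in> keys r" for k
        using keys_diff_less_lead[OF False g(1,3)] that by (simp add: r_def a_def)
      have "{m \<in> of_deg q (monomials n). \<exists>k\<in>keys r. m \<le> k} \<subset> {m \<in> of_deg q (monomials n). \<exists>k\<in>keys p. m \<le> k}"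
      proof
        show "{m \<in> of_deg q (monomials n). \<exists>k\<in>keys r. m \<le> k} \<subseteq> {m \<in> of_deg q (monomials n). \<exists>k\<in>keys p. m \<le> k}"
        proof clarify
          fix m k assume "m \<in> of_deg q (monomials n)" "k \<in> keys r" "m \<le> k"
          then have "m \<le> ?m" using lt[of k] by simp
          then show "\<exists>k\<in>keys p. m \<le> k" using lead_in_keys[OF False] by blast
        qed
        have "?m \<in> {m \<in> of_deg q (monomials n). \<exists>k\<in>keys p. m \<le> k}" using m lead_in_keys[OF False] by blast
        moreover have "?m \<notin> {m \<in> of_deg q (monomials n). \<exists>k\<in>keys r. m \<le> k}" using lt leD by blast
        ultimately show "{m \<in> of_deg q (monomials n). \<exists>k\<in>keys r. m \<le> k} \<noteq> {m \<in> of_deg q (monomials n). \<exists>k\<in>keys p. m \<le> k}"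
          by metis
      qed
      then have "card {m \<in> of_deg q (monomials n). \<exists>k\<in>keys r. m \<le> k} < card {m \<in> of_deg q (monomials n). \<exists>k\<in>keys p. m \<le> k}"
        using finite_of_deg_monomials[of "monomials n" n q] by (intro psubset_card_mono) simp_all
      then have "spanned J ?S ?b r" using less.hyps r by blast
      then have "spanned J ?S ?b (r + const a * g)"
        using spanned_const_mult[OF ideal g(4)] by (intro spanned_add[OF ideal])
      then show ?thesis by (simp add: r_def)
    qed
  qed
  moreover have "c s = 0" if c: "(\<Sum>s\<in>?S. const (c s) * ?b s) \<in> J" and s: "s \<in> ?S" for c s
  proof (rule ccontr)
    assume "c s \<noteq> 0"
    let ?f = "\<Sum>s\<in>?S. const (c s) * ?b s"
    have lookup: "lookup ?f k = (if k \<in> ?S then c k else 0)" for k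
      using lookup_sum_single[OF fin, of c] by (simp only: single_eq_const_mult[symmetric])
    then have "?f \<noteq> 0" using s \<open>c s \<noteq> 0\<close> by (metis lookup_zero)
    moreover have "lead ?f \<in> ?S" using lead_in_keys[OF \<open>?f \<noteq> 0\<close>] lookup by (auto simp: in_keys_iff split: if_splits)
    ultimately show False using c by (auto simp: of_deg_def std_def)
  qed
  moreover have "?b ` ?S \<subseteq> graded_part n q"
    by (auto simp: graded_part_iff of_deg_def std_def)
  ultimately show ?thesis using fin unfolding graded_basis_def by blast
qed

lemma hilbert_fun_std: "homog n J \<Longrightarrow> 1 \<notin> J \<Longrightarrow> hilbert_fun n J q = card (of_deg q (std n J))"
  using hilbert_fun_eq_card[OF homog_ideal _ std_basis] by blast

lemma hilbert_fun_0:
  assumes "is_ideal n J" "1 \<notin> J"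
  shows "hilbert_fun n J 0 = 1"
proof -
  have const: "p = const (lookup p 0)" if "p \<in> graded_part n 0" for p
  proof (rule poly_mapping_eqI)
    fix m show "lookup p m = lookup (const (lookup p 0)) m"
      using that by (cases "m = 0")
        (auto simp: const_def lookup_single graded_part_iff of_deg_def subset_iff in_keys_iff mdeg_eq_0_iff)
  qed
  have "graded_basis n J 0 {()} (\<lambda>_. 1)"
    unfolding graded_basis_def
  proof (intro conjI allI impI ballI)
    show "(\<lambda>_. 1) ` {()} \<subseteq> graded_part n 0" by (auto simp: graded_part_iff of_deg_def)
    show "c s = 0" if "(\<Sum>s\<in>{()}. const (c s) * 1) \<in> J" for c s
    proof (rule ccontr)
      assume "c s \<noteq> 0"
      then have "const (inverse (c s)) * const (c s) = 1" by (simp flip: const_mult)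
      moreover have "const (c s) \<in> J" using that by simp
      ultimately show False using is_idealD(4)[OF assms(1) polys_const] assms(2) by metis
    qed
    show "spanned J {()} (\<lambda>_. 1) p" if "p \<in> graded_part n 0" for p
    proof -
      have "p - (\<Sum>s\<in>{()}. const (lookup p 0) * 1) = 0" using const[OF that] by simp
      then have "p - (\<Sum>s\<in>{()}. const (lookup p 0) * 1) \<in> J"
        using is_idealD(2)[OF assms(1)] by (simp only:)
      then show ?thesis by (rule spannedI)
    qed
  qed simp
  from hilbert_fun_eq_card[OF assms this] show ?thesis by simp
qed

section \<open>Dividing by a regular linear form\<close>

lemma homog_adjoin:
  assumes J: "homog n J" and l: "l \<in> graded_part n d"
  shows "homog n (adjoin n J l)"
  unfolding homog_def
proof (intro conjI ballI allI)
  note ideal = homog_ideal[OF J]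
  show "is_ideal n (adjoin n J l)" by (rule adjoin_ideal[OF ideal graded_part_polys[OF l]])
  have keys_l: "mdeg m = d" if "m \<in> keys l" for m using l that by (auto simp: graded_part_iff of_deg_def)
  fix p q assume "p \<in> adjoin n J l"
  then obtain g a where p: "p = g + a * l" "g \<in> J" "a \<in> polys n" unfolding adjoin_def by blast
  have g: "hcomp q g \<in> J" using J p(2) by (simp add: homog_def)
  show "hcomp q p \<in> adjoin n J l"
  proof (cases "d \<le> q")
    case True
    have "hcomp (q - d + d) (a * l) = hcomp (q - d) a * l"
      by (rule hcomp_mult_homogeneous(1)[OF keys_l])
    then have "hcomp q p = hcomp q g + hcomp (q - d) a * l" using True p(1) by (simp add: part_add)
    then show ?thesis unfolding adjoin_def using g part_polys[OF p(3)] by blast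
  next
    case False
    then have "hcomp q (a * l) = 0" by (intro hcomp_mult_homogeneous(2)[OF keys_l]) auto
    then show ?thesis using p(1) g adjoin_superset[OF ideal, of l] by (auto simp: part_add)
  qed
qed

text \<open>Every multiple of \<open>l\<close> has degree zero component 0, so the constant 1 would
  have to be a component of an element of the homogeneous ideal \<open>J\<close>.\<close>

lemma one_notin_adjoin:
  assumes J: "homog n J" "1 \<notin> J" and l: "l \<in> graded_part n (Suc d)"
  shows "1 \<notin> adjoin n J l"
proof
  have keys_l: "mdeg m = Suc d" if "m \<in> keys l" for m using l that by (auto simp: graded_part_iff of_deg_def)
  assume "1 \<in> adjoin n J l"
  then obtain g a where p: "1 = g + a * l" "g \<in> J" unfolding adjoin_def by blast
  have "hcomp 0 (1 :: 'a mpoly) = 1" by (rule part_eq_self) simp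
  moreover have "hcomp 0 (a * l) = 0" by (intro hcomp_mult_homogeneous(2)[OF keys_l]) auto
  ultimately have "hcomp 0 g = 1" using p(1) part_add[of "{m. mdeg m = 0}" g "a * l"] by simp
  then show False using J p(2) by (metis homog_def)
qed

text \<open>The dimension count for multiplication by \<open>l\<close>, which by regularity embeds
  (A/J)_q into (A/J)_(q+1) with cokernel the degree \<open>q + 1\<close> part of the quotient by
  \<open>l\<close>. Concretely, the standard monomials of that quotient together with
  \<open>l\<close> times those of A/J form a basis of (A/J)_(q+1).\<close>

theorem hilbert_fun_adjoin_linear:
  assumes J: "homog n J" "1 \<notin> J" and l: "l \<in> graded_part n 1" and reg: "regular_on n J l"
  shows "hilbert_fun n (adjoin n J l) (Suc q) + hilbert_fun n J q = hilbert_fun n J (Suc q)"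
proof -
  let ?J' = "adjoin n J l"
  note ideal = homog_ideal[OF J(1)]
  have J': "homog n ?J'" "1 \<notin> ?J'" using homog_adjoin[OF J(1) l] one_notin_adjoin[OF J] l by auto
  note ideal' = homog_ideal[OF J'(1)]
  have l_polys: "l \<in> polys n" by (rule graded_part_polys[OF l])
  have keys_l: "mdeg m = 1" if "m \<in> keys l" for m using l that by (auto simp: graded_part_iff of_deg_def)
  let ?S = "of_deg (Suc q) (std n ?J')" and ?T = "of_deg q (std n J)"
  let ?b = "\<lambda>m. single m (1::'a)"
  let ?c = "case_sum ?b (\<lambda>m. l * ?b m)"
  note bS = std_basis[OF J'(1), of "Suc q"] and bT = std_basis[OF J(1), of q]
  have fin: "finite ?S" "finite ?T" using bS bT by (auto simp: graded_basis_def)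
  have sum: "(\<Sum>s\<in>?S <+> ?T. const (c s) * ?c s)
      = (\<Sum>s\<in>?S. const (c (Inl s)) * ?b s) + (\<Sum>t\<in>?T. const (c (Inr t)) * ?b t) * l" for c
    by (simp add: sum.Plus[OF fin] sum_distrib_right mult.assoc) (simp add: mult.commute)
  have T_polys: "(\<Sum>t\<in>?T. const (c t) * ?b t) \<in> polys n" for c
    by (intro polys_sum polys_mult polys_const) (auto simp: polys_single of_deg_def std_def)
  have "graded_basis n J (Suc q) (?S <+> ?T) ?c"
    unfolding graded_basis_def
  proof (intro conjI allI impI ballI)
    show "finite (?S <+> ?T)" using fin by simp
    have "l * ?b m \<in> graded_part n (Suc q)" if "m \<in> ?T" for m
      using graded_part_mult[OF l, of "?b m" q] that bT by (auto simp: graded_basis_def)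
    then show "?c ` (?S <+> ?T) \<subseteq> graded_part n (Suc q)" using bS by (auto simp: graded_basis_def)
  next
    fix c s assume mem: "(\<Sum>s\<in>?S <+> ?T. const (c s) * ?c s) \<in> J" and s: "s \<in> ?S <+> ?T"
    let ?x = "\<Sum>s\<in>?S. const (c (Inl s)) * ?b s" and ?y = "\<Sum>t\<in>?T. const (c (Inr t)) * ?b t"
    \<comment> \<open>Modulo \<open>l\<close> the second sum disappears, and the first is
      independent there; afterwards regularity removes the factor \<open>l\<close> from what is
      left.\<close>
    have "(?x + ?y * l) - ?y * l \<in> ?J'"
      using mem[unfolded sum] adjoin_superset[OF ideal, of l] T_polys
      by (intro is_ideal_diff[OF ideal'] adjoin_mem[OF ideal]) auto
    then have "?x \<in> ?J'" by simp
    then have x0: "\<forall>s\<in>?S. c (Inl s) = 0"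
      using graded_basis_independent[OF bS, of "\<lambda>s. c (Inl s)"] by blast
    then have "l * ?y \<in> J" using mem unfolding sum by (simp add: mult.commute)
    then have "?y \<in> J" using reg T_polys by (simp add: regular_on_def)
    then have "\<forall>t\<in>?T. c (Inr t) = 0"
      using graded_basis_independent[OF bT, of "\<lambda>s. c (Inr s)"] by blast
    then show "c s = 0" using s x0 by auto
  next
    fix p :: "'a mpoly" assume p: "p \<in> graded_part n (Suc q)"
    then obtain c where c: "p - (\<Sum>s\<in>?S. const (c s) * ?b s) \<in> ?J'"
      using bS by (auto simp: graded_basis_def spanned_def)
    let ?r = "p - (\<Sum>s\<in>?S. const (c s) * ?b s)"
    have r: "?r \<in> graded_part n (Suc q)"
      using bS by (intro graded_part_diff p graded_part_sum graded_part_const_mult) (auto simp: graded_basis_def)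
    obtain g a where ga: "?r = g + a * l" "g \<in> J" "a \<in> polys n" using c unfolding adjoin_def by blast
    \<comment> \<open>Comparing components of degree \<open>Suc q\<close> makes the multiplier of
      \<open>l\<close> homogeneous of degree \<open>q\<close>, so that it can be expanded in the
      second basis.\<close>
    have "?r = hcomp (Suc q) ?r" using hcomp_graded_self[OF r] by simp
    also have "\<dots> = hcomp (Suc q) g + hcomp q a * l"
      using hcomp_mult_homogeneous(1)[OF keys_l, where q = q and a = a] by (simp add: ga(1) part_add)
    finally have r_eq: "?r = hcomp (Suc q) g + hcomp q a * l" .
    obtain d where d: "hcomp q a - (\<Sum>t\<in>?T. const (d t) * ?b t) \<in> J"
      using bT hcomp_graded[OF ga(3), of q] by (auto simp: graded_basis_def spanned_def)
    have "p - (\<Sum>s\<in>?S <+> ?T. const (case_sum c d s) * ?c s)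
        = hcomp (Suc q) g + (hcomp q a - (\<Sum>t\<in>?T. const (d t) * ?b t)) * l"
      unfolding sum using r_eq by (simp add: algebra_simps)
    moreover have "\<dots> \<in> J"
      using J(1) ga(2) is_ideal_mult2[OF ideal l_polys d] is_idealD(3)[OF ideal] by (simp add: homog_def)
    ultimately have "p - (\<Sum>s\<in>?S <+> ?T. const (case_sum c d s) * ?c s) \<in> J" by (simp only:)
    then show "spanned J (?S <+> ?T) ?c p" by (rule spannedI)
  qed
  from hilbert_fun_eq_card[OF ideal J(2) this] show ?thesis
    using fin hilbert_fun_std[OF J'] hilbert_fun_std[OF J] by (simp add: card_Plus)
qed

corollary differential_hilbert_fun:
  assumes J: "homog n J" "1 \<notin> J" and l: "l \<in> graded_part n 1" and reg: "regular_on n J l"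
  shows "differential (\<lambda>q. int (hilbert_fun n J q)) = (\<lambda>q. int (hilbert_fun n (adjoin n J l) q))"
proof
  fix q
  have J': "homog n (adjoin n J l)" "1 \<notin> adjoin n J l"
    using homog_adjoin[OF J(1) l] one_notin_adjoin[OF J] l by auto
  show "differential (\<lambda>q. int (hilbert_fun n J q)) q = int (hilbert_fun n (adjoin n J l) q)"
  proof (cases q)
    case 0
    then show ?thesis using hilbert_fun_0[OF homog_ideal[OF J'(1)] J'(2)] by (simp add: differential_def)
  next
    case (Suc d)
    then show ?thesis using hilbert_fun_adjoin_linear[OF assms, of d] by (simp add: differential_def)
  qed
qed

section \<open>Generic linear forms\<close>

text \<open>Gaussian elimination on the monomials in \<open>T\<close>. The family is indexed, so
  that a repeated vector also counts as a dependence.\<close>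

lemma linear_dependence:
  fixes v :: "'c \<Rightarrow> 'k::field mpoly"
  assumes "finite T" "finite C" "card T < card C" "\<And>c. c \<in> C \<Longrightarrow> keys (v c) \<subseteq> T"
  shows "\<exists>d. (\<exists>c\<in>C. d c \<noteq> 0) \<and> (\<Sum>c\<in>C. const (d c) * v c) = 0"
  using assms
proof (induction T arbitrary: C v rule: finite_induct)
  case empty
  then have "C \<noteq> {}" by auto
  then obtain c where "c \<in> C" by blast
  moreover have "(\<Sum>c\<in>C. const 1 * v c) = 0" using empty by (intro sum.neutral) simp
  ultimately show ?case by (intro exI[of _ "\<lambda>_. 1"]) auto
next
  case (insert m T)
  show ?case
  proof (cases "\<forall>c\<in>C. lookup (v c) m = 0")
    case True
    have "\<And>c. c \<in> C \<Longrightarrow> keys (v c) \<subseteq> T"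
    proof
      fix c x assume "c \<in> C" "x \<in> keys (v c)"
      then show "x \<in> T" using insert.prems(3)[of c] True by (auto simp: in_keys_iff)
    qed
    moreover have "card T < card C" using insert by simp
    ultimately show ?thesis using insert.IH[OF insert.prems(1)] by blast
  next
    case False
    then obtain c0 where c0: "c0 \<in> C" "lookup (v c0) m \<noteq> 0" by blast
    let ?C = "C - {c0}" and ?r = "\<lambda>c. lookup (v c) m / lookup (v c0) m"
    let ?w = "\<lambda>c. v c - const (?r c) * v c0"
    have "keys (?w c) \<subseteq> T" if "c \<in> ?C" for c
    proof
      fix x assume x: "x \<in> keys (?w c)"
      then have "x \<noteq> m" using c0(2) by (auto simp: in_keys_iff lookup_minus lookup_const_mult)
      moreover have "x \<in> keys (v c) \<or> x \<in> keys (v c0)"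
        using x by (auto simp: in_keys_iff lookup_minus lookup_const_mult)
      ultimately show "x \<in> T" using insert.prems(3)[of c] insert.prems(3)[of c0] that c0(1) by blast
    qed
    moreover have "card T < card ?C" using insert c0(1) by simp
    ultimately obtain d where d: "\<exists>c\<in>?C. d c \<noteq> 0" "(\<Sum>c\<in>?C. const (d c) * ?w c) = 0"
      using insert.IH[of ?C ?w] insert.prems(1) by blast
    \<comment> \<open>The pivot vector absorbs what was subtracted from all the others.\<close>
    define e where "e c = (if c = c0 then - (\<Sum>c\<in>?C. d c * ?r c) else d c)" for c
    have const_sum: "const (sum f S) = (\<Sum>i\<in>S. const (f i))" for f :: "'c \<Rightarrow> 'k" and S
      by (induction S rule: infinite_finite_induct) (auto simp: const_add)
    have "(\<Sum>c\<in>C. const (e c) * v c) = const (e c0) * v c0 + (\<Sum>c\<in>?C. const (e c) * v c)"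
      by (rule sum.remove[OF insert.prems(1) c0(1)])
    also have "(\<Sum>c\<in>?C. const (e c) * v c) = (\<Sum>c\<in>?C. const (d c) * v c)"
      by (intro sum.cong) (auto simp: e_def)
    also have "const (e c0) * v c0 = - (\<Sum>c\<in>?C. const (d c) * (const (?r c) * v c0))"
      by (simp add: e_def const_uminus const_sum const_mult sum_distrib_right mult.assoc
          del: times_divide_eq_right)
    also have "\<dots> + (\<Sum>c\<in>?C. const (d c) * v c) = (\<Sum>c\<in>?C. const (d c) * ?w c)"
      by (simp add: right_diff_distrib sum_subtractf)
    finally have "(\<Sum>c\<in>C. const (e c) * v c) = 0" using d(2) by simp
    moreover have "\<exists>c\<in>C. e c \<noteq> 0" using d(1) by (auto simp: e_def)
    ultimately show ?thesis by blast
  qed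
qed

text \<open>No nonzero class in A/J is annihilated by all of \<open>X\<close>. For the set of
  variables this says that A/J has no socle, for a single form it is regularity; larger and smaller
  sets \<open>X\<close> interpolate between the two.\<close>

definition ann_free :: "nat \<Rightarrow> 'k::field mpoly set \<Rightarrow> 'k mpoly set \<Rightarrow> bool" where
  "ann_free n J X \<longleftrightarrow> (\<forall>w\<in>polys n. (\<forall>x\<in>X. x * w \<in> J) \<longrightarrow> w \<in> J)"

lemma ann_free_single: "ann_free n J {l} \<longleftrightarrow> regular_on n J l"
  by (simp add: ann_free_def regular_on_def)

text \<open>If \<open>(a + c\<^sub>0 b) v \<in> J\<close>, then modulo \<open>J\<close> every other form \<open>a + c b\<close> acts on \<open>v\<close> as a multiple of \<open>b\<close>.\<close>

lemma pencil_prod: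
  fixes a b v :: "'k::field mpoly"
  assumes J: "is_ideal n J" and polys: "a \<in> polys n" "b \<in> polys n" "v \<in> polys n"
    and c0: "(a + const c0 * b) * v \<in> J" and F: "finite F"
  shows "(\<Prod>c\<in>F. a + const c * b) * v - const (\<Prod>c\<in>F. c - c0) * (b ^ card F * v) \<in> J"
  using F
proof (induction F)
  case empty
  then show ?case using is_idealD(2)[OF J] by simp
next
  case (insert c F)
  let ?Q = "\<Prod>c\<in>F. a + const c * b" and ?k = "\<Prod>c\<in>F. c - c0"
  have bpow: "b ^ s \<in> polys n" for s using polys by (induction s) auto
  have "(a + const c * b) * (?Q * v - const ?k * (b ^ card F * v)) \<in> J"
    by (rule is_idealD(4)[OF J _ insert.IH]) (use polys in simp)
  moreover have "(const ?k * b ^ card F) * ((a + const c0 * b) * v) \<in> J"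
    by (rule is_idealD(4)[OF J _ c0]) (simp add: bpow)
  ultimately have "(a + const c * b) * (?Q * v - const ?k * (b ^ card F * v))
      + (const ?k * b ^ card F) * ((a + const c0 * b) * v) \<in> J" by (rule is_idealD(3)[OF J])
  also have "(a + const c * b) * (?Q * v - const ?k * (b ^ card F * v))
      + (const ?k * b ^ card F) * ((a + const c0 * b) * v)
      = (a + const c * b) * ?Q * v - (const ?k * (const c - const c0)) * (b ^ Suc (card F) * v)"
    by (simp add: algebra_simps)
  finally show ?case using insert.hyps by (simp add: const_mult const_diff mult.commute[of "const ?k"])
qed

text \<open>Choose a witness v_c for each bad \<open>c\<close>. Too many witnesses of bounded degree
  satisfy a linear relation. The product of the forms a + c b over all \<open>c\<close> other than
  c0 kills every term but that of c0, on which by \<open>pencil_prod\<close> it acts as a nonzero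
  multiple of a power of \<open>b\<close>. The last product of a power of \<open>b\<close> with v_c0
  outside \<open>J\<close> is then annihilated by \<open>a\<close>, \<open>b\<close> and
  \<open>X\<close>, a contradiction. So each degree bound admits only finitely many bad
  values.\<close>

lemma pencil_countable:
  fixes J :: "'k::field mpoly set"
  assumes J: "is_ideal n J" and polys: "a \<in> polys n" "b \<in> polys n" "X \<subseteq> polys n"
    and free: "ann_free n J (insert a (insert b X))"
  shows "countable {c. \<not> ann_free n J (insert (a + const c * b) X)}"
proof -
  let ?C = "{c. \<not> ann_free n J (insert (a + const c * b) X)}"
  have "\<exists>v. v \<in> polys n \<and> v \<notin> J \<and> (a + const c * b) * v \<in> J \<and> (\<forall>x\<in>X. x * v \<in> J)" if "c \<in> ?C" for c
    using that by (auto simp: ann_free_def)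
  then obtain v where v: "\<And>c. c \<in> ?C \<Longrightarrow> v c \<in> polys n \<and> v c \<notin> J \<and> (a + const c * b) * v c \<in> J \<and> (\<forall>x\<in>X. x * v c \<in> J)"
    by metis
  let ?T = "\<lambda>q. {m \<in> monomials n. mdeg m \<le> q}"
  have "finite {c \<in> ?C. keys (v c) \<subseteq> ?T q}" for q
  proof (rule ccontr)
    assume "infinite {c \<in> ?C. keys (v c) \<subseteq> ?T q}"
    then obtain C where C: "C \<subseteq> {c \<in> ?C. keys (v c) \<subseteq> ?T q}" "card C = Suc (card (?T q))" "finite C"
      using infinite_arbitrarily_large[of "{c \<in> ?C. keys (v c) \<subseteq> ?T q}" "Suc (card (?T q))"] by blast
    have "card (?T q) < card C" using C(2) by simp
    then obtain d where d: "\<exists>c\<in>C. d c \<noteq> 0" "(\<Sum>c\<in>C. const (d c) * v c) = 0"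
      using linear_dependence[OF finite_monomials_deg_le C(3), of n q v] C(1) by blast
    then obtain c0 where c0: "c0 \<in> C" "d c0 \<noteq> 0" by blast
    have v0: "v c0 \<in> polys n" "v c0 \<notin> J" "(a + const c0 * b) * v c0 \<in> J" "\<And>x. x \<in> X \<Longrightarrow> x * v c0 \<in> J"
      using v[of c0] C(1) c0(1) by blast+
    let ?F = "C - {c0}"
    let ?P = "\<Prod>c\<in>?F. a + const c * b"
    have factor: "(\<Prod>c\<in>S. a + const c * b) \<in> polys n" for S
      by (induction S rule: infinite_finite_induct) (use polys in auto)
    have "?P * v c \<in> J" if c: "c \<in> ?F" for c
    proof -
      have "?P = (\<Prod>c\<in>?F - {c}. a + const c * b) * (a + const c * b)"
        using prod.remove[of ?F c "\<lambda>c. a + const c * b"] c C(3) by (simp add: mult.commute)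
      then have "?P * v c = (\<Prod>c\<in>?F - {c}. a + const c * b) * ((a + const c * b) * v c)"
        by (simp add: mult.assoc)
      moreover have "(a + const c * b) * v c \<in> J" using v[of c] c C(1) by blast
      ultimately show ?thesis using is_idealD(4)[OF J factor] by (simp only:)
    qed
    then have "- (\<Sum>c\<in>?F. const (d c) * (?P * v c)) \<in> J"
      by (intro is_ideal_uminus[OF J] is_ideal_sum[OF J] is_idealD(4)[OF J polys_const])
    moreover have expand: "?P * (\<Sum>c\<in>C. const (d c) * v c)
        = const (d c0) * (?P * v c0) + (\<Sum>c\<in>?F. const (d c) * (?P * v c))"
      unfolding sum.remove[OF C(3) c0(1)]
      by (simp add: distrib_left sum_distrib_left mult.left_commute)
    have "const (d c0) * (?P * v c0) = - (\<Sum>c\<in>?F. const (d c) * (?P * v c))"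
      using expand unfolding d(2) mult_zero_right eq_neg_iff_add_eq_0 by (rule sym)
    ultimately have "const (d c0) * (?P * v c0) \<in> J" by (simp only:)
    then have "const (inverse (d c0)) * (const (d c0) * (?P * v c0)) \<in> J" by (rule is_idealD(4)[OF J polys_const])
    then have "?P * v c0 \<in> J" using c0(2) by (simp add: mult.assoc[symmetric] const_mult[symmetric])
    from is_ideal_diff[OF J this pencil_prod[OF J polys(1,2) v0(1,3), of ?F]]
    have mem: "const (\<Prod>c\<in>?F. c - c0) * (b ^ card ?F * v c0) \<in> J" using C(3) by simp
    have nz: "(\<Prod>c\<in>?F. c - c0) \<noteq> 0" using C(3) by simp
    from is_idealD(4)[OF J polys_const mem, of "inverse (\<Prod>c\<in>?F. c - c0)"]
    have pow: "b ^ card ?F * v c0 \<in> J" using nz by (simp add: mult.assoc[symmetric] const_mult[symmetric])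
    have "\<exists>j. b ^ j * v c0 \<notin> J \<and> b ^ Suc j * v c0 \<in> J"
    proof (rule ccontr)
      assume "\<not> ?thesis"
      then have "b ^ j * v c0 \<notin> J" for j by (induction j) (use v0(2) in auto)
      then show False using pow by blast
    qed
    then obtain j where j: "b ^ j * v c0 \<notin> J" "b ^ Suc j * v c0 \<in> J" by blast
    have bj: "b ^ j \<in> polys n" using polys(2) by (induction j) auto
    let ?w = "b ^ j * v c0"
    have bw: "b * ?w \<in> J" using j(2) by (simp add: mult.assoc)
    have "b ^ j * ((a + const c0 * b) * v c0) - const c0 * (b * ?w) \<in> J"
      by (intro is_ideal_diff[OF J] is_idealD(4)[OF J bj v0(3)] is_idealD(4)[OF J polys_const bw])
    moreover have "b ^ j * ((a + const c0 * b) * v c0) - const c0 * (b * ?w) = a * ?w"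
      by (simp add: algebra_simps)
    moreover have "x * ?w \<in> J" if "x \<in> X" for x
      using is_idealD(4)[OF J bj v0(4)[OF that]] by (simp add: mult.left_commute)
    ultimately have "?w \<in> J" using free bw bj v0(1) by (auto simp: ann_free_def)
    then show False using j(1) by simp
  qed
  then have "countable (\<Union>q. {c \<in> ?C. keys (v c) \<subseteq> ?T q})"
    by (intro countable_UN[OF countableI_type] countable_finite)
  moreover have "?C \<subseteq> (\<Union>q. {c \<in> ?C. keys (v c) \<subseteq> ?T q})"
  proof
    fix c assume c: "c \<in> ?C"
    have "keys (v c) \<subseteq> ?T (Max (insert 0 (mdeg ` keys (v c))))"
      using v[OF c] by (auto simp: polys_iff)
    then show "c \<in> (\<Union>q. {c \<in> ?C. keys (v c) \<subseteq> ?T q})" using c by blast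
  qed
  ultimately show ?thesis by (rule countable_subset[rotated])
qed

lemma irrelevant_is_ideal: "is_ideal n (irrelevant_ideal n)"
  unfolding irrelevant_ideal_def by (rule Idl_is_ideal) (auto simp: polys_var)

lemma var_irrelevant: "i < n \<Longrightarrow> var i \<in> irrelevant_ideal n"
proof -
  assume "i < n"
  moreover have "var ` {..<n} \<subseteq> polys n" by (auto simp: polys_var)
  ultimately show ?thesis unfolding irrelevant_ideal_def using Idl_superset by blast
qed

lemma irrelevant_polys: "f \<in> irrelevant_ideal n \<Longrightarrow> f \<in> polys n"
  using is_idealD(1)[OF irrelevant_is_ideal] .

lemma var_graded: "i < n \<Longrightarrow> var i \<in> graded_part n 1"
  by (auto simp: graded_part_iff var_def of_deg_def monomials_single)

text \<open>The variables are merged into one form step by step: freeness with respect to l, x_k,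
  x_(k+1), ... passes to l + c x_k, x_(k+1), ... for all but countably many \<open>c\<close>.
  Finitely many ideals still exclude only countably many values, so one form serves all of
  them.\<close>

lemma generic_linear_form:
  fixes Js :: "'k::field mpoly set set"
  assumes unc: "uncountable (UNIV :: 'k set)" and n: "1 \<le> n" and fin: "finite Js"
    and Js: "\<And>J. J \<in> Js \<Longrightarrow> is_ideal n J \<and> ann_free n J (var ` {..<n})"
  shows "\<exists>l. l \<in> graded_part n 1 \<and> l \<in> irrelevant_ideal n \<and> (\<forall>J\<in>Js. regular_on n J l)"
proof -
  have "\<exists>l. l \<in> graded_part n 1 \<and> l \<in> irrelevant_ideal n \<and> (\<forall>J\<in>Js. ann_free n J (insert l (var ` {k..<n})))"
    if "1 \<le> k" "k \<le> n" for k
    using that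
  proof (induction k rule: dec_induct)
    case base
    have "{..<n} = insert 0 {1..<n}" using n by auto
    then have "\<forall>J\<in>Js. ann_free n J (insert (var 0) (var ` {1..<n}))" using Js by simp
    then show ?case using var_graded[of 0 n] var_irrelevant[of 0 n] n by (intro exI[of _ "var 0"]) auto
  next
    case (step k)
    then obtain l where l: "l \<in> graded_part n 1" "l \<in> irrelevant_ideal n"
      "\<And>J. J \<in> Js \<Longrightarrow> ann_free n J (insert l (var ` {k..<n}))" by auto
    let ?X = "var ` {Suc k..<n} :: 'k mpoly set"
    have "{k..<n} = insert k {Suc k..<n}" using step by auto
    then have "countable {c. \<not> ann_free n J (insert (l + const c * var k) ?X)}" if "J \<in> Js" for J
      using l(3)[OF that] Js[OF that] step.prems
      by (intro pencil_countable) (auto simp: polys_var graded_part_polys[OF l(1)])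
    then have "countable (\<Union>J\<in>Js. {c. \<not> ann_free n J (insert (l + const c * var k) ?X)})"
      by (rule countable_UN[OF countable_finite[OF fin]])
    then have "(\<Union>J\<in>Js. {c. \<not> ann_free n J (insert (l + const c * var k) ?X)}) \<noteq> UNIV"
      using unc by (auto simp del: UN_simps)
    then obtain c where "c \<notin> (\<Union>J\<in>Js. {c. \<not> ann_free n J (insert (l + const c * var k) ?X)})" by blast
    moreover have "l + const c * var k \<in> graded_part n 1"
      using step by (intro graded_part_add graded_part_const_mult l var_graded) auto
    moreover have "l + const c * var k \<in> irrelevant_ideal n"
      using step by (intro is_idealD(3,4)[OF irrelevant_is_ideal] l var_irrelevant) auto
    ultimately show ?case by blast
  qed
  from this[of n] n show ?thesis by (auto simp: ann_free_single)
qed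

lemma annihilator_ideal:
  assumes "is_ideal n J" "w \<in> polys n"
  shows "is_ideal n {g \<in> polys n. g * w \<in> J}"
  unfolding is_ideal_def
  using is_idealD[OF assms(1)] by (auto simp: distrib_right mult.assoc)

lemma irrelevant_mult_mem:
  assumes "is_ideal n J" "w \<in> polys n" "\<And>i. i < n \<Longrightarrow> var i * w \<in> J" "f \<in> irrelevant_ideal n"
  shows "f * w \<in> J"
proof -
  have "irrelevant_ideal n \<subseteq> {g \<in> polys n. g * w \<in> J}"
    unfolding irrelevant_ideal_def
    by (rule Idl_minimal[OF annihilator_ideal[OF assms(1,2)]]) (use assms(3) in \<open>auto simp: polys_var\<close>)
  then show ?thesis using assms(4) by blast
qed

section \<open>Socles and exchange in regular sequences\<close>

lemma regular_ann_free:
  assumes "is_ideal n J" "f \<in> irrelevant_ideal n" "regular_on n J f"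
  shows "ann_free n J (var ` {..<n})"
  using irrelevant_mult_mem[OF assms(1) _ _ assms(2)] assms(3) by (auto simp: ann_free_def regular_on_def)

lemma adjoinE:
  assumes "p \<in> adjoin n J f"
  obtains g a where "g \<in> J" "a \<in> polys n" "p = g + a * f"
  using assms unfolding adjoin_def by blast

lemma adjoinI: "p - a * f \<in> J \<Longrightarrow> a \<in> polys n \<Longrightarrow> p \<in> adjoin n J f"
proof -
  assume "p - a * f \<in> J" "a \<in> polys n"
  moreover have "p = (p - a * f) + a * f" by simp
  ultimately show ?thesis unfolding adjoin_def by blast
qed

lemma regular_onD: "regular_on n J f \<Longrightarrow> g \<in> polys n \<Longrightarrow> f * g \<in> J \<Longrightarrow> g \<in> J"
  by (simp add: regular_on_def)

text \<open>An annihilated class is carried from one quotient to the other. In f y = j + x l,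
  multiplication by a variable and regularity of \<open>l\<close> show that the variables annihilate
  \<open>x\<close> modulo J + (f). Hence x = u f modulo \<open>J\<close>, and cancelling
  \<open>f\<close> leaves y = u l modulo \<open>J\<close>.\<close>

lemma ann_free_exchange:
  assumes J: "is_ideal n J" and f: "f \<in> irrelevant_ideal n" "regular_on n J f"
    and l: "l \<in> polys n" "regular_on n J l" and free: "ann_free n (adjoin n J f) (var ` {..<n})"
  shows "ann_free n (adjoin n J l) (var ` {..<n})"
  unfolding ann_free_def
proof (intro ballI impI)
  fix y assume y: "y \<in> polys n" and ann: "\<forall>x\<in>var ` {..<n}. x * y \<in> adjoin n J l"
  note fp = irrelevant_polys[OF f(1)]
  have "f * y \<in> adjoin n J l"
    using ann by (intro irrelevant_mult_mem[OF adjoin_ideal[OF J l(1)] y _ f(1)]) auto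
  then obtain j x where jx: "j \<in> J" "x \<in> polys n" "f * y = j + x * l" by (rule adjoinE)
  have "var i * x \<in> adjoin n J f" if i: "i < n" for i
  proof -
    have vi: "var i \<in> (polys n :: 'a mpoly set)" by (rule polys_var[OF i])
    have "var i * y \<in> adjoin n J l" using ann i by auto
    then obtain j' z where z: "j' \<in> J" "z \<in> polys n" "var i * y = j' + z * l" by (rule adjoinE)
    have "f * (var i * y) = var i * (f * y)" by (simp add: mult.left_commute)
    then have "f * j' + f * z * l = var i * j + var i * x * l"
      unfolding z(3) jx(3) by (simp add: distrib_left mult.assoc)
    then have "l * (var i * x - z * f) = f * j' - var i * j" by (simp add: algebra_simps)
    moreover have "f * j' - var i * j \<in> J"
      using is_idealD(4)[OF J] fp z(1) jx(1) vi is_ideal_diff[OF J] by blast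
    ultimately have "l * (var i * x - z * f) \<in> J" by (simp only:)
    then have "var i * x - z * f \<in> J"
      using regular_onD[OF l(2), of "var i * x - z * f"] jx(2) z(2) fp vi by simp
    then show ?thesis using z(2) by (rule adjoinI)
  qed
  then have "x \<in> adjoin n J f" using free jx(2) by (auto simp: ann_free_def)
  then obtain j2 u where u: "j2 \<in> J" "u \<in> polys n" "x = j2 + u * f" by (rule adjoinE)
  have "f * (y - u * l) = j + j2 * l" using jx(3) u(3) by (simp add: algebra_simps)
  moreover have "j + j2 * l \<in> J" using is_idealD(3)[OF J] is_ideal_mult2[OF J l(1)] jx(1) u(1) by blast
  ultimately have "y - u * l \<in> J" using regular_onD[OF f(2)] y u(2) l(1) by simp
  then show "y \<in> adjoin n J l" using u(2) by (rule adjoinI)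
qed

text \<open>From f x = j + y g the element \<open>g\<close> kills \<open>y\<close> modulo J + (f),
  so y = z f modulo \<open>J\<close> and \<open>f\<close> can be cancelled. This half of the
  exchange is purely formal; the other half, regularity of \<open>g\<close> on A/J, can fail in
  general and is secured below by the choice of \<open>g\<close>.\<close>

lemma regular_swap:
  assumes J: "is_ideal n J" and f: "f \<in> polys n" "regular_on n J f"
    and g: "g \<in> polys n" "regular_on n (adjoin n J f) g"
  shows "regular_on n (adjoin n J g) f"
  unfolding regular_on_def
proof (intro ballI impI)
  fix x assume x: "x \<in> polys n" "f * x \<in> adjoin n J g"
  then obtain j y where y: "j \<in> J" "y \<in> polys n" "f * x = j + y * g" using adjoinE by blast
  have "g * y - x * f = - j" using y(3) by (simp add: algebra_simps)
  then have "g * y \<in> adjoin n J f" using is_ideal_uminus[OF J y(1)] x(1) by (intro adjoinI[of _ x]) simp_all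
  then have "y \<in> adjoin n J f" using regular_onD[OF g(2)] y(2) by blast
  then obtain j' z where z: "j' \<in> J" "z \<in> polys n" "y = j' + z * f" by (rule adjoinE)
  have "f * (x - z * g) = j + j' * g" using y(3) z(3) by (simp add: algebra_simps)
  moreover have "j + j' * g \<in> J" using is_idealD(3)[OF J] is_ideal_mult2[OF J g(1)] y(1) z(1) by blast
  ultimately have "x - z * g \<in> J" using regular_onD[OF f(2)] x(1) z(2) g(1) by simp
  then show "x \<in> adjoin n J g" using z(2) by (rule adjoinI)
qed

text \<open>Recursion on the first element, which is the one that the exchange argument replaces.
  The elements may be inhomogeneous.\<close>

primrec grade_ge :: "nat \<Rightarrow> nat \<Rightarrow> 'k::field mpoly set \<Rightarrow> bool" where
  "grade_ge n 0 J \<longleftrightarrow> True"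
| "grade_ge n (Suc k) J \<longleftrightarrow> (\<exists>f\<in>irrelevant_ideal n. regular_on n J f \<and> grade_ge n k (adjoin n J f))"

text \<open>The first element of a regular sequence may be any regular \<open>l\<close>: exchange the given element \<open>f\<close> for \<open>l\<close>
  through a linear form \<open>g\<close> which is regular modulo \<open>J\<close>, \<open>J + (f)\<close> and \<open>J + (l)\<close>.\<close>

lemma grade_ge_adjoin:
  fixes J :: "'k::field mpoly set"
  assumes unc: "uncountable (UNIV :: 'k set)" and n: "1 \<le> n"
  shows "\<lbrakk>is_ideal n J; l \<in> irrelevant_ideal n; regular_on n J l; grade_ge n (Suc k) J\<rbrakk>
    \<Longrightarrow> grade_ge n k (adjoin n J l)"
proof (induction k arbitrary: J l)
  case 0
  then show ?case by simp
next
  case (Suc k)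
  note J = Suc.prems(1) and l = Suc.prems(2,3)
  have lp: "l \<in> polys n" by (rule irrelevant_polys[OF l(1)])
  obtain f where f: "f \<in> irrelevant_ideal n" "regular_on n J f" "grade_ge n (Suc k) (adjoin n J f)"
    using Suc.prems(4) by auto
  have fp: "f \<in> polys n" by (rule irrelevant_polys[OF f(1)])
  note Jf = adjoin_ideal[OF J fp] and Jl = adjoin_ideal[OF J lp]
  \<comment> \<open>The sequence has at least two elements here, and the second one shows that J +
    (f) leaves no socle.\<close>
  obtain f' where f': "f' \<in> irrelevant_ideal n" "regular_on n (adjoin n J f) f'" using f(3) by auto
  have free: "ann_free n J (var ` {..<n})" "ann_free n (adjoin n J f) (var ` {..<n})"
    using regular_ann_free J f Jf f' by blast+
  then have freel: "ann_free n (adjoin n J l) (var ` {..<n})"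
    using ann_free_exchange[OF J f(1,2) lp l(2)] by blast
  have "\<exists>g. g \<in> graded_part n 1 \<and> g \<in> irrelevant_ideal n \<and>
      (\<forall>K\<in>{J, adjoin n J f, adjoin n J l}. regular_on n K g)"
    by (rule generic_linear_form[OF unc n]) (use J Jf Jl free freel in auto)
  then obtain g where g: "g \<in> irrelevant_ideal n" "regular_on n J g" "regular_on n (adjoin n J f) g"
    "regular_on n (adjoin n J l) g" by auto
  have gp: "g \<in> polys n" by (rule irrelevant_polys[OF g(1)])
  note Jg = adjoin_ideal[OF J gp]
  \<comment> \<open>The induction hypothesis is used twice, on J + (f) to bring in \<open>g\<close>
    and on J + (g) to bring in \<open>l\<close>; after each use the two adjoined elements change
    places.\<close>
  have "grade_ge n k (adjoin n (adjoin n J f) g)" by (rule Suc.IH[OF Jf g(1,3) f(3)])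
  then have "grade_ge n k (adjoin n (adjoin n J g) f)" by (simp only: adjoin_commute[OF J fp gp])
  then have "grade_ge n (Suc k) (adjoin n J g)" using f(1) regular_swap[OF J fp f(2) gp g(3)] by auto
  then have "grade_ge n k (adjoin n (adjoin n J g) l)"
    by (rule Suc.IH[OF Jg l(1) regular_swap[OF J lp l(2) gp g(4)]])
  then have "grade_ge n k (adjoin n (adjoin n J l) g)" by (simp only: adjoin_commute[OF J lp gp])
  then show ?case using g(1,4) by auto
qed

text \<open>The given regular element only certifies that A/J has no socle. A regular linear form
  takes its place, which keeps the ideal homogeneous, while \<open>grade_ge_adjoin\<close> preserves
  the length of the remaining sequence.\<close>

theorem grade_ge_differential:
  fixes J :: "'k::field mpoly set"
  assumes unc: "uncountable (UNIV :: 'k set)" and n: "1 \<le> n"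
  shows "\<lbrakk>homog n J; 1 \<notin> J; grade_ge n r J\<rbrakk> \<Longrightarrow> \<exists>J' :: 'k mpoly set. homog n J' \<and> 1 \<notin> J' \<and>
    (\<lambda>q. int (hilbert_fun n J' q)) = (differential ^^ r) (\<lambda>q. int (hilbert_fun n J q))"
proof (induction r arbitrary: J)
  case 0
  then show ?case by auto
next
  case (Suc r)
  note ideal = homog_ideal[OF Suc.prems(1)]
  obtain f where f: "f \<in> irrelevant_ideal n" "regular_on n J f" using Suc.prems(3) by auto
  have "\<exists>l. l \<in> graded_part n 1 \<and> l \<in> irrelevant_ideal n \<and> (\<forall>K\<in>{J}. regular_on n K l)"
    by (rule generic_linear_form[OF unc n]) (use ideal regular_ann_free[OF ideal f] in auto)
  then obtain l where l: "l \<in> graded_part n 1" "l \<in> irrelevant_ideal n" "regular_on n J l" by auto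
  have "homog n (adjoin n J l)" "1 \<notin> adjoin n J l" "grade_ge n r (adjoin n J l)"
    using homog_adjoin[OF Suc.prems(1) l(1)] one_notin_adjoin[OF Suc.prems(1,2)] l
      grade_ge_adjoin[OF unc n ideal l(2,3) Suc.prems(3)] by auto
  from Suc.IH[OF this] obtain J' :: "'k mpoly set" where J': "homog n J'" "1 \<notin> J'"
    "(\<lambda>q. int (hilbert_fun n J' q)) = (differential ^^ r) (\<lambda>q. int (hilbert_fun n (adjoin n J l) q))"
    by blast
  then show ?case
    using differential_hilbert_fun[OF Suc.prems(1,2) l(1,3)]
    by (intro exI[of _ J']) (simp add: funpow_Suc_right del: funpow.simps)
qed

section \<open>Uncountability of the field of Laurent series\<close>

notation fls_nth (infixl \<open>$$\<close> 75)

text \<open>Power series with coefficients 0 and 1 encode the sets of naturals, so the field is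
  uncountable even over a finite coefficient field.\<close>

lemma uncountable_fls: "uncountable (UNIV :: 'k::field fls set)"
proof
  assume "countable (UNIV :: 'k fls set)"
  define g :: "nat set \<Rightarrow> 'k fls" where "g S = fps_to_fls (Abs_fps (\<lambda>n. if n \<in> S then 1 else 0))" for S
  have "inj g"
  proof (rule injI)
    fix S T assume "g S = g T"
    then have "Abs_fps (\<lambda>n. if n \<in> S then 1 else (0::'k)) = Abs_fps (\<lambda>n. if n \<in> T then 1 else 0)"
      by (simp add: g_def)
    from arg_cong[OF this, of "\<lambda>f. fps_nth f n" for n]
    have "(if n \<in> S then 1 else (0::'k)) = (if n \<in> T then 1 else 0)" for n by simp
    then have "n \<in> S \<longleftrightarrow> n \<in> T" for n by (metis zero_neq_one)
    then show "S = T" by blast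
  qed
  moreover have "countable (range g)" by (rule countable_subset[OF subset_UNIV]) fact
  ultimately have "countable (UNIV :: nat set set)" by (rule countable_image_inj_on[rotated])
  then obtain f :: "nat \<Rightarrow> nat set" where "range f = UNIV" using uncountable_def[of "UNIV :: nat set set"] by auto
  then show False using Cantors_theorem[of "UNIV :: nat set"] by auto
qed

section \<open>Extension of scalars to Laurent series\<close>

definition emb :: "'k::field mpoly \<Rightarrow> 'k fls mpoly" where
  "emb p = Poly_Mapping.map fls_const p"

definition fcoeff :: "int \<Rightarrow> 'k::field fls mpoly \<Rightarrow> 'k mpoly" where
  "fcoeff j g = Poly_Mapping.map (\<lambda>c. c $$ j) g"

text \<open>The scalar extension of \<open>J\<close>, described by coefficients of the Laurent
  series: in this form regularity passes over at once. Its description as a span, in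
  \<open>ext_in_span\<close>, serves for closure under scalars and for
  \<open>ext_adjoin\<close>.\<close>

definition ext :: "nat \<Rightarrow> 'k::field mpoly set \<Rightarrow> 'k fls mpoly set" where
  "ext n J = {g \<in> polys n. \<forall>j. fcoeff j g \<in> J}"

lemma lookup_emb [simp]: "lookup (emb p) m = fls_const (lookup p m)"
  by (simp add: emb_def map.rep_eq when_def)

lemma lookup_fcoeff [simp]: "lookup (fcoeff j g) m = lookup g m $$ j"
  by (simp add: fcoeff_def map.rep_eq when_def)

lemma fls_const_eq_0_iff: "fls_const c = 0 \<longleftrightarrow> c = 0"
  using fls_const_nonzero by auto

lemma keys_emb: "keys (emb p) = keys p"
  by (auto simp: in_keys_iff fls_const_eq_0_iff)

lemma keys_fcoeff: "keys (fcoeff j g) \<subseteq> keys g"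
  by (auto simp: in_keys_iff)

lemma emb_polys: "emb p \<in> polys n \<longleftrightarrow> p \<in> polys n"
  by (simp add: polys_iff keys_emb)

lemma fcoeff_polys: "g \<in> polys n \<Longrightarrow> fcoeff j g \<in> polys n"
  using keys_fcoeff[of j g] by (auto simp: polys_iff)

lemma emb_add: "emb (p + r) = emb p + emb r"
  by (intro poly_mapping_eqI) (simp add: lookup_add fls_plus_const)

lemma fcoeff_add: "fcoeff j (p + r) = fcoeff j p + fcoeff j r"
  by (intro poly_mapping_eqI) (simp add: lookup_add)

lemma fcoeff_diff: "fcoeff j (p - r) = fcoeff j p - fcoeff j r"
  by (intro poly_mapping_eqI) (simp add: lookup_minus)

lemma emb_0 [simp]: "emb 0 = 0"
  by (intro poly_mapping_eqI) simp

lemma fcoeff_0 [simp]: "fcoeff j 0 = 0"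
  by (intro poly_mapping_eqI) simp

lemma emb_single: "emb (single m c) = single m (fls_const c)"
  by (intro poly_mapping_eqI) (simp add: lookup_single when_def)

lemma fcoeff_single: "fcoeff j (single m c) = single m (c $$ j)"
  by (intro poly_mapping_eqI) (simp add: lookup_single when_def)

lemma emb_sum: "emb (sum f S) = (\<Sum>i\<in>S. emb (f i))"
  by (induction S rule: infinite_finite_induct) (auto simp: emb_add)

lemma fcoeff_sum: "fcoeff j (sum f S) = (\<Sum>i\<in>S. fcoeff j (f i))"
  by (induction S rule: infinite_finite_induct) (auto simp: fcoeff_add)

lemma fcoeff_emb: "fcoeff j (emb p) = (if j = 0 then p else 0)"
  by (intro poly_mapping_eqI) simp

lemma fcoeff_const_emb: "fcoeff j (const c * emb p) = const (c $$ j) * p"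
  by (intro poly_mapping_eqI) (simp add: lookup_const_mult fls_mult_const_nth)

lemma mult_expand:
  "p * r = (\<Sum>a\<in>keys p. \<Sum>b\<in>keys r. single (a + b) (lookup p a * lookup r b))"
  for p r :: "'k::field mpoly"
proof -
  have "p * r = (\<Sum>a\<in>keys p. single a (lookup p a)) * (\<Sum>b\<in>keys r. single b (lookup r b))"
    by (simp only: poly_mapping_expand)
  then show ?thesis by (simp add: sum_product mult_single)
qed

lemma fcoeff_emb_mult: "fcoeff j (emb f * g) = f * fcoeff j g"
proof -
  have "fcoeff j g = (\<Sum>b\<in>keys g. single b (lookup g b $$ j))"
    by (subst (1) poly_mapping_expand[of g, symmetric]) (simp only: fcoeff_sum fcoeff_single)
  then have "f * fcoeff j g = (\<Sum>a\<in>keys f. single a (lookup f a)) * (\<Sum>b\<in>keys g. single b (lookup g b $$ j))"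
    by (simp only: poly_mapping_expand)
  also have "\<dots> = (\<Sum>a\<in>keys f. \<Sum>b\<in>keys g. single (a + b) (lookup f a * lookup g b $$ j))"
    by (simp add: sum_product mult_single)
  finally show ?thesis
    by (simp add: mult_expand[of "emb f"] keys_emb fcoeff_sum fcoeff_single fls_mult_const_nth)
qed

lemma emb_mult: "emb (f * g) = emb f * emb g"
  by (simp add: mult_expand[of f] mult_expand[of "emb f"] keys_emb emb_sum emb_single)

lemma ext_mem_emb: "is_ideal n J \<Longrightarrow> p \<in> J \<Longrightarrow> emb p \<in> ext n J"
  using is_idealD(1,2)[of n J] by (auto simp: ext_def emb_polys fcoeff_emb)

text \<open>Gaussian elimination: the extension is the span of \<open>J\<close> over the Laurent series.\<close>

lemma ext_in_span:
  fixes K :: "'k::field fls mpoly set"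
  assumes J: "is_ideal n J" and K: "0 \<in> K" "\<And>p r. p \<in> K \<Longrightarrow> r \<in> K \<Longrightarrow> p + r \<in> K"
    "\<And>c p. p \<in> J \<Longrightarrow> const c * emb p \<in> K"
    and g: "g \<in> ext n J"
  shows "g \<in> K"
  using g
proof (induction "card (keys g)" arbitrary: g rule: less_induct)
  case less
  show ?case
  proof (cases "g = 0")
    case True
    then show ?thesis using K by simp
  next
    case False
    then obtain m where m: "m \<in> keys g" using keys_eq_empty by blast
    then have "lookup g m \<noteq> 0" by (simp add: in_keys_iff)
    then obtain j where j: "lookup g m $$ j \<noteq> 0" by (auto simp: fls_eq_iff)
    \<comment> \<open>A coefficient polynomial of \<open>g\<close> lies in \<open>J\<close>;
      normalised at \<open>m\<close>, it clears \<open>m\<close> from \<open>g\<close> without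
      introducing new monomials.\<close>
    define p where "p = const (inverse (lookup g m $$ j)) * fcoeff j g"
    have p: "p \<in> J"
      unfolding p_def by (rule is_idealD(4)[OF J polys_const]) (use less.prems in \<open>simp add: ext_def\<close>)
    have pm: "lookup p m = 1" using j by (simp add: p_def lookup_const_mult)
    have keys_p: "k \<in> keys g" if "lookup p k \<noteq> 0" for k
      using that by (auto simp: p_def lookup_const_mult in_keys_iff)
    define r where "r = g - const (lookup g m) * emb p"
    have r_keys: "keys r \<subseteq> keys g - {m}"
    proof
      fix k assume k: "k \<in> keys r"
      then have "lookup g k \<noteq> 0 \<or> lookup p k \<noteq> 0"
        by (auto simp: r_def in_keys_iff lookup_minus lookup_const_mult)
      then have "k \<in> keys g" using keys_p by (auto simp: in_keys_iff)
      moreover have "k \<noteq> m" using k pm by (auto simp: r_def in_keys_iff lookup_minus lookup_const_mult)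
      ultimately show "k \<in> keys g - {m}" by simp
    qed
    then have "card (keys r) < card (keys g)" using m by (intro psubset_card_mono) auto
    moreover have "r \<in> ext n J"
      unfolding ext_def
    proof (intro CollectI conjI allI)
      show "r \<in> polys n" using r_keys less.prems by (auto simp: ext_def polys_iff)
      show "fcoeff i r \<in> J" for i
        unfolding r_def fcoeff_diff fcoeff_const_emb using less.prems
        by (intro is_ideal_diff[OF J] is_idealD(4)[OF J polys_const p]) (simp add: ext_def)
    qed
    ultimately have "r \<in> K" by (rule less.hyps)
    then have "r + const (lookup g m) * emb p \<in> K" using K p by blast
    then show ?thesis by (simp add: r_def)
  qed
qed

lemma ext_add: "is_ideal n J \<Longrightarrow> p \<in> ext n J \<Longrightarrow> r \<in> ext n J \<Longrightarrow> p + r \<in> ext n J"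
  using is_idealD(3)[of n J] by (auto simp: ext_def fcoeff_add)

text \<open>Multiplication by a Laurent series mixes the coefficients, so closure under scalars is
  checked on the spanning elements. Multiplication by a monomial acts on each coefficient
  separately.\<close>

lemma ext_is_ideal:
  assumes J: "is_ideal n J"
  shows "is_ideal n (ext n J)"
proof -
  have zero: "0 \<in> ext n J" using is_idealD(2)[OF J] by (simp add: ext_def)
  have scale: "const c * p \<in> ext n J" if p: "p \<in> ext n J" for c p
  proof -
    have "p \<in> {p. const c * p \<in> ext n J}"
    proof (rule ext_in_span[OF J _ _ _ p])
      show "q + r \<in> {p. const c * p \<in> ext n J}"
        if "q \<in> {p. const c * p \<in> ext n J}" "r \<in> {p. const c * p \<in> ext n J}" for q r
        using that ext_add[OF J] by (simp add: distrib_left)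
      show "const d * emb q \<in> {p. const c * p \<in> ext n J}" if q: "q \<in> J" for d q
      proof -
        have "const c * (const d * emb q) = const (c * d) * emb q" by (simp add: const_mult mult.assoc)
        moreover have "const (c * d) * emb q \<in> ext n J"
          using is_idealD(4)[OF J polys_const q] is_idealD(1)[OF J q]
          by (simp add: ext_def fcoeff_const_emb emb_polys)
        ultimately show ?thesis by (simp only: mem_Collect_eq)
      qed
    qed (use zero in simp)
    then show ?thesis by simp
  qed
  have mult_single: "single m c * p \<in> ext n J" if m: "m \<in> monomials n" and p: "p \<in> ext n J" for m c p
  proof -
    have sm: "single m 1 \<in> (polys n :: 'a mpoly set)" using m by (simp add: polys_single)
    have "emb (single m 1) * p \<in> ext n J"
      using p sm is_idealD(4)[OF J sm] by (simp add: ext_def fcoeff_emb_mult emb_polys)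
    then have "single m 1 * p \<in> ext n J" by (simp add: emb_single)
    then have "const c * (single m 1 * p) \<in> ext n J" by (rule scale)
    then show ?thesis by (simp add: single_eq_const_mult[of m c] mult.assoc)
  qed
  show ?thesis
    unfolding is_ideal_def
  proof (intro conjI ballI zero ext_add[OF J])
    show "ext n J \<subseteq> polys n" by (auto simp: ext_def)
    fix a p :: "'a fls mpoly" assume a: "a \<in> polys n" and p: "p \<in> ext n J"
    have "(\<Sum>m\<in>T. single m (lookup a m) * p) \<in> ext n J" if "T \<subseteq> monomials n" for T
      using that
    proof (induction T rule: infinite_finite_induct)
      case (insert x F)
      then show ?case using ext_add[OF J] mult_single[OF _ p] by simp
    qed (use zero in simp_all)
    moreover have "a * p = (\<Sum>m\<in>keys a. single m (lookup a m) * p)"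
      by (simp add: poly_mapping_expand flip: sum_distrib_right)
    ultimately show "a * p \<in> ext n J" using a by (simp add: polys_iff)
  qed
qed

lemma emb_const: "emb (const c) = const (fls_const c)"
  by (simp add: const_def emb_single)

lemma regular_on_ext: "regular_on n J f \<Longrightarrow> regular_on n (ext n J) (emb f)"
  by (auto simp: regular_on_def ext_def fcoeff_emb_mult fcoeff_polys)

text \<open>Each coefficient of an element has the form h + a f, but arbitrarily chosen multipliers
  \<open>a\<close> need not assemble into one polynomial over the Laurent series. Checking the
  spanning elements avoids this choice.\<close>

lemma ext_adjoin:
  assumes J: "is_ideal n J" and f: "f \<in> polys n"
  shows "ext n (adjoin n J f) = adjoin n (ext n J) (emb f)"
proof (rule subset_antisym)
  note Jf = adjoin_ideal[OF J f] and E = ext_is_ideal[OF J]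
  have ef: "emb f \<in> polys n" using f by (simp add: emb_polys)
  note Ef = adjoin_ideal[OF E ef]
  show "ext n (adjoin n J f) \<subseteq> adjoin n (ext n J) (emb f)"
  proof
    fix g assume g: "g \<in> ext n (adjoin n J f)"
    show "g \<in> adjoin n (ext n J) (emb f)"
    proof (rule ext_in_span[OF Jf is_idealD(2)[OF Ef] is_idealD(3)[OF Ef] _ g])
      fix c p assume "p \<in> adjoin n J f"
      then obtain j a where "j \<in> J" "a \<in> polys n" "p = j + a * f" by (rule adjoinE)
      then have "emb p = emb j + emb a * emb f" "emb j \<in> ext n J" "emb a \<in> polys n"
        using ext_mem_emb[OF J] by (simp_all add: emb_add emb_mult emb_polys)
      then have "emb p \<in> adjoin n (ext n J) (emb f)" unfolding adjoin_def by blast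
      then show "const c * emb p \<in> adjoin n (ext n J) (emb f)" by (rule is_idealD(4)[OF Ef polys_const])
    qed
  qed
  show "adjoin n (ext n J) (emb f) \<subseteq> ext n (adjoin n J f)"
  proof (rule adjoin_minimal[OF ext_is_ideal[OF Jf]])
    show "ext n J \<subseteq> ext n (adjoin n J f)" using adjoin_superset[OF J, of f] by (auto simp: ext_def)
    show "emb f \<in> ext n (adjoin n J f)" by (rule ext_mem_emb[OF Jf adjoin_self[OF J]])
  qed
qed

lemma emb_irrelevant:
  fixes f :: "'k::field mpoly"
  assumes "f \<in> irrelevant_ideal n"
  shows "emb f \<in> irrelevant_ideal n"
proof -
  note I = is_idealD[OF irrelevant_is_ideal, where 'a = "'k fls"]
  have "is_ideal n {f :: 'k mpoly. f \<in> polys n \<and> emb f \<in> irrelevant_ideal n}"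
    unfolding is_ideal_def
  proof (intro conjI ballI)
    fix a p :: "'k mpoly"
    assume a: "a \<in> polys n" and p: "p \<in> {f. f \<in> polys n \<and> emb f \<in> irrelevant_ideal n}"
    have "emb a * emb p \<in> irrelevant_ideal n" using a p by (intro I(4)) (simp_all add: emb_polys)
    then show "a * p \<in> {f. f \<in> polys n \<and> emb f \<in> irrelevant_ideal n}" using a p by (simp add: emb_mult)
  qed (use I(2,3) in \<open>auto simp: emb_add\<close>)
  moreover have "emb (var i :: 'k mpoly) = var i" for i by (simp add: var_def emb_single)
  then have "var ` {..<n} \<subseteq> {f :: 'k mpoly. f \<in> polys n \<and> emb f \<in> irrelevant_ideal n}"
    by (auto simp: polys_var var_irrelevant)
  ultimately have "Idl\<^bsub>mpoly_ring n\<^esub> (var ` {..<n}) \<subseteq> {f :: 'k mpoly. f \<in> polys n \<and> emb f \<in> irrelevant_ideal n}"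
    by (rule Idl_minimal)
  then show ?thesis using assms by (auto simp: irrelevant_ideal_def)
qed

lemma grade_ge_ext: "is_ideal n J \<Longrightarrow> grade_ge n k J \<Longrightarrow> grade_ge n k (ext n J)"
proof (induction k arbitrary: J)
  case (Suc k)
  then obtain f where f: "f \<in> irrelevant_ideal n" "regular_on n J f" "grade_ge n k (adjoin n J f)" by auto
  have fp: "f \<in> polys n" by (rule irrelevant_polys[OF f(1)])
  have "grade_ge n k (adjoin n (ext n J) (emb f))"
    using Suc.IH[OF adjoin_ideal[OF Suc.prems(1) fp] f(3)] by (simp only: ext_adjoin[OF Suc.prems(1) fp])
  then show ?case using regular_on_ext[OF f(2)] emb_irrelevant[OF f(1)] by auto
qed simp

lemma homog_ext:
  assumes "homog n J"
  shows "homog n (ext n J)"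
proof -
  have "fcoeff j (hcomp q g) = hcomp q (fcoeff j g)" for j q and g :: "'a fls mpoly"
    by (intro poly_mapping_eqI) (simp add: lookup_part)
  then show ?thesis
    using assms ext_is_ideal[of n J] by (auto simp: homog_def ext_def part_polys)
qed

lemma one_notin_ext:
  assumes "1 \<notin> J"
  shows "1 \<notin> ext n J"
proof -
  have "fcoeff 0 (1 :: 'a fls mpoly) = 1" using fcoeff_single[of 0 0 1] by simp
  then show ?thesis using assms by (metis (mono_tags, lifting) ext_def mem_Collect_eq)
qed

lemma spanned_sum: "is_ideal n J \<Longrightarrow> (\<And>i. i \<in> T \<Longrightarrow> spanned J S b (f i)) \<Longrightarrow> spanned J S b (sum f T)"
  by (induction T rule: infinite_finite_induct)
    (auto intro: spanned_add spanned_ideal is_idealD(2))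

text \<open>The standard monomials of \<open>J\<close> remain a basis over the larger field:
  independence is read off coefficient by coefficient, and each monomial is already spanned over the
  small field.\<close>

lemma hilbert_fun_ext:
  fixes J :: "'k::field mpoly set"
  assumes J: "homog n J" "1 \<notin> J"
  shows "hilbert_fun n (ext n J) q = hilbert_fun n J q"
proof -
  let ?S = "of_deg q (std n J)"
  note ideal = homog_ideal[OF J(1)] and basis = std_basis[OF J(1), of q]
  note E = ext_is_ideal[OF ideal]
  have fin: "finite ?S" using basis by (simp add: graded_basis_def)
  have "graded_basis n (ext n J) q ?S (\<lambda>m. single m 1)"
    unfolding graded_basis_def
  proof (intro conjI allI impI ballI fin)
    show "(\<lambda>m. single m 1) ` ?S \<subseteq> graded_part n q" by (auto simp: graded_part_iff of_deg_def std_def)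
  next
    fix c s assume mem: "(\<Sum>s\<in>?S. const (c s) * single s 1) \<in> ext n J" and s: "s \<in> ?S"
    have "c s $$ j = 0" for j
    proof -
      have "fcoeff j (\<Sum>s\<in>?S. const (c s) * single s 1) = (\<Sum>s\<in>?S. const (c s $$ j) * single s 1)"
        by (simp add: fcoeff_sum fcoeff_single flip: single_eq_const_mult)
      moreover have "fcoeff j (\<Sum>s\<in>?S. const (c s) * single s 1) \<in> J"
        using mem by (simp only: ext_def mem_Collect_eq simp_thms)
      ultimately have "(\<Sum>s\<in>?S. const (c s $$ j) * single s 1) \<in> J" by (simp only:)
      then show ?thesis using graded_basis_independent[OF basis, of "\<lambda>s. c s $$ j"] s by blast
    qed
    then show "c s = 0" by (simp add: fls_eq_iff)
  next
    fix p :: "'k fls mpoly" assume p: "p \<in> graded_part n q"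
    have mono: "spanned (ext n J) ?S (\<lambda>m. single m 1) (single m 1)" if m: "m \<in> keys p" for m
    proof -
      have "single m 1 \<in> (graded_part n q :: 'k mpoly set)"
        using m p by (auto simp: graded_part_iff)
      then obtain c where c: "single m 1 - (\<Sum>s\<in>?S. const (c s) * single s 1) \<in> J"
        using basis by (auto simp: graded_basis_def spanned_def)
      have "emb (single m 1 - (\<Sum>s\<in>?S. const (c s) * single s 1) + (\<Sum>s\<in>?S. const (c s) * single s 1)) = single m 1"
        by (simp add: emb_single)
      then have "emb (single m 1 - (\<Sum>s\<in>?S. const (c s) * single s 1))
          = single m 1 - (\<Sum>s\<in>?S. const (fls_const (c s)) * single s 1)"
        unfolding emb_add by (simp add: emb_sum emb_mult emb_const emb_single eq_diff_eq)
      then have "single m 1 - (\<Sum>s\<in>?S. const (fls_const (c s)) * single s 1) \<in> ext n J"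
        using ext_mem_emb[OF ideal c] by simp
      then show ?thesis by (rule spannedI)
    qed
    have "p = (\<Sum>m\<in>keys p. const (lookup p m) * single m 1)"
      by (simp add: poly_mapping_expand flip: single_eq_const_mult)
    moreover have "spanned (ext n J) ?S (\<lambda>m. single m 1) (\<Sum>m\<in>keys p. const (lookup p m) * single m 1)"
      by (intro spanned_sum[OF E] spanned_const_mult[OF E] mono)
    ultimately show "spanned (ext n J) ?S (\<lambda>m. single m 1) p" by simp
  qed
  from hilbert_fun_eq_card[OF E one_notin_ext[OF J(2)] this] show ?thesis
    using hilbert_fun_std[OF J] by simp
qed

section \<open>Monomial ideals\<close>

definition mon_ideal :: "nat \<Rightarrow> monomial set \<Rightarrow> 'k::field mpoly set" where
  "mon_ideal n N = {p \<in> polys n. keys p \<inter> N = {}}"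

lemma mon_ideal_is_ideal:
  assumes "down_closed N"
  shows "is_ideal n (mon_ideal n N :: 'k::field mpoly set)"
  unfolding is_ideal_def
proof (intro conjI ballI)
  show "p + r \<in> mon_ideal n N" if "p \<in> mon_ideal n N" "r \<in> mon_ideal n N" for p r :: "'k mpoly"
    using that Poly_Mapping.keys_add[of p r] by (auto simp: mon_ideal_def)
  show "a * p \<in> mon_ideal n N" if a: "a \<in> polys n" and p: "p \<in> mon_ideal n N" for a p :: "'k mpoly"
  proof -
    have "m \<notin> N" if m: "m \<in> keys (a * p)" for m
    proof
      assume "m \<in> N"
      obtain x y where xy: "m = x + y" "y \<in> keys p" using m keys_mult[of a p] by blast
      then have "y \<in> N" using down_closed_add[OF assms, of y x] \<open>m \<in> N\<close> by (simp add: add.commute)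
      then show False using xy p by (auto simp: mon_ideal_def)
    qed
    then show ?thesis using a p by (auto simp: mon_ideal_def)
  qed
qed (auto simp: mon_ideal_def)

lemma homogeneous_mon_ideal:
  assumes "down_closed N"
  shows "homogeneous_ideal n (mon_ideal n N :: 'k::field mpoly set)"
proof -
  let ?G = "(\<lambda>m. single m (1::'k)) ` (monomials n - N)"
  have sub: "?G \<subseteq> polys n" by (auto simp: polys_single)
  note I = Idl_is_ideal[OF sub]
  have "mon_ideal n N \<subseteq> Idl\<^bsub>mpoly_ring n\<^esub> ?G"
  proof
    fix p :: "'k mpoly" assume p: "p \<in> mon_ideal n N"
    have "(\<Sum>m\<in>keys p. const (lookup p m) * single m 1) \<in> Idl\<^bsub>mpoly_ring n\<^esub> ?G"
    proof (intro is_ideal_sum[OF I] is_idealD(4)[OF I polys_const])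
      fix m assume "m \<in> keys p"
      then have "m \<in> monomials n - N" using p by (auto simp: mon_ideal_def polys_iff)
      then show "single m 1 \<in> Idl\<^bsub>mpoly_ring n\<^esub> ?G" using Idl_superset[OF sub] by blast
    qed
    then show "p \<in> Idl\<^bsub>mpoly_ring n\<^esub> ?G"
      by (simp add: poly_mapping_expand flip: single_eq_const_mult)
  qed
  moreover have "Idl\<^bsub>mpoly_ring n\<^esub> ?G \<subseteq> mon_ideal n N"
    by (rule Idl_minimal[OF mon_ideal_is_ideal[OF assms]]) (auto simp: mon_ideal_def polys_single)
  moreover have "?G \<subseteq> (\<Union>q. graded_part n q)"
    by (auto simp: graded_part_iff of_deg_def)
  ultimately show ?thesis unfolding homogeneous_ideal_def by blast
qed

lemma one_notin_mon_ideal: "0 \<in> N \<Longrightarrow> 1 \<notin> mon_ideal n N"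
  by (simp add: mon_ideal_def)

lemma hilbert_fun_mon_ideal:
  assumes "down_closed N" "0 \<in> N" "N \<subseteq> monomials n"
  shows "hilbert_fun n (mon_ideal n N :: 'k::field mpoly set) q = card (of_deg q N)"
proof -
  let ?J = "mon_ideal n N :: 'k mpoly set" and ?S = "of_deg q N"
  have fin: "finite ?S" by (rule finite_of_deg_monomials[OF assms(3)])
  have "graded_basis n ?J q ?S (\<lambda>m. single m 1)"
    unfolding graded_basis_def
  proof (intro conjI allI impI ballI fin)
    show "(\<lambda>m. single m 1) ` ?S \<subseteq> graded_part n q"
      using assms(3) by (auto simp: graded_part_iff of_deg_def)
  next
    fix c s assume mem: "(\<Sum>s\<in>?S. const (c s) * single s 1) \<in> ?J" and s: "s \<in> ?S"
    have "lookup (\<Sum>s\<in>?S. const (c s) * single s 1) s = c s"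
      using lookup_sum_single[OF fin, of c s] s by (simp flip: single_eq_const_mult)
    moreover have "s \<in> N" using s by (simp add: of_deg_def)
    then have "s \<notin> keys (\<Sum>s\<in>?S. const (c s) * single s 1)" using mem unfolding mon_ideal_def by blast
    ultimately show "c s = 0" by (simp only: in_keys_iff not_not)
  next
    fix p :: "'k mpoly" assume p: "p \<in> graded_part n q"
    have lookup: "lookup (\<Sum>s\<in>?S. const (lookup p s) * single s 1) m = (if m \<in> ?S then lookup p m else 0)" for m
      using lookup_sum_single[OF fin, of "lookup p" m] by (simp flip: single_eq_const_mult)
    have "p - (\<Sum>s\<in>?S. const (lookup p s) * single s 1) \<in> ?J"
      unfolding mon_ideal_def
    proof (intro CollectI conjI)
      show "p - (\<Sum>s\<in>?S. const (lookup p s) * single s 1) \<in> polys n"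
        using graded_part_polys[OF p] assms(3)
        by (intro polys_diff polys_sum polys_mult polys_const) (auto simp: polys_single of_deg_def)
      have "m \<notin> N" if "m \<in> keys (p - (\<Sum>s\<in>?S. const (lookup p s) * single s 1))" for m
      proof
        assume "m \<in> N"
        have "lookup p m \<noteq> (if m \<in> ?S then lookup p m else 0)"
          using that lookup[of m] by (simp add: in_keys_iff lookup_minus)
        then have "m \<in> keys p" "m \<notin> ?S" by (auto simp: in_keys_iff split: if_splits)
        then show False using p \<open>m \<in> N\<close> by (auto simp: graded_part_iff of_deg_def)
      qed
      then show "keys (p - (\<Sum>s\<in>?S. const (lookup p s) * single s 1)) \<inter> N = {}" by blast
    qed
    then show "spanned ?J ?S (\<lambda>m. single m 1) p" by (rule spannedI)
  qed
  from hilbert_fun_eq_card[OF mon_ideal_is_ideal[OF assms(1)] one_notin_mon_ideal[OF assms(2)] this]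
  show ?thesis .
qed

section \<open>Cylinders: order ideals extended by free variables\<close>

definition cylinder :: "monomial set \<Rightarrow> nat set \<Rightarrow> monomial set" where
  "cylinder M T = {a + b | a b. a \<in> M \<and> keys b \<subseteq> T}"

lemma cylinderI: "a \<in> M \<Longrightarrow> keys b \<subseteq> T \<Longrightarrow> a + b \<in> cylinder M T"
  unfolding cylinder_def by blast

lemma cylinderE:
  assumes "u \<in> cylinder M T"
  obtains a b where "a \<in> M" "keys b \<subseteq> T" "u = a + b"
  using assms unfolding cylinder_def by blast

lemma cylinder_empty: "cylinder M {} = M"
  by (auto simp: cylinder_def)

lemma cylinder_mono: "T \<subseteq> T' \<Longrightarrow> cylinder M T \<subseteq> cylinder M T'"
  unfolding cylinder_def by blast

lemma keys_minus_subset: "keys (b - c :: 'a \<Rightarrow>\<^sub>0 nat) \<subseteq> keys b"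
  by (auto simp: in_keys_iff lookup_minus)

lemma down_closed_cylinder:
  assumes "down_closed M"
  shows "down_closed (cylinder M T)"
  unfolding down_closed_def
proof (intro allI impI)
  fix u i assume "u + single i 1 \<in> cylinder M T"
  then obtain a b where ab: "a \<in> M" "keys b \<subseteq> T" "u + single i 1 = a + b" by (rule cylinderE)
  have "i \<in> keys (a + b)" unfolding ab(3)[symmetric] by (simp add: keys_add_nat)
  then consider "i \<in> keys a" | "i \<in> keys b" by (auto simp: keys_add_nat)
  then show "u \<in> cylinder M T"
  proof cases
    case 1
    have a: "a = (a - single i 1) + single i 1" by (rule monomial_minus_single[OF 1])
    then have "u + single i 1 = ((a - single i 1) + b) + single i 1" using ab(3)
      by (simp add: ac_simps)
    then have "u = (a - single i 1) + b" by simp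
    moreover have "a - single i 1 \<in> M" using assms ab(1) a unfolding down_closed_def by metis
    ultimately show ?thesis using cylinderI ab(2) by simp
  next
    case 2
    have "b = (b - single i 1) + single i 1" by (rule monomial_minus_single[OF 2])
    then have "u + single i 1 = (a + (b - single i 1)) + single i 1" using ab(3) by (metis add.assoc)
    then have "u = a + (b - single i 1)" by simp
    moreover have "keys (b - single i 1) \<subseteq> T" using keys_minus_subset[of b "single i 1"] ab(2) by blast
    ultimately show ?thesis using cylinderI ab(1) by simp
  qed
qed

text \<open>Multiplication by x_k maps the cylinder injectively into itself, so a monomial of
  \<open>g\<close> in the cylinder stays visible in the product.\<close>

lemma regular_on_cylinder:
  assumes "k \<in> T" "k < n"
  shows "regular_on n (mon_ideal n (cylinder M T) :: 'k::field mpoly set) (var k)"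
  unfolding regular_on_def
proof (intro ballI impI)
  fix g :: "'k mpoly" assume g: "g \<in> polys n" and mem: "var k * g \<in> mon_ideal n (cylinder M T)"
  have "u \<notin> cylinder M T" if u: "u \<in> keys g" for u
  proof
    assume "u \<in> cylinder M T"
    then obtain a b where ab: "a \<in> M" "keys b \<subseteq> T" "u = a + b" by (rule cylinderE)
    have "a + (b + single k 1) \<in> cylinder M T"
      using ab assms by (intro cylinderI) (auto simp: keys_add_nat)
    moreover have "single k 1 + u \<in> keys (var k * g)"
      using u by (simp add: var_def keys_single_mult)
    then have "a + (b + single k 1) \<in> keys (var k * g)" by (simp add: ab(3) ac_simps)
    ultimately show False using mem by (auto simp: mon_ideal_def)
  qed
  then show "g \<in> mon_ideal n (cylinder M T)" using g by (auto simp: mon_ideal_def)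
qed

text \<open>A monomial in the cylinder over \<open>T\<close> but not over \<open>T - {k}\<close> is
  divisible by x_k, hence a multiple of the adjoined variable. Conversely, \<open>M\<close> involves
  only variables below \<open>k\<close>, which keeps x_k out of the smaller cylinder.\<close>

lemma adjoin_cylinder:
  assumes M: "down_closed M" "M \<subseteq> monomials k" and k: "k \<in> T" "k < n"
  shows "adjoin n (mon_ideal n (cylinder M T) :: 'k::field mpoly set) (var k)
    = mon_ideal n (cylinder M (T - {k}))"
proof (rule subset_antisym)
  let ?N = "cylinder M T" and ?N' = "cylinder M (T - {k})"
  have J: "is_ideal n (mon_ideal n ?N :: 'k mpoly set)"
    by (intro mon_ideal_is_ideal down_closed_cylinder M)
  have vk: "var k \<in> (polys n :: 'k mpoly set)" by (rule polys_var[OF k(2)])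
  show "adjoin n (mon_ideal n ?N) (var k) \<subseteq> (mon_ideal n ?N' :: 'k mpoly set)"
  proof (rule adjoin_minimal[OF mon_ideal_is_ideal[OF down_closed_cylinder[OF M(1)]]])
    show "mon_ideal n ?N \<subseteq> (mon_ideal n ?N' :: 'k mpoly set)"
      using cylinder_mono[of "T - {k}" T M] by (auto simp: mon_ideal_def)
    have "single k 1 \<notin> ?N'"
    proof
      assume "single k 1 \<in> ?N'"
      then obtain a b where ab: "a \<in> M" "keys b \<subseteq> T - {k}" "single k 1 = a + b" by (rule cylinderE)
      have "k \<in> keys (a + b)" unfolding ab(3)[symmetric] by simp
      moreover have "k \<notin> keys a" using M(2) ab(1) by (auto simp: monomials_def)
      ultimately show False using ab(2) by (auto simp: keys_add_nat)
    qed
    then show "var k \<in> (mon_ideal n ?N' :: 'k mpoly set)" using vk by (auto simp: mon_ideal_def var_def)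
  qed
  show "(mon_ideal n ?N' :: 'k mpoly set) \<subseteq> adjoin n (mon_ideal n ?N) (var k)"
  proof
    fix p :: "'k mpoly" assume p: "p \<in> mon_ideal n ?N'"
    note Jk = adjoin_ideal[OF J vk]
    have "single u c \<in> adjoin n (mon_ideal n ?N) (var k)" if u: "u \<in> keys p" for u and c :: 'k
    proof (cases "u \<in> ?N")
      case False
      have "single u c \<in> mon_ideal n ?N" using u p False by (auto simp: mon_ideal_def polys_iff)
      then show ?thesis using adjoin_superset[OF J] by blast
    next
      case True
      then obtain a b where ab: "a \<in> M" "keys b \<subseteq> T" "u = a + b" by (rule cylinderE)
      have "u \<notin> ?N'" using u p by (auto simp: mon_ideal_def)
      then have "k \<in> keys b" using cylinderI[OF ab(1), of b "T - {k}"] ab(2,3) by blast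
      then have uk: "u = (u - single k 1) + single k 1"
        by (intro monomial_minus_single) (simp add: ab(3) keys_add_nat)
      have "u \<in> monomials n" using u p by (auto simp: mon_ideal_def polys_iff)
      then have "u - single k 1 \<in> monomials n"
        using keys_minus_subset[of u "single k 1"] by (auto simp: monomials_def)
      then have "single (u - single k 1) c \<in> (polys n :: 'k mpoly set)" by (simp add: polys_single)
      then have "single (u - single k 1) c * var k \<in> adjoin n (mon_ideal n ?N) (var k)"
        by (rule adjoin_mem[OF J])
      moreover have "single (u - single k 1) c * var k = single u c"
        using uk by (simp add: var_def mult_single)
      ultimately show ?thesis by simp
    qed
    then have "(\<Sum>u\<in>keys p. single u (lookup p u)) \<in> adjoin n (mon_ideal n ?N) (var k)"
      by (intro is_ideal_sum[OF Jk])
    then show "p \<in> adjoin n (mon_ideal n ?N) (var k)" by (simp add: poly_mapping_expand)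
  qed
qed

section \<open>Iterated differentials of numerical functions\<close>

lemma differential_pow_0: "f 0 = 1 \<Longrightarrow> (differential ^^ p) f 0 = 1"
  by (induction p) (auto simp: differential_def)

text \<open>Nonnegativity of this value is what bounds the admissible numbers of differentials by
  H(1), hence by \<open>n\<close>.\<close>

lemma differential_pow_1: "f 0 = 1 \<Longrightarrow> (differential ^^ p) f 1 = f 1 - int p"
  by (induction p) (auto simp: differential_def differential_pow_0)

lemma differential_inj:
  assumes "f 0 = 1" "g 0 = 1" "differential f = differential g"
  shows "f = g"
proof
  fix q
  show "f q = g q"
  proof (induction q)
    case (Suc q)
    then show ?case using fun_cong[OF assms(3), of "Suc q"] by (simp add: differential_def)
  qed (use assms in simp)
qed

text \<open>The Hilbert function of the constructed ideal is compared with \<open>H\<close> only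
  after \<open>p\<close> differentials. Since the initial value is fixed at 1, summation recovers
  the function.\<close>

lemma differential_pow_inj:
  assumes "f 0 = 1" "g 0 = 1" "(differential ^^ p) f = (differential ^^ p) g"
  shows "f = g"
  using assms(3)
proof (induction p)
  case (Suc p)
  have "differential ((differential ^^ p) f) = differential ((differential ^^ p) g)"
    using Suc.prems by simp
  then have "(differential ^^ p) f = (differential ^^ p) g"
    using differential_pow_0[of f p] differential_pow_0[of g p] assms(1,2)
      differential_inj[of "(differential ^^ p) f" "(differential ^^ p) g"] by simp
  then show ?case by (rule Suc.IH)
qed simp

section \<open>Depth and differentials\<close>

lemma Idl_ideal_eq:
  assumes "is_ideal n I"
  shows "Idl\<^bsub>mpoly_ring n\<^esub> I = I"
proof (rule subset_antisym)
  show "Idl\<^bsub>mpoly_ring n\<^esub> I \<subseteq> I" by (rule Idl_minimal[OF assms order_refl])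
  show "I \<subseteq> Idl\<^bsub>mpoly_ring n\<^esub> I" by (rule Idl_superset) (use is_idealD(1)[OF assms] in blast)
qed

lemma Idl_take_Suc:
  assumes I: "is_ideal n I" and fs: "set fs \<subseteq> polys n" and i: "i < length fs"
  shows "Idl\<^bsub>mpoly_ring n\<^esub> (I \<union> set (take (Suc i) fs))
    = adjoin n (Idl\<^bsub>mpoly_ring n\<^esub> (I \<union> set (take i fs))) (fs ! i)"
proof -
  have "I \<union> set (take (Suc i) fs) = insert (fs ! i) (I \<union> set (take i fs))"
    using i by (simp add: take_Suc_conv_app_nth)
  moreover have "I \<union> set (take i fs) \<subseteq> polys n"
    using is_idealD(1)[OF I] fs set_take_subset[of i fs] by blast
  moreover have "fs ! i \<in> polys n" using fs i by auto
  ultimately show ?thesis using Idl_insert by metis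
qed

lemma ideal_proper_iff: "is_ideal n I \<Longrightarrow> I = polys n \<longleftrightarrow> 1 \<in> I"
  using is_idealD(1)[of n I] is_idealD(4)[of n I _ 1] by auto

lemma regular_sequence_grade_ge:
  assumes I: "is_ideal n I" and fs: "regular_sequence n I fs"
  shows "grade_ge n (length fs) I"
proof -
  let ?J = "\<lambda>i. Idl\<^bsub>mpoly_ring n\<^esub> (I \<union> set (take i fs))"
  have irr: "set fs \<subseteq> irrelevant_ideal n"
    and reg: "\<And>i. i < length fs \<Longrightarrow> regular_on n (?J i) (fs ! i)"
    using fs by (auto simp: regular_sequence_def Let_def regular_on_def)
  have polys: "set fs \<subseteq> polys n" using irr irrelevant_polys by blast
  have "grade_ge n (length fs - i) (?J i)" if "i \<le> length fs" for i
    using that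
  proof (induction rule: inc_induct)
    case (step i)
    then have "grade_ge n (length fs - Suc i) (adjoin n (?J i) (fs ! i))"
      using Idl_take_Suc[OF I polys, of i] by simp
    moreover have "fs ! i \<in> irrelevant_ideal n" using irr step by auto
    moreover have "length fs - i = Suc (length fs - Suc i)" using step by simp
    ultimately show ?case using reg[of i] step by auto
  qed simp
  from this[of 0] show ?thesis by (simp add: Idl_ideal_eq[OF I])
qed

text \<open>The ideal that realises \<open>D\<close> lives over the Laurent series, but
  \<open>D\<close> is a numerical function, so Macaulay's bound for the standard monomials up there
  is already the claim.\<close>

lemma regular_sequence_length:
  fixes I :: "'k::field mpoly set"
  assumes n: "1 \<le> n" and I: "homog n I" "1 \<notin> I" and fs: "regular_sequence n I fs"
  defines "D \<equiv> (differential ^^ length fs) (\<lambda>q. int (hilbert_fun n I q))"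
  shows "(\<forall>q. 0 \<le> D q) \<and> (\<forall>q\<ge>1. nat (D (q + 1)) \<le> macaulay_power (nat (D q)) q)"
proof -
  note ideal = homog_ideal[OF I(1)]
  have "grade_ge n (length fs) (ext n I)"
    by (rule grade_ge_ext[OF ideal regular_sequence_grade_ge[OF ideal fs]])
  from grade_ge_differential[OF uncountable_fls n homog_ext[OF I(1)] one_notin_ext[OF I(2)] this]
  obtain J :: "'k fls mpoly set" where J: "homog n J" "1 \<notin> J"
    and D: "(\<lambda>q. int (hilbert_fun n J q)) = D"
    unfolding D_def by (auto simp: hilbert_fun_ext[OF I])
  have Dq: "D q = int (card (of_deg q (std n J)))" for q
    using fun_cong[OF D, of q] hilbert_fun_std[OF J] by simp
  have "std n J \<subseteq> monomials n" by (auto simp: std_def)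
  then show ?thesis
    using macaulay_bound[OF _ down_closed_std[OF homog_ideal[OF J(1)]]] by (simp add: Dq)
qed

text \<open>\<open>depth\<close> is a supremum of extended naturals. The finite set \<open>P\<close>
  contains all lengths, and the empty sequence, regular because the ideal is proper, provides one;
  so the supremum is a maximum.\<close>

lemma depth_attained:
  assumes I: "is_ideal n I" "1 \<notin> I"
    and P: "finite P" "\<And>fs. regular_sequence n I fs \<Longrightarrow> length fs \<in> P"
  shows "\<exists>fs. regular_sequence n I fs \<and> depth n I = enat (length fs)
    \<and> (\<forall>gs. regular_sequence n I gs \<longrightarrow> length gs \<le> length fs)"
proof -
  let ?L = "length ` {fs. regular_sequence n I fs}"
  have "regular_sequence n I []"
    using I ideal_proper_iff[OF I(1)] by (simp add: regular_sequence_def Let_def Idl_ideal_eq)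
  then have L: "finite ?L" "?L \<noteq> {}" using P finite_subset[of ?L P] by auto
  have Max: "Max ?L \<in> ?L" by (rule Max_in[OF L])
  then obtain fs where fs: "regular_sequence n I fs" "Max ?L = length fs" by auto
  have bound: "length gs \<le> length fs" if "regular_sequence n I gs" for gs
    using Max_ge[OF L(1)] that fs(2) by auto
  have "depth n I = enat (length fs)"
    unfolding depth_def
    by (rule antisym[OF SUP_least SUP_upper2[of fs]]) (use fs bound in auto)
  then show ?thesis using fs bound by blast
qed

theorem exists_regular_sequence:
  assumes p: "p \<le> n" and H0: "H 0 = 1"
  defines "D \<equiv> (differential ^^ p) (\<lambda>q. int (H q))"
  assumes D1: "D 1 \<le> int (n - p)" and nonneg: "\<And>q. 0 \<le> D q"
    and growth: "\<And>q. 1 \<le> q \<Longrightarrow> nat (D (q + 1)) \<le> macaulay_power (nat (D q)) q"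
  shows "\<exists>I :: 'k::field mpoly set. \<exists>fs. homogeneous_ideal n I \<and> 1 \<notin> I \<and> hilbert_fun n I = H
    \<and> regular_sequence n I fs \<and> length fs = p"
proof -
  define m where "m = n - p"
  have D0: "D 0 = 1" unfolding D_def by (rule differential_pow_0) (simp add: H0)
  have "\<exists>M. M \<subseteq> monomials m \<and> down_closed M \<and> (\<forall>q. card (of_deg q M) = nat (D q))"
    by (rule exists_down_closed) (use D0 D1 growth in \<open>simp_all add: m_def\<close>)
  then obtain M where M: "M \<subseteq> monomials m" "down_closed M" "\<And>q. card (of_deg q M) = nat (D q)" by blast
  \<comment> \<open>The variables from \<open>m + i\<close> on are free: \<open>N 0\<close> belongs
    to the full extension, each element of the sequence removes one free variable, and
    \<open>N p\<close> is \<open>M\<close>.\<close>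
  define N where "N i = cylinder M {m + i..<n}" for i
  define J where "J i = (mon_ideal n (N i) :: 'k mpoly set)" for i
  define fs where "fs = (map var [m..<n] :: 'k mpoly list)"
  have len: "length fs = p" using p by (simp add: fs_def m_def)
  have "card (of_deg 0 M) = 1" using M(3)[of 0] D0 by simp
  then have "of_deg 0 M \<noteq> {}" by auto
  then have M0: "0 \<in> M" by (auto simp: of_deg_def mdeg_eq_0_iff)
  have N0: "0 \<in> N i" for i using cylinderI[OF M0, of 0 "{m + i..<n}"] by (simp add: N_def)
  have dc: "down_closed (N i)" for i unfolding N_def by (rule down_closed_cylinder[OF M(2)])
  have Nsub: "N i \<subseteq> monomials n" for i
  proof
    fix u assume "u \<in> N i"
    then obtain a b where ab: "a \<in> M" "keys b \<subseteq> {m + i..<n}" "u = a + b" unfolding N_def by (rule cylinderE)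
    then have "keys a \<subseteq> {..<m}" using M(1) by (auto simp: monomials_def)
    then show "u \<in> monomials n" using ab(2,3) by (auto simp: monomials_def m_def keys_add_nat)
  qed
  have ideal: "is_ideal n (J i)" for i unfolding J_def by (rule mon_ideal_is_ideal[OF dc])
  have hom: "homogeneous_ideal n (J i)" for i unfolding J_def by (rule homogeneous_mon_ideal[OF dc])
  have proper: "1 \<notin> J i" for i unfolding J_def by (rule one_notin_mon_ideal[OF N0])
  have reg: "regular_on n (J i) (var (m + i))" if "i < p" for i
    unfolding J_def N_def by (rule regular_on_cylinder) (use that p in \<open>auto simp: m_def\<close>)
  have step: "adjoin n (J i) (var (m + i)) = J (Suc i)" if "i < p" for i
  proof -
    have "monomials m \<subseteq> monomials (m + i)" by (auto simp: monomials_def)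
    then have "M \<subseteq> monomials (m + i)" using M(1) by blast
    moreover have "{m + i..<n} - {m + i} = {m + Suc i..<n}" by auto
    moreover have "m + i < n" using that p by (simp add: m_def)
    ultimately show ?thesis
      using adjoin_cylinder[OF M(2), of "m + i" "{m + i..<n}" n] by (simp add: J_def N_def)
  qed
  have polys: "set fs \<subseteq> polys n" by (auto simp: fs_def polys_var)
  have nth: "fs ! i = var (m + i)" if "i < p" for i using that p by (simp add: fs_def m_def)
  have Idl: "Idl\<^bsub>mpoly_ring n\<^esub> (J 0 \<union> set (take i fs)) = J i" if "i \<le> p" for i
    using that
  proof (induction i)
    case 0
    then show ?case by (simp add: Idl_ideal_eq[OF ideal])
  next
    case (Suc i)
    then show ?case using Idl_take_Suc[OF ideal polys, of i 0] len nth[of i] step[of i] by simp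
  qed
  have "regular_sequence n (J 0) fs"
    unfolding regular_sequence_def Let_def
  proof (intro conjI allI impI ballI)
    show "set fs \<subseteq> irrelevant_ideal n" by (auto simp: fs_def var_irrelevant)
    show "g \<in> Idl\<^bsub>mpoly_ring n\<^esub> (J 0 \<union> set (take i fs))"
      if "i < length fs" "g \<in> polys n" "fs ! i \<otimes>\<^bsub>mpoly_ring n\<^esub> g \<in> Idl\<^bsub>mpoly_ring n\<^esub> (J 0 \<union> set (take i fs))" for i g
      using that regular_onD[OF reg[of i]] Idl[of i] nth[of i] len by simp
    show "Idl\<^bsub>mpoly_ring n\<^esub> (J 0 \<union> set (take (length fs) fs)) \<noteq> polys n"
      using Idl[of p] len proper[of p] by auto
  qed
  moreover have "hilbert_fun n (J 0) = H"
  proof -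
    \<comment> \<open>Each of the \<open>p\<close> variables contributes one differential, down to
      \<open>J p\<close>, whose Hilbert function is \<open>D\<close> by construction.\<close>
    let ?h = "\<lambda>i q. int (hilbert_fun n (J i) q)"
    have "(differential ^^ i) (?h 0) = ?h i" if "i \<le> p" for i
      using that
    proof (induction i)
      case (Suc i)
      have "differential (?h i) = ?h (Suc i)"
        using differential_hilbert_fun[OF homogeneous_ideal_homog[OF hom] proper var_graded reg[of i]]
          Suc.prems p step[of i] by (simp add: m_def)
      then show ?case using Suc by simp
    qed simp
    then have "(differential ^^ p) (?h 0) = ?h p" by simp
    moreover have "?h p = D"
    proof
      fix q
      have "N p = M" using p by (simp add: N_def m_def cylinder_empty)
      then show "?h p q = D q"
        using hilbert_fun_mon_ideal[OF dc[of p] N0 Nsub, where 'k = 'k] M(3)[of q] nonneg[of q] by (simp add: J_def)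
    qed
    ultimately have eq: "(differential ^^ p) (?h 0) = (differential ^^ p) (\<lambda>q. int (H q))" by (simp add: D_def)
    have "?h 0 = (\<lambda>q. int (H q))"
      by (rule differential_pow_inj[OF _ _ eq]) (simp_all add: hilbert_fun_0[OF ideal proper] H0)
    from fun_cong[OF this] show ?thesis by auto
  qed
  ultimately show ?thesis using hom proper len by blast
qed

theorem theorem2p2:
  fixes n :: nat and H :: "nat \<Rightarrow> nat"
  assumes "1 \<le> n"
    and "H 0 = 1"
    and "H 1 \<le> n"
    and "\<And>q. 1 \<le> q \<Longrightarrow> H (q + 1) \<le> macaulay_power (H q) q"
  defines "AH \<equiv> {r. r \<le> n \<and>
      (\<exists>I :: 'k::field mpoly set.
         homogeneous_ideal n I \<and> I \<noteq> carrier (mpoly_ring n) \<and>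
         hilbert_fun n I = H \<and> depth n I = enat r)}"
    and "P \<equiv> {p. let D = (differential ^^ p) (\<lambda>q. int (H q)) in
      (\<forall>q. 0 \<le> D q) \<and>
      (\<forall>q\<ge>1. nat (D (q + 1)) \<le> macaulay_power (nat (D q)) q)}"
  shows "finite AH \<and> AH \<noteq> {} \<and> finite P \<and> P \<noteq> {} \<and> Max AH = Max P"
proof -
  have P_le: "p \<le> n" if "p \<in> P" for p
  proof -
    have "0 \<le> (differential ^^ p) (\<lambda>q. int (H q)) 1" using that by (simp add: P_def Let_def)
    then show ?thesis using differential_pow_1[of "\<lambda>q. int (H q)" p] assms(2,3) by simp
  qed
  then have finP: "finite P" using finite_subset[of P "{..n}"] by auto
  have "0 \<in> P" using assms(4) by (simp add: P_def)
  then have neP: "P \<noteq> {}" by blast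
  have finA: "finite AH" by (rule finite_subset[of _ "{..n}"]) (auto simp: AH_def)
  have len: "length fs \<in> P" if "homogeneous_ideal n I" "1 \<notin> I" "hilbert_fun n I = H" "regular_sequence n I fs"
    for I :: "'k mpoly set" and fs
    using regular_sequence_length[OF assms(1) homogeneous_ideal_homog[OF that(1)] that(2,4)] that(3)
    by (simp add: P_def Let_def)
  have A_P: "r \<in> P" if r: "r \<in> AH" for r
  proof -
    obtain I :: "'k mpoly set" where I: "homogeneous_ideal n I" "I \<noteq> polys n" "hilbert_fun n I = H"
      "depth n I = enat r" using r unfolding AH_def by blast
    note ideal = homog_ideal[OF homogeneous_ideal_homog[OF I(1)]]
    have proper: "1 \<notin> I" using I(2) ideal_proper_iff[OF ideal] by simp
    obtain fs where "regular_sequence n I fs" "depth n I = enat (length fs)"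
      using depth_attained[OF ideal proper finP] len[OF I(1) proper I(3)] by blast
    then show ?thesis using len[OF I(1) proper I(3)] I(4) by auto
  qed
  let ?p = "Max P"
  have p: "?p \<in> P" by (rule Max_in[OF finP neP])
  have "\<exists>I :: 'k mpoly set. \<exists>fs. homogeneous_ideal n I \<and> 1 \<notin> I \<and> hilbert_fun n I = H
    \<and> regular_sequence n I fs \<and> length fs = ?p"
  proof (rule exists_regular_sequence)
    show "?p \<le> n" by (rule P_le[OF p])
    show "H 0 = 1" by fact
    \<comment> \<open>The value at 1 is H(1) - p, which fits into the n - p variables left for the
      lexicographic ideal.\<close>
    show "(differential ^^ ?p) (\<lambda>q. int (H q)) 1 \<le> int (n - ?p)"
      using differential_pow_1[of "\<lambda>q. int (H q)" ?p] assms(2,3) P_le[OF p] by simp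
  qed (use p in \<open>simp_all add: P_def Let_def\<close>)
  then obtain I :: "'k mpoly set" and fs where I: "homogeneous_ideal n I" "1 \<notin> I" "hilbert_fun n I = H"
    and fs: "regular_sequence n I fs" "length fs = ?p" by blast
  note ideal = homog_ideal[OF homogeneous_ideal_homog[OF I(1)]]
  obtain gs where gs: "regular_sequence n I gs" "depth n I = enat (length gs)" "length fs \<le> length gs"
    using depth_attained[OF ideal I(2) finP] len[OF I] fs(1) by blast
  \<comment> \<open>The depth of this ideal lies in \<open>P\<close> as well, so it cannot exceed
    the maximum.\<close>
  have "length gs = ?p" using Max_ge[OF finP len[OF I gs(1)]] gs(3) fs(2) by simp
  then have "?p \<in> AH" using I gs(2) P_le[OF p] ideal_proper_iff[OF ideal] by (auto simp: AH_def)
  moreover have "Max AH = ?p"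
    by (rule Max_eqI[OF finA _ \<open>?p \<in> AH\<close>]) (rule Max_ge[OF finP A_P])
  ultimately show ?thesis using finA finP neP by blast
qed

end
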